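(* Let $n,k\ge 1$ be integers, let $g_k$ be a (possibly partial) Boolean function with domain $\mathrm{dom}(g_k)\subseteq\{0,1\}^k\times\{0,1\}^k$, and suppose $\rho(g_k)\le \frac{1}{2en}$. If $Q(g_k)$ and $R(g_k)$ are polynomially related, then so are $Q(f_n\Box g_k)$ and $R(f_n\Box g_k)$ for any $f_n:\{0,1\}^n\to\{0,1\}$. Explicitly: for all constants $C,a\ge 1$ there exist constants $C',a'\ge 1$ such that for all integers $n,k\ge1$, all $g_k:\mathrm{dom}(g_k)\to\{0,1\}$ with $\mathrm{dom}(g_k)\subseteq\{0,1\}^k\times\{0,1\}^k$ satisfying $\rho(g_k)\le\frac{1}{2en}$ and $R(g_k)\le C\,Q(g_k)^a$, and all $f_n:\{0,1\}^n\to\{0,1\}$, one has $R(f_n\Box g_k)\le C'\,Q(f_n\Box g_k)^{a'}$.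
   Context: Here $e$ is the base of the natural logarithm. Communication complexity: for a (possibly partial) Boolean function $F$ with $\mathrm{dom}(F)\subseteq X\times Y$, Alice receives $x$, Bob receives $y$, $(x,y)\in\mathrm{dom}(F)$, and they communicate interactively (two-way) to compute $F(x,y)$. $R(F)$ is the minimum worst-case number of bits exchanged by a randomized protocol (with unlimited shared randomness) that computes $F$ with error probability at most $1/3$ on every input in $\mathrm{dom}(F)$. $Q(F)$ is the minimum worst-case number of qubits exchanged by a quantum protocol (with unlimited prior shared entanglement) with error probability at most $1/3$ on every input in $\mathrm{dom}(F)$. Since $Q(F)=O(R(F))$ always holds, "polynomially related" means that $R$ is bounded by a polynomial in $Q$. Block composition: $f_n\Box g_k$ is the (partial) function on $(x,y)\in\{0,1\}^{nk}\times\{0,1\}^{nk}$, with $x=x_1\cdots x_n$, $y=y_1\cdots y_n$, $x_i,y_i\in\{0,1\}^k$, given by $f_n\Box g_k(x,y)=f_n(g_k(x_1,y_1),\ldots,g_k(x_n,y_n))$, defined when all $(x_i,y_i)\in\mathrm{dom}(g_k)$. Spectral discrepancy: for $I_A,I_B\subseteq\{0,1\}^k$ and $b\in\{0,1\}$, a $b$-distribution is a probability distribution $\mu_b$ on $g_k^{-1}(b)\cap(I_A\times I_B)$, viewed as a matrix in $\mathbb{R}^{I_A\times I_B}$ (zero outside the support). The spectral discrepancy $\rho(g_k)$ is the minimum $r\in\mathbb{R}$ such that there exist $I_A,I_B\subseteq\{0,1\}^k$ and $b$-distributions $\mu_b\in\mathbb{R}^{I_A\times I_B}$ for $g_k$,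 $b\in\{0,1\}$, with (1) $\sqrt{|I_A|\cdot|I_B|}\cdot\left\|\frac{\mu_0+\mu_1}{2}\right\|\le 1+r$ and (2) $\sqrt{|I_A|\cdot|I_B|}\cdot\left\|\frac{\mu_0-\mu_1}{2}\right\|\le r$, where $\|\cdot\|$ is the operator (spectral) norm. If $g_k$ does not take both values, set $\rho(g_k)=+\infty$. *)

theory Defs
  imports
    "HOL-Analysis.Analysis"
    "HOL-Probability.Probability"
    "Jordan_Normal_Form.Schur_Decomposition"
begin

(* A partial Boolean function F with dom F contained in X x Y is a map
   'x * 'y => bool option; the inputs outside dom F carry no promise. *)

definition bitstrings :: "nat \<Rightarrow> bool list set" where
  "bitstrings k = {x. length x = k}"


section \<open>Randomized communication complexity\<close>

(* Deterministic two-way protocol tree: at an inner node the named party sends one bit,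
   which may depend on its own input and (through the node) on all previous bits. *)

datatype ('x, 'y) protocol =
    Output bool
  | Alice_Bit "'x \<Rightarrow> bool" "('x, 'y) protocol" "('x, 'y) protocol"
  | Bob_Bit "'y \<Rightarrow> bool" "('x, 'y) protocol" "('x, 'y) protocol"

primrec run :: "('x, 'y) protocol \<Rightarrow> 'x \<Rightarrow> 'y \<Rightarrow> bool" where
  "run (Output b) x y = b"
| "run (Alice_Bit s p0 p1) x y = (if s x then run p1 x y else run p0 x y)"
| "run (Bob_Bit s p0 p1) x y = (if s y then run p1 x y else run p0 x y)"

primrec cost :: "('x, 'y) protocol \<Rightarrow> nat" where
  "cost (Output b) = 0"
| "cost (Alice_Bit s p0 p1) = Suc (max (cost p0) (cost p1))"
| "cost (Bob_Bit s p0 p1) = Suc (max (cost p0) (cost p1))"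

(* Unlimited shared randomness: a probability distribution on deterministic protocols. *)

definition randomized_computes :: "nat \<Rightarrow> ('x \<times> 'y \<Rightarrow> bool option) \<Rightarrow> bool" where
  "randomized_computes c F \<longleftrightarrow>
     (\<exists>P :: ('x, 'y) protocol pmf.
        (\<forall>p \<in> set_pmf P. cost p \<le> c) \<and>
        (\<forall>x y b. F (x, y) = Some b \<longrightarrow> measure_pmf.prob P {p. run p x y \<noteq> b} \<le> 1 / 3))"

definition R_cc :: "('x \<times> 'y \<Rightarrow> bool option) \<Rightarrow> nat" where
  "R_cc F = (LEAST c. randomized_computes c F)"


section \<open>Quantum communication complexity\<close>

(* A joint pure state of Alice's register (dimension a) and Bob's register (dimension b) is
   represented by its a x b matrix M of amplitudes: the state is the sum of
   M_ij |i>|j>. A local operation U of Alice maps M to U M; a local operation V of Bob maps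
   M to M V^T. *)

definition unitary_on :: "nat \<Rightarrow> complex mat \<Rightarrow> bool" where
  "unitary_on d U \<longleftrightarrow> U \<in> carrier_mat d d \<and> mat_adjoint U * U = 1\<^sub>m d"

definition projector_on :: "nat \<Rightarrow> complex mat \<Rightarrow> bool" where
  "projector_on d P \<longleftrightarrow> P \<in> carrier_mat d d \<and> mat_adjoint P = P \<and> P * P = P"

definition state_norm2 :: "complex mat \<Rightarrow> real" where
  "state_norm2 M = (\<Sum>i<dim_row M. \<Sum>j<dim_col M. (cmod (M $$ (i, j)))\<^sup>2)"

(* Transfer of one qubit. A register of dimension 2d is read as C^d (x) C^2, with index
   2i + q standing for |i>|q>; the qubit that changes hands is q. *)

definition qubit_to_bob :: "complex mat \<Rightarrow> complex mat" where
  "qubit_to_bob M = mat (dim_row M div 2) (2 * dim_col M)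
     (\<lambda>(i, j). M $$ (2 * i + j mod 2, j div 2))"

definition qubit_to_alice :: "complex mat \<Rightarrow> complex mat" where
  "qubit_to_alice M = mat (2 * dim_row M) (dim_col M div 2)
     (\<lambda>(i, j). M $$ (i div 2, 2 * j + i mod 2))"

(* quantum_states c a b Psi: some quantum protocol, after the exchange of exactly c qubits,
   leaves Alice and Bob with registers of dimension a and b in the joint state Psi x y.
   The initial state is an arbitrary input-independent joint state, which accounts for
   unlimited prior entanglement and for all private workspace. *)

inductive quantum_states :: "nat \<Rightarrow> nat \<Rightarrow> nat \<Rightarrow> ('x \<Rightarrow> 'y \<Rightarrow> complex mat) \<Rightarrow> bool" where
  start: "\<psi> \<in> carrier_mat a b \<Longrightarrow> state_norm2 \<psi> = 1 \<Longrightarrow> quantum_states 0 a b (\<lambda>x y. \<psi>)"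
| alice_sends: "quantum_states c (2 * a) b \<Psi> \<Longrightarrow> (\<And>x. unitary_on (2 * a) (U x)) \<Longrightarrow>
    quantum_states (Suc c) a (2 * b) (\<lambda>x y. qubit_to_bob (U x * \<Psi> x y))"
| bob_sends: "quantum_states c a (2 * b) \<Psi> \<Longrightarrow> (\<And>y. unitary_on (2 * b) (V y)) \<Longrightarrow>
    quantum_states (Suc c) (2 * a) b (\<lambda>x y. qubit_to_alice (\<Psi> x y * transpose_mat (V y)))"

(* Finally one party measures its own register with a projective measurement depending on its
   own input; acc x y is the probability of output 1. *)

inductive quantum_acceptance :: "nat \<Rightarrow> ('x \<Rightarrow> 'y \<Rightarrow> real) \<Rightarrow> bool" where
  alice_measures: "quantum_states c a b \<Psi> \<Longrightarrow> (\<And>x. projector_on a (P x)) \<Longrightarrow>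
    quantum_acceptance c (\<lambda>x y. state_norm2 (P x * \<Psi> x y))"
| bob_measures: "quantum_states c a b \<Psi> \<Longrightarrow> (\<And>y. projector_on b (P y)) \<Longrightarrow>
    quantum_acceptance c (\<lambda>x y. state_norm2 (\<Psi> x y * transpose_mat (P y)))"

definition quantum_computes :: "nat \<Rightarrow> ('x \<times> 'y \<Rightarrow> bool option) \<Rightarrow> bool" where
  "quantum_computes c F \<longleftrightarrow>
     (\<exists>acc. quantum_acceptance c acc \<and>
        (\<forall>x y. F (x, y) = Some True \<longrightarrow> 1 - acc x y \<le> 1 / 3) \<and>
        (\<forall>x y. F (x, y) = Some False \<longrightarrow> acc x y \<le> 1 / 3))"

definition Q_cc :: "('x \<times> 'y \<Rightarrow> bool option) \<Rightarrow> nat" where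
  "Q_cc F = (LEAST c. quantum_computes c F)"


section \<open>Block composition\<close>

(* The i-th length-k block of x, counting from 0. *)

definition block :: "nat \<Rightarrow> nat \<Rightarrow> bool list \<Rightarrow> bool list" where
  "block k i x = take k (drop (i * k) x)"

definition block_composition ::
  "nat \<Rightarrow> nat \<Rightarrow> (bool list \<Rightarrow> bool) \<Rightarrow> (bool list \<times> bool list \<Rightarrow> bool option) \<Rightarrow>
   bool list \<times> bool list \<Rightarrow> bool option" where
  "block_composition n k f g = (\<lambda>(x, y).
     if x \<in> bitstrings (n * k) \<and> y \<in> bitstrings (n * k) \<and>
        (\<forall>i<n. (block k i x, block k i y) \<in> dom g)
     then Some (f (map (\<lambda>i. the (g (block k i x, block k i y))) [0..<n]))
     else None)"


section \<open>Spectral discrepancy\<close>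

(* Operator norm of the real matrix (M i j) with rows indexed by the finite set I and
   columns by the finite set J. *)

definition operator_norm :: "'a set \<Rightarrow> 'b set \<Rightarrow> ('a \<Rightarrow> 'b \<Rightarrow> real) \<Rightarrow> real" where
  "operator_norm I J M =
     (SUP v \<in> {v. L2_set v J \<le> 1}. L2_set (\<lambda>i. \<Sum>j\<in>J. M i j * v j) I)"

definition b_distribution ::
  "(bool list \<times> bool list \<Rightarrow> bool option) \<Rightarrow> bool list set \<Rightarrow> bool list set \<Rightarrow> bool \<Rightarrow>
   (bool list \<times> bool list) pmf \<Rightarrow> bool" where
  "b_distribution g IA IB b \<mu> \<longleftrightarrow> set_pmf \<mu> \<subseteq> {z \<in> IA \<times> IB. g z = Some b}"

definition spectral_witness ::
  "nat \<Rightarrow> (bool list \<times> bool list \<Rightarrow> bool option) \<Rightarrow> real \<Rightarrow> bool" where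
  "spectral_witness k g r \<longleftrightarrow>
     (\<exists>IA IB \<mu>0 \<mu>1. IA \<subseteq> bitstrings k \<and> IB \<subseteq> bitstrings k \<and>
        b_distribution g IA IB False \<mu>0 \<and> b_distribution g IA IB True \<mu>1 \<and>
        sqrt (real (card IA) * real (card IB)) *
          operator_norm IA IB (\<lambda>x y. (pmf \<mu>0 (x, y) + pmf \<mu>1 (x, y)) / 2) \<le> 1 + r \<and>
        sqrt (real (card IA) * real (card IB)) *
          operator_norm IA IB (\<lambda>x y. (pmf \<mu>0 (x, y) - pmf \<mu>1 (x, y)) / 2) \<le> r)"

(* The minimum over r is attained (compactness) as soon as g takes both values, so it is the
   infimum; the infimum of the empty set in ereal is \<infinity>. *)

definition spectral_discrepancy ::
  "nat \<Rightarrow> (bool list \<times> bool list \<Rightarrow> bool option) \<Rightarrow> ereal" where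
  "spectral_discrepancy k g = Inf {ereal r | r. spectral_witness k g r}"

lemma spectral_discrepancy_infinite:
  assumes "\<not> (\<exists>z. g z = Some b)"
  shows "spectral_discrepancy k g = \<infinity>"
proof -
  have "\<not> b_distribution g IA IB b \<mu>" for IA IB \<mu>
    using assms set_pmf_not_empty[of \<mu>] unfolding b_distribution_def by auto
  then have "\<not> spectral_witness k g r" for r
    unfolding spectral_witness_def by (cases b) auto
  then show ?thesis
    by (simp add: spectral_discrepancy_def top_ereal_def)
qed

end

theory Submission
  imports Defs "HOL-Probability.Product_PMF"
begin

text \<open>
  In the Heisenberg picture the acceptance probability of a \<open>c\<close>-qubit protocol is a sum of
  \<open>4 ^ c\<close> inner products of vectors of norm at most 1, each vector depending on one input only, so
  its correlation with a matrix \<open>W\<close> is at most \<open>4 ^ c\<close> times the normalized operator norm of \<open>W\<close>.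
  Averaging the acceptance probability over products of the two witness distributions yields a
  function on the cube whose Fourier coefficient at \<open>S\<close> is the correlation with a tensor product of
  \<open>(\<mu>0 - \<mu>1) / 2\<close> on \<open>S\<close> and \<open>(\<mu>0 + \<mu>1) / 2\<close> off \<open>S\<close>. Small spectral discrepancy makes the
  coefficients of degree above \<open>c + 2\<close> negligible, so \<open>f\<close> has approximate degree at most \<open>c + 2\<close>.
  A Markov-type inequality then bounds the block sensitivity of \<open>f\<close> by \<open>O(c\<^sup>2)\<close>, hence its decision
  tree depth by \<open>O(c\<^sup>8)\<close>. The parties simulate such a tree, answering each query by an amplified
  protocol for \<open>g\<close>. Finally, \<open>g\<close> or its negation is a restriction of the composed function when
  \<open>f\<close> is not constant, which compares the quantum complexities of \<open>g\<close> and of the composition.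
\<close>

text \<open>The final state depends on both inputs, so it does not factor directly. Pulling the
  measurement back through the rounds keeps one operator a function of \<open>x\<close> alone and
  the other a function of \<open>y\<close> alone until both meet the fixed initial state. The
  dimension of the entanglement never enters, and every transferred qubit costs a factor 4. The
  cutoff: the coefficient at \<open>S\<close> is at most
  \<open>4 ^ c * r ^ card S * (1 + r) ^ (n - card S)\<close>. Once \<open>card S\<close> is at least
  \<open>c + 3\<close>, the factor \<open>4 ^ c\<close> is at most \<open>4 ^ card S / 64\<close>,
  so the tail sums to at most \<open>(1 + 5 * r) ^ n / 64\<close>, which is at most 1/16 if
  \<open>r * n \<le> 1 / 4\<close>; the discrepancy hypothesis provides such an \<open>r\<close>
  because e > 2. The exponent \<open>48 + a\<close>: block sensitivity is at most
  \<open>K = 22 * (c + 2)\<^sup>2\<close> and tree depth at most \<open>D = K ^ 4\<close>. Each of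
  at most \<open>D\<close> queries is amplified to error \<open>1 / (3 * D)\<close> at a cost factor
  of order \<open>D ^ 5\<close>, so \<open>D ^ 6 = K ^ 24\<close> multiplies \<open>R_cc g\<close>,
  whose own bound adds \<open>a\<close>.\<close>

section \<open>Quantum protocols\<close>

lemma index_mult_sum:
  assumes "A \<in> carrier_mat n m" "B \<in> carrier_mat m p" "i < n" "j < p"
  shows "(A * B) $$ (i, j) = (\<Sum>k<m. A $$ (i, k) * B $$ (k, j))"
  using assms by (simp add: scalar_prod_def lessThan_atLeast0)

lemma index_mat_adjoint [simp]:
  fixes A :: "complex mat"
  assumes "i < dim_col A" "j < dim_row A"
  shows "mat_adjoint A $$ (i, j) = cnj (A $$ (j, i))"
  using assms by (simp add: mat_adjoint_def mat_of_rows_def)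

lemma dim_mat_adjoint [simp]:
  fixes A :: "complex mat"
  shows "dim_row (mat_adjoint A) = dim_col A" "dim_col (mat_adjoint A) = dim_row A"
  by (simp_all add: mat_adjoint_def)

lemma mat_adjoint_carrier [simp, intro]:
  fixes A :: "complex mat"
  shows "A \<in> carrier_mat n m \<Longrightarrow> mat_adjoint A \<in> carrier_mat m n"
  by (auto intro!: carrier_matI)

lemma mat_adjoint_mat_adjoint [simp]:
  fixes A :: "complex mat"
  shows "mat_adjoint (mat_adjoint A) = A"
  by (intro eq_matI) auto

lemma mat_adjoint_transpose:
  fixes A :: "complex mat"
  shows "mat_adjoint (transpose_mat A) = transpose_mat (mat_adjoint A)"
  by (intro eq_matI) auto

text \<open>Hilbert--Schmidt inner product, conjugate-linear in the first argument.\<close>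

definition hs :: "complex mat \<Rightarrow> complex mat \<Rightarrow> complex" where
  "hs A B = (\<Sum>i<dim_row A. \<Sum>j<dim_col A. cnj (A $$ (i, j)) * B $$ (i, j))"

lemma hs_self: "hs M M = of_real (state_norm2 M)"
proof -
  have "cnj z * z = of_real ((cmod z)\<^sup>2)" for z
    by (metis complex_norm_square mult.commute)
  then show ?thesis by (simp add: hs_def state_norm2_def)
qed

lemma state_norm2_hs: "state_norm2 M = Re (hs M M)"
  by (simp add: hs_self)

lemma hs_add_left:
  assumes "A \<in> carrier_mat n m" "B \<in> carrier_mat n m"
  shows "hs (A + B) D = hs A D + hs B D"
  using assms by (simp add: hs_def distrib_right sum.distrib)

lemma hs_add_right:
  assumes "A \<in> carrier_mat n m" "B \<in> carrier_mat n m" "D \<in> carrier_mat n m"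
  shows "hs D (A + B) = hs D A + hs D B"
  using assms by (simp add: hs_def distrib_left sum.distrib)

lemma hs_mult_left:
  assumes A: "A \<in> carrier_mat n m" and M: "M \<in> carrier_mat m p" and N: "N \<in> carrier_mat n p"
  shows "hs (A * M) N = hs M (mat_adjoint A * N)"
proof -
  have "hs (A * M) N = (\<Sum>i<n. \<Sum>j<p. \<Sum>k<m. cnj (A $$ (i, k)) * cnj (M $$ (k, j)) * N $$ (i, j))"
    using A M by (simp add: hs_def index_mult_sum[OF A M] sum_distrib_right del: index_mult_mat(1))
  also have "\<dots> = (\<Sum>k<m. \<Sum>j<p. \<Sum>i<n. cnj (A $$ (i, k)) * cnj (M $$ (k, j)) * N $$ (i, j))"
    by (subst (1 2) sum.swap, subst sum.swap) (rule refl)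
  also have "\<dots> = hs M (mat_adjoint A * N)"
    using A M by (simp add: hs_def index_mult_sum[OF mat_adjoint_carrier[OF A] N]
        sum_distrib_left mult_ac del: index_mult_mat(1))
  finally show ?thesis .
qed

lemma hs_mult_right:
  assumes A: "A \<in> carrier_mat m p" and M: "M \<in> carrier_mat n m" and N: "N \<in> carrier_mat n p"
  shows "hs (M * A) N = hs M (N * mat_adjoint A)"
proof -
  have "hs (M * A) N = (\<Sum>i<n. \<Sum>j<p. \<Sum>k<m. cnj (M $$ (i, k)) * cnj (A $$ (k, j)) * N $$ (i, j))"
    using A M by (simp add: hs_def index_mult_sum[OF M A] sum_distrib_right del: index_mult_mat(1))
  also have "\<dots> = (\<Sum>i<n. \<Sum>k<m. \<Sum>j<p. cnj (M $$ (i, k)) * cnj (A $$ (k, j)) * N $$ (i, j))"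
    by (intro sum.cong refl sum.swap)
  also have "\<dots> = hs M (N * mat_adjoint A)"
    using A M by (simp add: hs_def index_mult_sum[OF N mat_adjoint_carrier[OF A]]
        sum_distrib_left mult_ac del: index_mult_mat(1))
  finally show ?thesis .
qed

lemma hs_mult_left':
  assumes "A \<in> carrier_mat n m" "M \<in> carrier_mat n p" "N \<in> carrier_mat m p"
  shows "hs M (A * N) = hs (mat_adjoint A * M) N"
  using hs_mult_left[OF mat_adjoint_carrier[OF assms(1)] assms(2,3)] by simp

section \<open>Contractions, unitaries and projectors\<close>

lemma state_norm2_nonneg: "0 \<le> state_norm2 M"
  by (simp add: state_norm2_def sum_nonneg)

lemma state_norm2_transpose: "state_norm2 (transpose_mat M) = state_norm2 M"
  unfolding state_norm2_def by (subst sum.swap) simp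

text \<open>Operator norm at most 1. The number \<open>p\<close> of columns is arbitrary because
  \<open>X\<close> acts on one register of a joint state while the other register may have any
  dimension.\<close>

definition contraction :: "nat \<Rightarrow> nat \<Rightarrow> complex mat \<Rightarrow> bool" where
  "contraction m n X \<longleftrightarrow> X \<in> carrier_mat m n \<and>
     (\<forall>p. \<forall>M \<in> carrier_mat n p. state_norm2 (X * M) \<le> state_norm2 M)"

lemma contraction_carrier: "contraction m n X \<Longrightarrow> X \<in> carrier_mat m n"
  by (simp add: contraction_def)

lemma contractionD: "contraction m n X \<Longrightarrow> M \<in> carrier_mat n p \<Longrightarrow> state_norm2 (X * M) \<le> state_norm2 M"
  by (auto simp: contraction_def)

lemma contraction_mult:
  assumes "contraction m n X" "contraction n l Y"
  shows "contraction m l (X * Y)"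
  unfolding contraction_def
proof (intro conjI allI ballI)
  show "X * Y \<in> carrier_mat m l" using assms by (meson contraction_carrier mult_carrier_mat)
  fix p and M :: "complex mat" assume M: "M \<in> carrier_mat l p"
  have c: "X \<in> carrier_mat m n" "Y \<in> carrier_mat n l" using assms by (auto simp: contraction_carrier)
  have "state_norm2 (X * Y * M) = state_norm2 (X * (Y * M))"
    using assoc_mult_mat[OF c M] by simp
  also have "\<dots> \<le> state_norm2 (Y * M)" using assms(1) c M by (intro contractionD) auto
  also have "\<dots> \<le> state_norm2 M" using assms(2) M by (rule contractionD)
  finally show "state_norm2 (X * Y * M) \<le> state_norm2 M" .
qed

lemma isometry_norm:
  assumes X: "X \<in> carrier_mat m n" and "mat_adjoint X * X = 1\<^sub>m n" and M: "M \<in> carrier_mat n p"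
  shows "state_norm2 (X * M) = state_norm2 M"
proof -
  have "hs (X * M) (X * M) = hs M (mat_adjoint X * (X * M))"
    using X M by (intro hs_mult_left) auto
  also have "mat_adjoint X * (X * M) = M"
    using assms assoc_mult_mat[OF mat_adjoint_carrier[OF X] X M] by simp
  finally show ?thesis by (simp add: state_norm2_hs)
qed

lemma contraction_isometry:
  assumes "X \<in> carrier_mat m n" "mat_adjoint X * X = 1\<^sub>m n"
  shows "contraction m n X"
  using assms isometry_norm[OF assms] by (simp add: contraction_def)

lemma contraction_one: "contraction n n (1\<^sub>m n)"
  by (simp add: contraction_def)

text \<open>\<open>unitary_on\<close> asks for a left inverse only; for square matrices it is
  two-sided.\<close>

lemma unitary_on_adjoint: "unitary_on d U \<Longrightarrow> unitary_on d (mat_adjoint U)"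
  using mat_mult_left_right_inverse[of "mat_adjoint U" d U] by (auto simp: unitary_on_def)

lemma contraction_unitary: "unitary_on d U \<Longrightarrow> contraction d d U"
  by (auto simp: unitary_on_def intro: contraction_isometry)

lemma state_norm2_unitary:
  "unitary_on d U \<Longrightarrow> M \<in> carrier_mat d p \<Longrightarrow> state_norm2 (U * M) = state_norm2 M"
  by (auto simp: unitary_on_def intro: isometry_norm)

text \<open>Self-adjointness and idempotence give \<open>mat_adjoint P * P = P\<close>. The
  quadratic acceptance probability thereby becomes linear in \<open>P\<close>, as the backward
  evolution requires.\<close>

lemma hs_projector:
  assumes "projector_on d P" and M: "M \<in> carrier_mat d p"
  shows "hs (P * M) (P * M) = hs (P * M) M"
proof -
  have P: "P \<in> carrier_mat d d" "mat_adjoint P = P" "P * P = P"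
    using assms by (auto simp: projector_on_def)
  have "hs (P * M) (P * M) = hs (P * (P * M)) M"
    using hs_mult_left'[OF P(1) mult_carrier_mat[OF P(1) M] M] by (simp add: P(2))
  also have "P * (P * M) = P * M"
    using P assoc_mult_mat[OF P(1) P(1) M] by simp
  finally show ?thesis .
qed

lemma projector_on_compl:
  assumes "projector_on d P" shows "projector_on d (1\<^sub>m d - P)"
proof -
  have P: "P \<in> carrier_mat d d" "mat_adjoint P = P" "P * P = P"
    using assms by (auto simp: projector_on_def)
  have ij: "cnj (P $$ (j, i)) = P $$ (i, j)" if "i < d" "j < d" for i j
    using P(1) that by (subst (2) P(2)[symmetric]) simp
  have "mat_adjoint (1\<^sub>m d - P) = 1\<^sub>m d - P"
    using P(1) by (intro eq_matI) (auto simp: ij)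
  moreover have "(1\<^sub>m d - P) * (1\<^sub>m d - P) = 1\<^sub>m d - P"
  proof -
    have "(1\<^sub>m d - P) * (1\<^sub>m d - P) = (1\<^sub>m d - P) * 1\<^sub>m d - (1\<^sub>m d - P) * P"
      using P(1) by (intro mult_minus_distrib_mat) auto
    also have "(1\<^sub>m d - P) * P = 1\<^sub>m d * P - P * P"
      using P(1) by (intro minus_mult_distrib_mat) auto
    also have "\<dots> = 0\<^sub>m d d" using P by auto
    finally show ?thesis using P(1) by auto
  qed
  ultimately show ?thesis using P(1) by (auto simp: projector_on_def intro: minus_carrier_mat)
qed

lemma state_norm2_projector:
  assumes "projector_on d P" and M: "M \<in> carrier_mat d p"
  shows "state_norm2 (P * M) + state_norm2 ((1\<^sub>m d - P) * M) = state_norm2 M"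
proof -
  have P: "P \<in> carrier_mat d d" using assms by (auto simp: projector_on_def)
  have "hs (P * M) M + hs ((1\<^sub>m d - P) * M) M = hs (P * M + (1\<^sub>m d - P) * M) M"
    using P M by (intro hs_add_left[symmetric]) (auto intro!: minus_carrier_mat mult_carrier_mat)
  also have "P * M + (1\<^sub>m d - P) * M = (P + (1\<^sub>m d - P)) * M"
    using P M by (intro add_mult_distrib_mat[symmetric]) (auto intro: minus_carrier_mat)
  also have "P + (1\<^sub>m d - P) = 1\<^sub>m d" using P by auto
  finally show ?thesis
    using M by (simp add: state_norm2_hs hs_projector[OF assms]
        hs_projector[OF projector_on_compl[OF assms(1)] M] flip: plus_complex.sel(1))
qed

lemma contraction_projector: "projector_on d P \<Longrightarrow> contraction d d P"
  unfolding contraction_def projector_on_def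
  by (metis (no_types) le_add_same_cancel1 projector_on_def state_norm2_nonneg state_norm2_projector)

text \<open>The compression \<open>|i\<rangle>|q'\<rangle> \<mapsto> \<delta>\<^bsub>q q'\<^esub> |i\<rangle>\<close>, with the index convention \<open>2 i + q\<close> of registers.\<close>

definition qsel :: "nat \<Rightarrow> nat \<Rightarrow> complex mat" where
  "qsel q a = mat a (2 * a) (\<lambda>(i, j). if j = 2 * i + q then 1 else 0)"

lemma qsel_carrier [simp]: "qsel q a \<in> carrier_mat a (2 * a)"
  by (simp add: qsel_def)

lemma qsel_adjoint: "mat_adjoint (qsel q a) = transpose_mat (qsel q a)"
  by (intro eq_matI) (auto simp: qsel_def)

lemma index_qsel_mult:
  assumes "M \<in> carrier_mat (2 * a) p" "i < a" "j < p" "q < 2"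
  shows "(qsel q a * M) $$ (i, j) = M $$ (2 * i + q, j)"
proof -
  have "(qsel q a * M) $$ (i, j) = (\<Sum>k<2 * a. if k = 2 * i + q then M $$ (k, j) else 0)"
    unfolding index_mult_sum[OF qsel_carrier assms(1,2,3)]
    using assms by (intro sum.cong) (auto simp: qsel_def)
  then show ?thesis using assms by simp
qed

lemma index_mult_qsel:
  assumes "M \<in> carrier_mat p b" "i < p" "j < 2 * b" "q < 2"
  shows "(M * qsel q b) $$ (i, j) = (if j mod 2 = q then M $$ (i, j div 2) else 0)"
proof -
  have "(M * qsel q b) $$ (i, j) = (\<Sum>k<b. if k = j div 2 then (if j mod 2 = q then M $$ (i, k) else 0) else 0)"
    unfolding index_mult_sum[OF assms(1) qsel_carrier assms(2,3)]
    using assms by (intro sum.cong) (auto simp: qsel_def)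
  then show ?thesis using assms by auto
qed

lemma qsel_transpose: assumes "q < 2" shows "qsel q a * transpose_mat (qsel q a) = 1\<^sub>m a"
proof (intro eq_matI)
  fix i j assume "i < dim_row (1\<^sub>m a)" "j < dim_col (1\<^sub>m a)"
  then have ij: "i < a" "j < a" by auto
  have "(qsel q a * transpose_mat (qsel q a)) $$ (i, j) = transpose_mat (qsel q a) $$ (2 * i + q, j)"
    using ij assms by (intro index_qsel_mult) auto
  then show "(qsel q a * transpose_mat (qsel q a)) $$ (i, j) = 1\<^sub>m a $$ (i, j)"
    using ij assms by (auto simp: qsel_def)
qed (auto simp: qsel_def)

lemma contraction_qsel_transpose:
  "q < 2 \<Longrightarrow> contraction (2 * a) a (transpose_mat (qsel q a))"
  by (rule contraction_isometry) (simp_all add: qsel_transpose mat_adjoint_transpose qsel_adjoint)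

lemma contraction_qsel:
  assumes "q < 2" shows "contraction a (2 * a) (qsel q a)"
  unfolding contraction_def
proof (intro conjI allI ballI)
  fix p and M :: "complex mat" assume M: "M \<in> carrier_mat (2 * a) p"
  have "state_norm2 (qsel q a * M) = (\<Sum>i<a. \<Sum>j<p. (cmod (M $$ (2 * i + q, j)))\<^sup>2)"
    using M assms by (simp add: state_norm2_def index_qsel_mult carrier_matD[OF qsel_carrier]
        del: index_mult_mat(1))
  also have "\<dots> = (\<Sum>i\<in>(\<lambda>i. 2 * i + q) ` {..<a}. \<Sum>j<p. (cmod (M $$ (i, j)))\<^sup>2)"
    by (subst sum.reindex) (auto simp: inj_on_def)
  also have "\<dots> \<le> (\<Sum>i<2 * a. \<Sum>j<p. (cmod (M $$ (i, j)))\<^sup>2)"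
    using assms by (intro sum_mono2) (auto intro: sum_nonneg)
  also have "\<dots> = state_norm2 M" using M by (simp add: state_norm2_def)
  finally show "state_norm2 (qsel q a * M) \<le> state_norm2 M" .
qed simp

text \<open>Resolve the identity on the travelling qubit: left multiplication by
  \<open>qsel q a\<close> strips the basis state q from Alice's register, right multiplication by
  \<open>qsel q b\<close> attaches it to Bob's. In this form adjoints can move the transfer from the
  state to the operators.\<close>

lemma qubit_to_bob_qsel:
  assumes M: "M \<in> carrier_mat (2 * a) b"
  shows "qubit_to_bob M = qsel 0 a * M * qsel 0 b + qsel 1 a * M * qsel 1 b"
proof (intro eq_matI)
  have c: "qsel q a * M \<in> carrier_mat a b" for q by (intro mult_carrier_mat[OF _ M]) simp
  have c': "qsel q a * M * qsel q b \<in> carrier_mat a (2 * b)" for q by (intro mult_carrier_mat[OF c]) simp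
  show "dim_row (qubit_to_bob M) = dim_row (qsel 0 a * M * qsel 0 b + qsel 1 a * M * qsel 1 b)"
     "dim_col (qubit_to_bob M) = dim_col (qsel 0 a * M * qsel 0 b + qsel 1 a * M * qsel 1 b)"
    using carrier_matD[OF c'[of 1]] M by (auto simp: qubit_to_bob_def qsel_def)
  fix i j assume "i < dim_row (qsel 0 a * M * qsel 0 b + qsel 1 a * M * qsel 1 b)"
    "j < dim_col (qsel 0 a * M * qsel 0 b + qsel 1 a * M * qsel 1 b)"
  then have ij: "i < a" "j < 2 * b" using carrier_matD[OF c'[of 1]] by auto
  have "(qsel q a * M * qsel q b) $$ (i, j) = (if j mod 2 = q then M $$ (2 * i + q, j div 2) else 0)"
    if "q < 2" for q
    unfolding index_mult_qsel[OF c ij that]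
    using index_qsel_mult[OF M ij(1) _ that, of "j div 2"] ij by auto
  moreover have "j mod 2 = 0 \<or> j mod 2 = 1" by auto
  ultimately show "qubit_to_bob M $$ (i, j) = (qsel 0 a * M * qsel 0 b + qsel 1 a * M * qsel 1 b) $$ (i, j)"
    using ij M carrier_matD[OF c'[of 1]] by (auto simp: qubit_to_bob_def simp del: index_mult_mat(1))
qed

text \<open>Transposing the amplitude matrix exchanges the parties, so facts about Bob's messages
  reduce to those about Alice's.\<close>

lemma qubit_to_alice_transpose:
  "qubit_to_alice M = transpose_mat (qubit_to_bob (transpose_mat M))"
  by (intro eq_matI) (auto simp: qubit_to_bob_def qubit_to_alice_def)

lemma qubit_to_bob_carrier: "M \<in> carrier_mat (2 * a) b \<Longrightarrow> qubit_to_bob M \<in> carrier_mat a (2 * b)"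
  by (auto simp: qubit_to_bob_def)

lemma qubit_to_alice_carrier: "M \<in> carrier_mat a (2 * b) \<Longrightarrow> qubit_to_alice M \<in> carrier_mat (2 * a) b"
  by (auto simp: qubit_to_alice_def)

lemma sum_pairs: "(\<Sum>i<2 * (a::nat). f i) = (\<Sum>i<a. f (2 * i) + (f (2 * i + 1) :: 'a :: comm_monoid_add))"
  by (induction a) (auto simp: add_ac)

lemma state_norm2_qubit_to_bob:
  assumes M: "M \<in> carrier_mat (2 * a) b"
  shows "state_norm2 (qubit_to_bob M) = state_norm2 M"
proof -
  have "state_norm2 (qubit_to_bob M) = (\<Sum>i<a. \<Sum>j<2 * b. (cmod (M $$ (2 * i + j mod 2, j div 2)))\<^sup>2)"
    using M by (simp add: state_norm2_def qubit_to_bob_def)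
  also have "\<dots> = (\<Sum>i<a. (\<Sum>j<b. (cmod (M $$ (2 * i, j)))\<^sup>2) + (\<Sum>j<b. (cmod (M $$ (2 * i + 1, j)))\<^sup>2))"
    by (simp add: sum_pairs sum.distrib)
  also have "\<dots> = (\<Sum>i<2 * a. \<Sum>j<b. (cmod (M $$ (i, j)))\<^sup>2)"
    by (simp only: sum_pairs)
  finally show ?thesis using M by (simp add: state_norm2_def)
qed

lemma quantum_states_state:
  assumes "quantum_states c a b \<Psi>"
  shows "\<Psi> x y \<in> carrier_mat a b \<and> state_norm2 (\<Psi> x y) = 1"
  using assms
proof (induction arbitrary: x y)
  case (alice_sends c a b \<Psi> U)
  then have U: "unitary_on (2 * a) (U x)" and P: "\<Psi> x y \<in> carrier_mat (2 * a) b" "state_norm2 (\<Psi> x y) = 1"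
    by auto
  have UP: "U x * \<Psi> x y \<in> carrier_mat (2 * a) b"
    using U P by (auto simp: unitary_on_def)
  show ?case
    using state_norm2_unitary[OF U P(1)] P
    by (simp add: qubit_to_bob_carrier[OF UP] state_norm2_qubit_to_bob[OF UP])
next
  case (bob_sends c a b \<Psi> V)
  then have V: "unitary_on (2 * b) (V y)" and P: "\<Psi> x y \<in> carrier_mat a (2 * b)" "state_norm2 (\<Psi> x y) = 1"
    by auto
  have V': "V y \<in> carrier_mat (2 * b) (2 * b)" using V by (auto simp: unitary_on_def)
  have PV: "\<Psi> x y * transpose_mat (V y) \<in> carrier_mat a (2 * b)"
    using V' P by auto
  have T: "transpose_mat (\<Psi> x y * transpose_mat (V y)) = V y * transpose_mat (\<Psi> x y)"
    using V' P by (subst transpose_mult) auto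
  have "state_norm2 (qubit_to_alice (\<Psi> x y * transpose_mat (V y)))
      = state_norm2 (V y * transpose_mat (\<Psi> x y))"
    unfolding qubit_to_alice_transpose state_norm2_transpose T
    using V' P(1) by (intro state_norm2_qubit_to_bob[of _ b a]) auto
  also have "\<dots> = 1"
    using state_norm2_unitary[OF V, of "transpose_mat (\<Psi> x y)" a] P by (simp add: state_norm2_transpose)
  finally show ?case using qubit_to_alice_carrier[OF PV] by simp
qed auto

section \<open>Correlation with matrices of bounded operator norm\<close>

text \<open>An upper bound on the operator norm in homogeneous form, free of suprema and of the
  normalization of \<open>v\<close>; this is the form that passes to tensor products.\<close>

definition opbound :: "'a set \<Rightarrow> 'b set \<Rightarrow> ('a \<Rightarrow> 'b \<Rightarrow> real) \<Rightarrow> real \<Rightarrow> bool" where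
  "opbound I J W B \<longleftrightarrow> (\<forall>v. L2_set (\<lambda>i. \<Sum>j\<in>J. W i j * v j) I \<le> B * L2_set v J)"

lemma opbound_bilinear:
  assumes "opbound I J W B"
  shows "\<bar>\<Sum>i\<in>I. \<Sum>j\<in>J. W i j * (u i * v j)\<bar> \<le> B * (L2_set u I * L2_set v J)"
proof -
  have "(\<Sum>i\<in>I. \<Sum>j\<in>J. W i j * (u i * v j)) = (\<Sum>i\<in>I. u i * (\<Sum>j\<in>J. W i j * v j))"
    by (simp add: sum_distrib_left mult_ac)
  also have "\<bar>\<dots>\<bar> \<le> (\<Sum>i\<in>I. \<bar>u i\<bar> * \<bar>\<Sum>j\<in>J. W i j * v j\<bar>)"
    by (rule order_trans[OF sum_abs]) (simp add: abs_mult)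
  also have "\<dots> \<le> L2_set u I * L2_set (\<lambda>i. \<Sum>j\<in>J. W i j * v j) I"
    by (rule L2_set_mult_ineq)
  also have "\<dots> \<le> L2_set u I * (B * L2_set v J)"
    using assms by (intro mult_left_mono) (auto simp: opbound_def)
  finally show ?thesis by (simp add: mult_ac)
qed

text \<open>Dual description of \<open>\<gamma>\<^sub>2\<close>-norm at most \<open>K\<close> on all finite submatrices; subadditivity is
  immediate in this form.\<close>

definition bounded_against :: "real \<Rightarrow> ('x \<Rightarrow> 'y \<Rightarrow> real) \<Rightarrow> bool" where
  "bounded_against K h \<longleftrightarrow>
     (\<forall>X Y W B. finite X \<longrightarrow> finite Y \<longrightarrow> 0 \<le> B \<longrightarrow> opbound X Y W B \<longrightarrow>
        \<bar>\<Sum>x\<in>X. \<Sum>y\<in>Y. W x y * h x y\<bar> \<le> K * B * sqrt (real (card X) * real (card Y)))"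

lemma bounded_against_add:
  fixes h h' :: "'x \<Rightarrow> 'y \<Rightarrow> real"
  assumes "bounded_against K h" "bounded_against L h'"
  shows "bounded_against (K + L) (\<lambda>x y. h x y + h' x y)"
  unfolding bounded_against_def
proof (intro allI impI)
  fix X :: "'x set" and Y :: "'y set" and W and B :: real assume *: "finite X" "finite Y" "0 \<le> B" "opbound X Y W B"
  have "\<bar>\<Sum>x\<in>X. \<Sum>y\<in>Y. W x y * h x y\<bar> \<le> K * B * sqrt (real (card X) * real (card Y))"
       "\<bar>\<Sum>x\<in>X. \<Sum>y\<in>Y. W x y * h' x y\<bar> \<le> L * B * sqrt (real (card X) * real (card Y))"
    using assms * by (auto simp: bounded_against_def)
  then show "\<bar>\<Sum>x\<in>X. \<Sum>y\<in>Y. W x y * (h x y + h' x y)\<bar> \<le> (K + L) * B * sqrt (real (card X) * real (card Y))"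
    by (simp add: distrib_left sum.distrib distrib_right)
qed

text \<open>Easy half of the duality: apply the bilinear bound for each \<open>t\<close>, then
  Cauchy-Schwarz over \<open>t\<close>. Unit vectors have total squared length at most the number of
  inputs, which yields the square root of the cardinalities. The bound does not depend on the size
  of \<open>T\<close>.\<close>

lemma bounded_against_inner_product:
  fixes u :: "'t \<Rightarrow> 'x \<Rightarrow> real" and v :: "'t \<Rightarrow> 'y \<Rightarrow> real"
  assumes "\<And>x. (\<Sum>t\<in>T. (u t x)\<^sup>2) \<le> 1" "\<And>y. (\<Sum>t\<in>T. (v t y)\<^sup>2) \<le> 1"
  shows "bounded_against 1 (\<lambda>x y. \<Sum>t\<in>T. u t x * v t y)"
  unfolding bounded_against_def
proof (intro allI impI)
  fix X :: "'x set" and Y :: "'y set" and W and B :: real assume *: "finite X" "finite Y" "0 \<le> B" "opbound X Y W B"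
  have L: "L2_set (\<lambda>t. L2_set (w t) Z) T \<le> sqrt (card Z)"
    if "\<And>z. (\<Sum>t\<in>T. (w t z)\<^sup>2) \<le> 1" for w :: "'t \<Rightarrow> 'z \<Rightarrow> real" and Z
  proof -
    have "(\<Sum>t\<in>T. (L2_set (w t) Z)\<^sup>2) = (\<Sum>z\<in>Z. \<Sum>t\<in>T. (w t z)\<^sup>2)"
      by (subst sum.swap) (simp add: L2_set_def sum_nonneg)
    also have "\<dots> \<le> (\<Sum>z\<in>Z. 1)" using that by (intro sum_mono)
    finally show ?thesis by (simp add: L2_set_def)
  qed
  have "(\<Sum>x\<in>X. \<Sum>y\<in>Y. W x y * (\<Sum>t\<in>T. u t x * v t y))
      = (\<Sum>t\<in>T. \<Sum>x\<in>X. \<Sum>y\<in>Y. W x y * (u t x * v t y))"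
    by (simp add: sum_distrib_left sum.swap[of _ Y T] sum.swap[of _ X T])
  also have "\<bar>\<dots>\<bar> \<le> (\<Sum>t\<in>T. B * (L2_set (u t) X * L2_set (v t) Y))"
    by (rule order_trans[OF sum_abs]) (intro sum_mono opbound_bilinear *)
  also have "\<dots> = B * (\<Sum>t\<in>T. \<bar>L2_set (u t) X\<bar> * \<bar>L2_set (v t) Y\<bar>)"
    by (simp add: sum_distrib_left)
  also have "\<dots> \<le> B * (L2_set (\<lambda>t. L2_set (u t) X) T * L2_set (\<lambda>t. L2_set (v t) Y) T)"
    using * by (intro mult_left_mono L2_set_mult_ineq)
  also have "\<dots> \<le> B * (sqrt (card X) * sqrt (card Y))"
    using * assms by (intro mult_left_mono mult_mono L) auto
  finally show "\<bar>\<Sum>x\<in>X. \<Sum>y\<in>Y. W x y * (\<Sum>t\<in>T. u t x * v t y)\<bar> \<le> 1 * B * sqrt (real (card X) * real (card Y))"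
    by (simp add: real_sqrt_mult)
qed

text \<open>The real part of a complex inner product is a real inner product in twice the dimension;
  the Boolean component of \<open>T\<close> selects the real or the imaginary part.\<close>

lemma bounded_against_hs:
  assumes A: "\<And>x. A x \<in> carrier_mat a b" "\<And>x. state_norm2 (A x) \<le> 1"
    and B: "\<And>y. B y \<in> carrier_mat a b" "\<And>y. state_norm2 (B y) \<le> 1"
  shows "bounded_against 1 (\<lambda>x y. Re (hs (A x) (B y)))"
proof -
  define T where "T = ({..<a} \<times> {..<b}) \<times> (UNIV :: bool set)"
  define e where "e M t = (case t of (ij, p) \<Rightarrow> if p then Re (M $$ ij) else Im (M $$ ij))"
    for M :: "complex mat" and t :: "(nat \<times> nat) \<times> bool"
  have norm: "(\<Sum>t\<in>T. (e M t)\<^sup>2) = state_norm2 M" if "M \<in> carrier_mat a b" for M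
    using that by (simp add: T_def e_def state_norm2_def cmod_power2 UNIV_bool add_ac sum.cartesian_product')
  have "Re (hs M N) = (\<Sum>t\<in>T. e M t * e N t)" if "M \<in> carrier_mat a b" for M N
    using that by (simp add: T_def e_def hs_def UNIV_bool add_ac sum.cartesian_product')
  then have "(\<lambda>x y. Re (hs (A x) (B y))) = (\<lambda>x y. \<Sum>t\<in>T. e (A x) t * e (B y) t)"
    using A by simp
  then show ?thesis
    using bounded_against_inner_product[where T = T and u = "\<lambda>t x. e (A x) t" and v = "\<lambda>t y. e (B y) t"]
      A B by (simp add: norm)
qed

section \<open>Backward evolution of the measurement\<close>

text \<open>Expanding both copies of the transferred state by \<open>qubit_to_bob_qsel\<close> gives
  four terms, cross terms included. In each, adjointness moves the selectors onto \<open>X\<close>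
  and \<open>Y\<close>, which then act on the state before the transfer.\<close>

lemma hs_qubit_to_bob:
  assumes N: "N \<in> carrier_mat (2 * a) b" and X: "X \<in> carrier_mat a a"
    and Y: "Y \<in> carrier_mat (2 * b) (2 * b)"
  shows "hs (X * qubit_to_bob N) (qubit_to_bob N * transpose_mat Y) =
    (\<Sum>q<2. \<Sum>r<2. hs (transpose_mat (qsel r a) * X * qsel q a * N)
        (N * transpose_mat (qsel q b * Y * transpose_mat (qsel r b))))"
proof -
  define T where "T q = qsel q a * N * qsel q b" for q
  have SN: "qsel q a * N \<in> carrier_mat a b" for q by (intro mult_carrier_mat[OF _ N]) simp
  have T: "T q \<in> carrier_mat a (2 * b)" for q unfolding T_def by (intro mult_carrier_mat[OF SN]) simp
  have YT: "transpose_mat Y \<in> carrier_mat (2 * b) (2 * b)" using Y by simp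
  have "hs (X * qubit_to_bob N) (qubit_to_bob N * transpose_mat Y) =
     hs (X * T 0 + X * T 1) (T 0 * transpose_mat Y + T 1 * transpose_mat Y)"
    using mult_add_distrib_mat[OF X T T] add_mult_distrib_mat[OF T T YT]
    by (simp add: qubit_to_bob_qsel[OF N] flip: T_def)
  also have "\<dots> = hs (X * T 0) (T 0 * transpose_mat Y + T 1 * transpose_mat Y)
       + hs (X * T 1) (T 0 * transpose_mat Y + T 1 * transpose_mat Y)"
    by (rule hs_add_left) (rule mult_carrier_mat[OF X T])+
  also have "\<dots> = (\<Sum>q<2. \<Sum>r<2. hs (X * T q) (T r * transpose_mat Y))"
    using hs_add_right[OF mult_carrier_mat[OF T YT] mult_carrier_mat[OF T YT] mult_carrier_mat[OF X T]]
    by (simp add: numeral_2_eq_2)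
  also have "\<dots> = (\<Sum>q<2. \<Sum>r<2. hs (transpose_mat (qsel r a) * X * qsel q a * N)
        (N * transpose_mat (qsel q b * Y * transpose_mat (qsel r b))))"
  proof (intro sum.cong refl)
    fix q r
    define A where "A = qsel q a" define A' where "A' = qsel r a"
    define B where "B = qsel q b" define B' where "B' = qsel r b"
    have c: "A \<in> carrier_mat a (2 * a)" "A' \<in> carrier_mat a (2 * a)"
      "B \<in> carrier_mat b (2 * b)" "B' \<in> carrier_mat b (2 * b)"
      by (simp_all add: A_def A'_def B_def B'_def)
    have adj: "mat_adjoint B = transpose_mat B" "mat_adjoint A' = transpose_mat A'"
      by (simp_all add: A'_def B_def qsel_adjoint)
    have AN: "A * N \<in> carrier_mat a b" "A' * N \<in> carrier_mat a b"
      using mult_carrier_mat[OF c(1) N] mult_carrier_mat[OF c(2) N] by auto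
    have XAN: "X * (A * N) \<in> carrier_mat a b" using X AN by simp
    have BY: "B' * transpose_mat Y \<in> carrier_mat b (2 * b)" using c YT by (meson mult_carrier_mat)
    have BYB: "B' * transpose_mat Y * transpose_mat B \<in> carrier_mat b b"
      using BY c by (meson mult_carrier_mat transpose_carrier_mat)
    have N1: "A' * N * B' * transpose_mat Y = A' * (N * (B' * transpose_mat Y))"
      using assoc_mult_mat[OF AN(2) c(4) YT] assoc_mult_mat[OF c(2) N BY] by simp
    have NB: "N * (B' * transpose_mat Y) \<in> carrier_mat (2 * a) (2 * b)" using N BY by simp
    have "hs (X * T q) (T r * transpose_mat Y) = hs (X * (A * N) * B) (A' * (N * (B' * transpose_mat Y)))"
      using assoc_mult_mat[OF X AN(1) c(3)] N1 by (simp add: T_def A_def A'_def B_def B'_def)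
    also have "\<dots> = hs (X * (A * N)) (A' * (N * (B' * transpose_mat Y)) * transpose_mat B)"
      using hs_mult_right[OF c(3) XAN mult_carrier_mat[OF c(2) NB]] adj by simp
    also have "A' * (N * (B' * transpose_mat Y)) * transpose_mat B
        = A' * (N * (B' * transpose_mat Y) * transpose_mat B)"
      using c NB by (intro assoc_mult_mat) auto
    also have "N * (B' * transpose_mat Y) * transpose_mat B = N * (B' * transpose_mat Y * transpose_mat B)"
      using c N BY by (intro assoc_mult_mat) auto
    also have "hs (X * (A * N)) (A' * (N * (B' * transpose_mat Y * transpose_mat B)))
        = hs (transpose_mat A' * (X * (A * N))) (N * (B' * transpose_mat Y * transpose_mat B))"
      using hs_mult_left'[OF c(2) XAN mult_carrier_mat[OF N BYB]] adj by simp
    also have "transpose_mat A' * (X * (A * N)) = transpose_mat A' * X * A * N"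
      using assoc_mult_mat[of "transpose_mat A'" "2 * a" a X a "A * N" b]
        assoc_mult_mat[of "transpose_mat A' * X" "2 * a" a A "2 * a" N b] c X AN N by simp
    also have "B' * transpose_mat Y * transpose_mat B = transpose_mat (B * Y * transpose_mat B')"
      using transpose_mult[of "B * Y" b "2 * b" "transpose_mat B'" b] transpose_mult[OF c(3) Y]
        assoc_mult_mat[OF c(4) YT, of "transpose_mat B" b] c Y by simp
    finally show "hs (X * T q) (T r * transpose_mat Y) = hs (transpose_mat (qsel r a) * X * qsel q a * N)
        (N * transpose_mat (qsel q b * Y * transpose_mat (qsel r b)))"
      by (simp add: A_def A'_def B_def B'_def)
  qed
  finally show ?thesis .
qed

lemma hs_transpose: 
  assumes "A \<in> carrier_mat n m" "B \<in> carrier_mat n m"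
  shows "hs (transpose_mat A) (transpose_mat B) = hs A B"
  using assms unfolding hs_def by (subst sum.swap) simp

lemma cnj_hs:
  assumes "A \<in> carrier_mat n m" "B \<in> carrier_mat n m"
  shows "cnj (hs A B) = hs B A"
  using assms unfolding hs_def by (simp add: mult_ac)

lemma hs_sandwich_swap:
  assumes N: "N \<in> carrier_mat n m" and X: "X \<in> carrier_mat n n" and Y: "Y \<in> carrier_mat m m"
  shows "hs (X * N) (N * transpose_mat Y) = cnj (hs (Y * transpose_mat N) (transpose_mat N * transpose_mat X))"
proof -
  have "hs (Y * transpose_mat N) (transpose_mat N * transpose_mat X)
      = hs (transpose_mat (N * transpose_mat Y)) (transpose_mat (X * N))"
    using transpose_mult[OF X N] transpose_mult[OF N, of "transpose_mat Y" m] Y by simp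
  also have "\<dots> = hs (N * transpose_mat Y) (X * N)"
    using assms by (intro hs_transpose) auto
  finally show ?thesis
    using cnj_hs[of "N * transpose_mat Y" n m "X * N"] assms by auto
qed

lemma hs_unitary_left:
  assumes U: "U \<in> carrier_mat n n" and M: "M \<in> carrier_mat n m" and X: "X \<in> carrier_mat n n"
    and Y: "Y \<in> carrier_mat m m"
  shows "hs (X * (U * M)) (U * M * transpose_mat Y) = hs (mat_adjoint U * X * U * M) (M * transpose_mat Y)"
proof -
  have "U * M * transpose_mat Y = U * (M * transpose_mat Y)"
    using U M Y by (intro assoc_mult_mat) auto
  moreover have "hs (X * (U * M)) (U * (M * transpose_mat Y))
      = hs (mat_adjoint U * (X * (U * M))) (M * transpose_mat Y)"
    using U M X Y by (intro hs_mult_left') auto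
  moreover have "mat_adjoint U * (X * (U * M)) = mat_adjoint U * X * U * M"
    using assoc_mult_mat[OF mat_adjoint_carrier[OF U] X, of "U * M" m]
        assoc_mult_mat[OF mult_carrier_mat[OF mat_adjoint_carrier[OF U] X] U M] U M by simp
  ultimately show ?thesis by simp
qed

text \<open>For the joint state \<open>M\<close> this is the real part of its expectation of the
  product operator with factors \<open>mat_adjoint X\<close> on Alice's side and \<open>Y\<close> on
  Bob's; right multiplication by \<open>transpose_mat Y\<close> is how Bob acts.\<close>

definition sandwich where
  "sandwich X Y M = Re (hs (X * M) (M * transpose_mat Y))"

lemma sandwich_transpose:
  assumes "M \<in> carrier_mat n m" "X \<in> carrier_mat n n" "Y \<in> carrier_mat m m"
  shows "sandwich X Y M = sandwich Y X (transpose_mat M)"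
  using hs_sandwich_swap[OF assms] by (simp add: sandwich_def)

lemma sandwich_qubit_to_bob:
  assumes U: "unitary_on (2 * a) U" and M: "M \<in> carrier_mat (2 * a) b"
    and X: "X \<in> carrier_mat a a" and Y: "Y \<in> carrier_mat (2 * b) (2 * b)"
  shows "sandwich X Y (qubit_to_bob (U * M)) =
    (\<Sum>q<2. \<Sum>r<2. sandwich (mat_adjoint U * (transpose_mat (qsel r a) * X * qsel q a) * U)
        (qsel q b * Y * transpose_mat (qsel r b)) M)"
proof -
  have U': "U \<in> carrier_mat (2 * a) (2 * a)" using U by (simp add: unitary_on_def)
  have c1: "transpose_mat (qsel r a) * X * qsel q a \<in> carrier_mat (2 * a) (2 * a)" for q r
    by (meson X mult_carrier_mat qsel_carrier transpose_carrier_mat)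
  have c2: "qsel q b * Y * transpose_mat (qsel r b) \<in> carrier_mat b b" for q r
    by (meson Y mult_carrier_mat qsel_carrier transpose_carrier_mat)
  show ?thesis
    unfolding sandwich_def hs_qubit_to_bob[OF mult_carrier_mat[OF U' M] X Y]
    by (simp add: hs_unitary_left[OF U' M c1 c2])
qed

lemma contraction_alice:
  assumes "contraction a a X" "unitary_on (2 * a) U" "q < 2" "r < 2"
  shows "contraction (2 * a) (2 * a) (mat_adjoint U * (transpose_mat (qsel r a) * X * qsel q a) * U)"
proof -
  have "contraction (2 * a) (2 * a) (transpose_mat (qsel r a) * X * qsel q a)"
    using assms by (intro contraction_mult[of "2 * a" a] contraction_qsel contraction_qsel_transpose)
  then show ?thesis
    by (rule contraction_mult[OF contraction_mult[OF contraction_unitary[OF unitary_on_adjoint]]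
          contraction_unitary, OF assms(2) _ assms(2)])
qed

lemma contraction_bob:
  assumes "contraction (2 * b) (2 * b) Y" "q < 2" "r < 2"
  shows "contraction b b (qsel q b * Y * transpose_mat (qsel r b))"
  using assms by (intro contraction_mult[of b "2 * b"] contraction_qsel contraction_qsel_transpose)

lemma bounded_against_four:
  assumes "\<And>q r. q < 2 \<Longrightarrow> r < 2 \<Longrightarrow> bounded_against K (h q r)"
  shows "bounded_against (4 * K) (\<lambda>x y. \<Sum>q<(2::nat). \<Sum>r<(2::nat). h q r x y)"
proof -
  have "bounded_against ((K + K) + (K + K)) (\<lambda>x y. (h 0 0 x y + h 0 1 x y) + (h 1 0 x y + h 1 1 x y))"
    by (intro bounded_against_add assms) auto
  then show ?thesis by (simp add: numeral_2_eq_2)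
qed

text \<open>Induction over the rounds with \<open>X\<close> and \<open>Y\<close> arbitrary, since
  each round replaces them by four new pairs. The claim is about contractions because the pieces
  with q different from r are no longer projectors. At the start the state is fixed, so one vector
  depends on \<open>x\<close> only and the other on \<open>y\<close> only.\<close>

lemma quantum_states_bounded:
  fixes X :: "'x \<Rightarrow> complex mat" and Y :: "'y \<Rightarrow> complex mat"
  assumes "quantum_states c a b \<Psi>"
    and "\<And>x. contraction a a (X x)" and "\<And>y. contraction b b (Y y)"
  shows "bounded_against (4 ^ c) (\<lambda>x y. sandwich (X x) (Y y) (\<Psi> x y))"
  using assms
proof (induction arbitrary: X Y)
  case (start \<psi> a b)
  have "state_norm2 (\<psi> * transpose_mat (Y y)) = state_norm2 (Y y * transpose_mat \<psi>)" for y
    using transpose_mult[OF start(1), of "transpose_mat (Y y)" b] contraction_carrier[OF start(4)]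
      state_norm2_transpose[of "\<psi> * transpose_mat (Y y)"] by simp
  moreover have "state_norm2 (Y y * transpose_mat \<psi>) \<le> 1" for y
    using contractionD[OF start(4), of "transpose_mat \<psi>" a] start(1,2) by (simp add: state_norm2_transpose)
  ultimately show ?case
    using start(1) contractionD[OF start(3,1)] start(2) contraction_carrier[OF start(3)]
       contraction_carrier[OF start(4)]
    unfolding sandwich_def power_0
    by (intro bounded_against_hs[of _ a b] mult_carrier_mat) auto
next
  case (alice_sends c a b \<Psi> U)
  have P: "\<Psi> x y \<in> carrier_mat (2 * a) b" for x y
    using quantum_states_state[OF alice_sends(1)] by simp
  have eq: "(\<lambda>x y. sandwich (X x) (Y y) (qubit_to_bob (U x * \<Psi> x y))) =
     (\<lambda>x y. \<Sum>q<2. \<Sum>r<2. sandwich (mat_adjoint (U x) * (transpose_mat (qsel r a) * X x * qsel q a) * U x)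
        (qsel q b * Y y * transpose_mat (qsel r b)) (\<Psi> x y))"
    by (intro ext sandwich_qubit_to_bob[OF alice_sends(2) P contraction_carrier[OF alice_sends(4)]
          contraction_carrier[OF alice_sends(5)]])
  show ?case
    unfolding eq power_Suc by (intro bounded_against_four alice_sends.IH contraction_alice contraction_bob alice_sends)
next
  case (bob_sends c a b \<Psi> V)
  have P: "\<Psi> x y \<in> carrier_mat a (2 * b)" for x y
    using quantum_states_state[OF bob_sends(1)] by simp
  have V: "V y \<in> carrier_mat (2 * b) (2 * b)" for y using bob_sends(2) by (auto simp: unitary_on_def)
  have "sandwich (X x) (Y y) (qubit_to_alice (\<Psi> x y * transpose_mat (V y))) =
     (\<Sum>q<2. \<Sum>r<2. sandwich (qsel q a * X x * transpose_mat (qsel r a))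
        (mat_adjoint (V y) * (transpose_mat (qsel r b) * Y y * qsel q b) * V y) (\<Psi> x y))" for x y
  proof -
    \<comment> \<open>Exchange the parties by transposition, treat the message as one from Alice,
      and exchange them back.\<close>
    have "sandwich (X x) (Y y) (qubit_to_alice (\<Psi> x y * transpose_mat (V y))) =
      sandwich (Y y) (X x) (transpose_mat (qubit_to_alice (\<Psi> x y * transpose_mat (V y))))"
      using P V contraction_carrier[OF bob_sends(4)] contraction_carrier[OF bob_sends(5)]
      by (intro sandwich_transpose[of _ "2 * a" b] qubit_to_alice_carrier mult_carrier_mat) auto
    also have "transpose_mat (qubit_to_alice (\<Psi> x y * transpose_mat (V y)))
        = qubit_to_bob (V y * transpose_mat (\<Psi> x y))"
      using transpose_mult[OF P[of x y], of "transpose_mat (V y)" "2 * b"] V by (simp add: qubit_to_alice_transpose)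
    also have "sandwich (Y y) (X x) \<dots> = (\<Sum>q<2. \<Sum>r<2. sandwich
        (mat_adjoint (V y) * (transpose_mat (qsel r b) * Y y * qsel q b) * V y)
        (qsel q a * X x * transpose_mat (qsel r a)) (transpose_mat (\<Psi> x y)))"
      using P contraction_carrier[OF bob_sends(4)] contraction_carrier[OF bob_sends(5)]
      by (intro sandwich_qubit_to_bob bob_sends) auto
    also have "\<dots> = (\<Sum>q<2. \<Sum>r<2. sandwich (qsel q a * X x * transpose_mat (qsel r a))
        (mat_adjoint (V y) * (transpose_mat (qsel r b) * Y y * qsel q b) * V y) (\<Psi> x y))"
      using sandwich_transpose[OF P] contraction_carrier[OF contraction_bob[OF bob_sends(4)]]
         contraction_carrier[OF contraction_alice[OF bob_sends(5,2)]] by simp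
    finally show ?thesis .
  qed
  then show ?case
    unfolding power_Suc by (auto intro!: bounded_against_four bob_sends.IH contraction_alice contraction_bob bob_sends)
qed

text \<open>By \<open>hs_projector\<close> the acceptance probability is a \<open>sandwich\<close>
  of the measuring party's projector with the identity on the other side.\<close>

theorem quantum_acceptance_bounded:
  assumes "quantum_acceptance c acc"
  shows "bounded_against (4 ^ c) acc"
  using assms
proof cases
  case (alice_measures a b \<Psi> P)
  have M: "\<Psi> x y \<in> carrier_mat a b" for x y
    using quantum_states_state[OF alice_measures(2)] by simp
  have "acc = (\<lambda>x y. sandwich (P x) (1\<^sub>m b) (\<Psi> x y))"
    unfolding alice_measures(1) sandwich_def
    using right_mult_one_mat[OF M] by (simp add: state_norm2_hs hs_projector[OF alice_measures(3) M])
  then show ?thesis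
    using quantum_states_bounded[OF alice_measures(2), of P "\<lambda>_. 1\<^sub>m b"] alice_measures(3)
    by (simp add: contraction_projector contraction_one)
next
  case (bob_measures a b \<Psi> P)
  have M: "\<Psi> x y \<in> carrier_mat a b" for x y
    using quantum_states_state[OF bob_measures(2)] by simp
  have MT: "transpose_mat (\<Psi> x y) \<in> carrier_mat b a" for x y using M by simp
  have P: "P y \<in> carrier_mat b b" for y using bob_measures(3) by (simp add: projector_on_def)
  have "state_norm2 (\<Psi> x y * transpose_mat (P y)) = sandwich (1\<^sub>m a) (P y) (\<Psi> x y)" for x y
  proof -
    have "state_norm2 (\<Psi> x y * transpose_mat (P y)) = state_norm2 (P y * transpose_mat (\<Psi> x y))"
      using state_norm2_transpose[of "\<Psi> x y * transpose_mat (P y)"]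
        transpose_mult[OF M[of x y], of "transpose_mat (P y)" b] P by simp
    also have "\<dots> = sandwich (P y) (1\<^sub>m a) (transpose_mat (\<Psi> x y))"
      unfolding sandwich_def
      using right_mult_one_mat[OF MT] by (simp add: state_norm2_hs hs_projector[OF bob_measures(3) MT])
    also have "\<dots> = sandwich (1\<^sub>m a) (P y) (\<Psi> x y)"
      using sandwich_transpose[OF M _ P] by simp
    finally show ?thesis .
  qed
  then have "acc = (\<lambda>x y. sandwich (1\<^sub>m a) (P y) (\<Psi> x y))"
    unfolding bob_measures(1) by simp
  then show ?thesis
    using quantum_states_bounded[OF bob_measures(2), of "\<lambda>_. 1\<^sub>m a" P] bob_measures(3)
    by (simp add: contraction_projector contraction_one)
qed

text \<open>Measure the complementary projector. This supplies both the upper bound 1 on acceptance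
  probabilities and protocols for negated functions.\<close>

lemma quantum_acceptance_compl:
  assumes "quantum_acceptance c acc"
  shows "quantum_acceptance c (\<lambda>x y. 1 - acc x y)"
  using assms
proof cases
  case (alice_measures a b \<Psi> P)
  have "1 - acc x y = state_norm2 ((1\<^sub>m a - P x) * \<Psi> x y)" for x y
    using quantum_states_state[OF alice_measures(2), of x y]
      state_norm2_projector[OF alice_measures(3), of "\<Psi> x y" b x] alice_measures(1) by simp
  then show ?thesis
    using quantum_acceptance.alice_measures[OF alice_measures(2) projector_on_compl[OF alice_measures(3)]]
    by simp
next
  case (bob_measures a b \<Psi> P)
  have "1 - acc x y = state_norm2 (\<Psi> x y * transpose_mat (1\<^sub>m b - P y))" for x y
  proof -
    have M: "\<Psi> x y \<in> carrier_mat a b" "state_norm2 (\<Psi> x y) = 1"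
      using quantum_states_state[OF bob_measures(2)] by auto
    have P: "P y \<in> carrier_mat b b" "1\<^sub>m b - P y \<in> carrier_mat b b"
      using bob_measures(3) projector_on_compl[OF bob_measures(3)] by (auto simp: projector_on_def)
    have "state_norm2 (\<Psi> x y * transpose_mat Q) = state_norm2 (Q * transpose_mat (\<Psi> x y))"
      if "Q \<in> carrier_mat b b" for Q
      using state_norm2_transpose[of "\<Psi> x y * transpose_mat Q"]
        transpose_mult[OF M(1), of "transpose_mat Q" b] that by simp
    then show ?thesis
      using state_norm2_projector[OF bob_measures(3), of "transpose_mat (\<Psi> x y)" a y] M P bob_measures(1)
      by (simp add: state_norm2_transpose)
  qed
  then show ?thesis
    using quantum_acceptance.bob_measures[OF bob_measures(2) projector_on_compl[OF bob_measures(3)]]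
    by simp
qed

lemma quantum_acceptance_nonneg:
  assumes "quantum_acceptance c acc" shows "0 \<le> acc x y"
  using assms by cases (simp_all add: state_norm2_nonneg)

lemma quantum_acceptance_le_1:
  assumes "quantum_acceptance c acc" shows "acc x y \<le> 1"
  using quantum_acceptance_nonneg[OF quantum_acceptance_compl[OF assms], of x y] by simp

lemma quantum_states_reindex:
  assumes "quantum_states c a b \<Psi>"
  shows "quantum_states c a b (\<lambda>x y. \<Psi> (\<alpha> x) (\<beta> y))"
  using assms
proof induction
  case (alice_sends c a b \<Psi> U)
  then show ?case
    using quantum_states.alice_sends[OF alice_sends.IH, of "\<lambda>x. U (\<alpha> x)"] by simp
next
  case (bob_sends c a b \<Psi> V)
  then show ?case
    using quantum_states.bob_sends[OF bob_sends.IH, of "\<lambda>y. V (\<beta> y)"] by simp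
qed (rule quantum_states.start)

lemma quantum_acceptance_reindex:
  assumes "quantum_acceptance c acc"
  shows "quantum_acceptance c (\<lambda>x y. acc (\<alpha> x) (\<beta> y))"
  using assms
proof cases
  case (alice_measures a b \<Psi> P)
  then show ?thesis
    using quantum_acceptance.alice_measures[OF quantum_states_reindex[OF alice_measures(2)], of "\<lambda>x. P (\<alpha> x)"]
    by simp
next
  case (bob_measures a b \<Psi> P)
  then show ?thesis
    using quantum_acceptance.bob_measures[OF quantum_states_reindex[OF bob_measures(2)], of "\<lambda>y. P (\<beta> y)"]
    by simp
qed

section \<open>Existence of an exact quantum protocol\<close>

definition unit_state :: "nat \<Rightarrow> nat \<Rightarrow> nat \<Rightarrow> nat \<Rightarrow> complex mat" where
  "unit_state a b i j = mat a b (\<lambda>p. if p = (i, j) then 1 else 0)"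

lemma unit_state_carrier [simp]: "unit_state a b i j \<in> carrier_mat a b"
  by (simp add: unit_state_def)

lemma qubit_to_bob_unit_state:
  assumes "i < 2 * a" "j < b"
  shows "qubit_to_bob (unit_state (2 * a) b i j) = unit_state a (2 * b) (i div 2) (2 * j + i mod 2)"
proof (rule eq_matI)
  fix i' j' assume "i' < dim_row (unit_state a (2 * b) (i div 2) (2 * j + i mod 2))"
    "j' < dim_col (unit_state a (2 * b) (i div 2) (2 * j + i mod 2))"
  then have ij: "i' < a" "j' < 2 * b" by (simp_all add: unit_state_def)
  have iff: "2 * i' + j' mod 2 = i \<and> j' div 2 = j \<longleftrightarrow> i' = i div 2 \<and> j' = 2 * j + i mod 2"
  proof
    assume "2 * i' + j' mod 2 = i \<and> j' div 2 = j"
    then have "i = 2 * i' + j' mod 2" "j = j' div 2" by auto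
    then show "i' = i div 2 \<and> j' = 2 * j + i mod 2" by simp
  next
    assume "i' = i div 2 \<and> j' = 2 * j + i mod 2"
    then show "2 * i' + j' mod 2 = i \<and> j' div 2 = j" by simp
  qed
  have "2 * i' + j' mod 2 < 2 * a" "j' div 2 < b" using ij by auto
  then have "qubit_to_bob (unit_state (2 * a) b i j) $$ (i', j')
      = (if 2 * i' + j' mod 2 = i \<and> j' div 2 = j then 1 else 0)"
    using ij by (simp add: qubit_to_bob_def unit_state_def)
  also have "\<dots> = unit_state a (2 * b) (i div 2) (2 * j + i mod 2) $$ (i', j')"
    unfolding iff using ij by (simp add: unit_state_def)
  finally show "qubit_to_bob (unit_state (2 * a) b i j) $$ (i', j')
      = unit_state a (2 * b) (i div 2) (2 * j + i mod 2) $$ (i', j')" .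
qed (auto simp: qubit_to_bob_def unit_state_def)

lemma unitary_on_one: "unitary_on d (1\<^sub>m d)"
proof -
  have "mat_adjoint (1\<^sub>m d) = (1\<^sub>m d :: complex mat)" by (intro eq_matI) auto
  then show ?thesis by (simp add: unitary_on_def)
qed

text \<open>Alice ships the lowest bit of a basis index in each round until her register is trivial.
  The separation property of \<open>J\<close> records that Bob's final index determines the original
  pair of indices.\<close>

lemma quantum_states_send_all:
  assumes "quantum_states c (2 ^ m) b (\<lambda>(x :: 'x) (y :: 'y). unit_state (2 ^ m) b (i x) (j x))"
    and "\<And>x. i x < 2 ^ m" "\<And>x. j x < b"
  shows "\<exists>J. quantum_states (c + m) 1 (2 ^ m * b) (\<lambda>(x :: 'x) (y :: 'y). unit_state 1 (2 ^ m * b) 0 (J x)) \<and>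
    (\<forall>x. J x < 2 ^ m * b) \<and> (\<forall>x x'. J x = J x' \<longrightarrow> i x = i x' \<and> j x = j x')"
  using assms
proof (induction m arbitrary: c b i j)
  case 0
  then have "i = (\<lambda>x. 0)" by auto
  with 0 show ?case by (intro exI[of _ j] conjI) simp_all
next
  case (Suc m)
  define j' where "j' x = 2 * j x + i x mod 2" for x
  have "quantum_states (Suc c) (2 ^ m) (2 * b)
      (\<lambda>(x :: 'x) (y :: 'y). qubit_to_bob (1\<^sub>m (2 * 2 ^ m) * unit_state (2 * 2 ^ m) b (i x) (j x)))"
    using quantum_states.alice_sends[of c "2 ^ m" b _ "\<lambda>x. 1\<^sub>m (2 * 2 ^ m)"] Suc.prems(1) unitary_on_one
    by simp
  then have "quantum_states (Suc c) (2 ^ m) (2 * b) (\<lambda>(x :: 'x) (y :: 'y). unit_state (2 ^ m) (2 * b) (i x div 2) (j' x))"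
    using Suc.prems(2,3) by (simp add: qubit_to_bob_unit_state j'_def left_mult_one_mat[OF unit_state_carrier])
  moreover have "i x div 2 < 2 ^ m" "j' x < 2 * b" for x
    using Suc.prems(2,3)[of x] by (auto simp: j'_def)
  ultimately obtain J where J: "quantum_states (Suc c + m) 1 (2 ^ m * (2 * b)) (\<lambda>(x :: 'x) (y :: 'y). unit_state 1 (2 ^ m * (2 * b)) 0 (J x))"
    "\<And>x. J x < 2 ^ m * (2 * b)" "\<And>x x'. J x = J x' \<Longrightarrow> i x div 2 = i x' div 2 \<and> j' x = j' x'"
    using Suc.IH[of "Suc c" "2 * b" "\<lambda>x. i x div 2" j'] by blast
  have "i x = i x' \<and> j x = j x'" if "J x = J x'" for x x'
  proof -
    have "j' x div 2 = j x" "j' x mod 2 = i x mod 2" for x by (simp_all add: j'_def)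
    then show ?thesis using J(3)[OF that] by (metis div_mult_mod_eq)
  qed
  moreover have "quantum_states (c + Suc m) 1 (2 ^ Suc m * b) (\<lambda>(x :: 'x) (y :: 'y). unit_state 1 (2 ^ Suc m * b) 0 (J x))"
    using J(1) by (simp add: mult_ac)
  moreover have "J x < 2 ^ Suc m * b" for x using J(2)[of x] by (simp add: mult_ac)
  ultimately show ?case by blast
qed

lemma projector_on_diag: "projector_on d (mat d d (\<lambda>(i, j). if i = j \<and> i \<in> S then 1 else 0))"
proof -
  define D :: "complex mat" where "D = mat d d (\<lambda>(i, j). if i = j \<and> i \<in> S then 1 else 0)"
  have D: "D \<in> carrier_mat d d" by (simp add: D_def)
  have "mat_adjoint D = D" by (rule eq_matI) (auto simp: D_def)
  moreover have "D * D = D"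
  proof (rule eq_matI)
    fix i j assume "i < dim_row D" "j < dim_col D"
    then have ij: "i < d" "j < d" using D by auto
    have "(D * D) $$ (i, j) = (\<Sum>k<d. if k = i then (if i = j \<and> i \<in> S then 1 else 0) else 0)"
      unfolding index_mult_sum[OF D D ij] using ij by (intro sum.cong) (auto simp: D_def)
    then show "(D * D) $$ (i, j) = D $$ (i, j)" using ij by (simp add: D_def)
  qed (use D in auto)
  ultimately show ?thesis unfolding projector_on_def D_def[symmetric] using D by simp
qed

lemma state_norm2_unit_state_diag:
  assumes "j < d"
  shows "state_norm2 (unit_state 1 d 0 j * transpose_mat (mat d d (\<lambda>(i, j). if i = j \<and> i \<in> S then 1 else 0)))
    = (if j \<in> S then 1 else 0)"
proof -
  define D :: "complex mat" where "D = mat d d (\<lambda>(i, j). if i = j \<and> i \<in> S then 1 else 0)"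
  have D: "transpose_mat D \<in> carrier_mat d d" by (simp add: D_def)
  have z: "0 < (1 :: nat)" by simp
  have "(unit_state 1 d 0 j * transpose_mat D) $$ (0, l) = (if l = j \<and> j \<in> S then 1 else 0)" if "l < d" for l
  proof -
    have "(unit_state 1 d 0 j * transpose_mat D) $$ (0, l) = (\<Sum>k<d. if k = j then (if l = j \<and> j \<in> S then 1 else 0) else 0)"
      unfolding index_mult_sum[OF unit_state_carrier D z that] using that assms
      by (intro sum.cong) (auto simp: D_def unit_state_def)
    then show ?thesis using assms by simp
  qed
  then have "state_norm2 (unit_state 1 d 0 j * transpose_mat D)
      = (\<Sum>l<d. (cmod (if l = j \<and> j \<in> S then 1 else 0))\<^sup>2)"
    using D by (simp add: state_norm2_def unit_state_def del: index_mult_mat(1))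
  also have "\<dots> = (\<Sum>l<d. if l = j then (if j \<in> S then 1 else 0) else 0)"
    by (intro sum.cong) auto
  finally show ?thesis using assms by (simp add: D_def)
qed

lemma unitary_on_permutation:
  assumes "bij_betw \<pi> {..<d} {..<d}"
  shows "unitary_on d (mat d d (\<lambda>(i, j). if i = \<pi> j then 1 else 0))"
proof -
  define U :: "complex mat" where "U = mat d d (\<lambda>(i, j). if i = \<pi> j then 1 else 0)"
  have U: "U \<in> carrier_mat d d" by (simp add: U_def)
  have "mat_adjoint U * U = 1\<^sub>m d"
  proof (rule eq_matI)
    fix i j assume "i < dim_row (1\<^sub>m d :: complex mat)" "j < dim_col (1\<^sub>m d :: complex mat)"
    then have ij: "i < d" "j < d" by auto
    have "(mat_adjoint U * U) $$ (i, j) = (\<Sum>k<d. if k = \<pi> i then (if \<pi> i = \<pi> j then 1 else 0) else 0)"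
      unfolding index_mult_sum[OF mat_adjoint_carrier[OF U] U ij] using ij U
      by (intro sum.cong) (auto simp: U_def)
    then show "(mat_adjoint U * U) $$ (i, j) = 1\<^sub>m d $$ (i, j)"
      using ij assms by (auto simp: bij_betw_def inj_on_def)
  qed (use U in auto)
  then show ?thesis using U unfolding unitary_on_def U_def by simp
qed

lemma bij_betw_transpose_lessThan:
  assumes "a < d" "b < (d :: nat)"
  shows "bij_betw (Transposition.transpose a b) {..<d} {..<d}"
  using assms by (intro bij_betwI[of _ _ _ "Transposition.transpose a b"])
    (auto simp: Transposition.transpose_def)

text \<open>\<open>Q_cc\<close> is a \<open>LEAST\<close>, informative only if some protocol exists.
  Alice encodes her input as a basis state and sends all of it; Bob then evaluates \<open>F\<close>
  by a diagonal measurement.\<close>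

lemma quantum_computes_exists:
  fixes F :: "'x \<times> 'y \<Rightarrow> bool option"
  assumes "finite (fst ` dom F)"
  shows "\<exists>c. quantum_computes c F"
proof -
  define X where "X = fst ` dom F"
  have fin: "finite X" using assms by (simp add: X_def)
  define m where "m = card X"
  have m: "card X \<le> 2 * 2 ^ m"
    using less_exp[of "card X"] unfolding m_def by linarith
  \<comment> \<open>The first round, in which Alice also writes her input, is carried out by hand
    and uses the extra factor 2; the other \<open>m\<close> rounds come from
    \<open>quantum_states_send_all\<close>.\<close>
  define N :: nat where "N = 2 * 2 ^ m"
  obtain e0 where e0: "inj_on e0 X" "e0 ` X \<subseteq> {..<N}"
    using card_le_inj[OF fin, of "{..<N}"] m by (auto simp: N_def)
  \<comment> \<open>Inputs outside the domain share the code 0, so that every code is below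
    \<open>N\<close>; acceptance is constrained on the domain only.\<close>
  define e where "e x = (if x \<in> X then e0 x else 0)" for x
  have eN: "e x < N" for x using e0 by (auto simp: e_def N_def)
  \<comment> \<open>Swapping the basis states 0 and \<open>e x\<close> is unitary and creates the
    code of \<open>x\<close> from the fixed initial state.\<close>
  define U where "U x = (mat N N (\<lambda>(i, j). if i = Transposition.transpose 0 (e x) j then 1 else 0) :: complex mat)" for x
  have U: "unitary_on (2 * 2 ^ m) (U x)" for x
    using unitary_on_permutation[OF bij_betw_transpose_lessThan[of 0 N "e x"]] eN[of x]
    by (simp add: U_def N_def)
  have UC: "U x \<in> carrier_mat N N" for x by (simp add: U_def)
  have "(\<Sum>i<N. (cmod (if i = 0 then 1 else 0))\<^sup>2) = (\<Sum>i<N. if i = 0 then 1 else 0 :: real)"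
    by (intro sum.cong) auto
  then have "state_norm2 (unit_state N 1 0 0) = 1"
    using eN[of undefined] by (simp add: state_norm2_def unit_state_def)
  then have "quantum_states 0 N 1 (\<lambda>(x :: 'x) (y :: 'y). unit_state N 1 0 0)"
    by (rule quantum_states.start[OF unit_state_carrier])
  then have "quantum_states 0 (2 * 2 ^ m) 1 (\<lambda>(x :: 'x) (y :: 'y). unit_state N 1 0 0)"
    by (simp only: N_def)
  from quantum_states.alice_sends[OF this U]
  have "quantum_states (Suc 0) (2 ^ m) 2 (\<lambda>x (y :: 'y). qubit_to_bob (U x * unit_state N 1 0 0))"
    by simp
  moreover have "U x * unit_state N 1 0 0 = unit_state (2 * 2 ^ m) 1 (e x) 0" for x
  proof (rule eq_matI)
    fix i j assume "i < dim_row (unit_state (2 * 2 ^ m) 1 (e x) 0)" "j < dim_col (unit_state (2 * 2 ^ m) 1 (e x) 0)"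
    then have ij: "i < N" "j = 0" "j < 1" by (auto simp: unit_state_def N_def)
    have "(U x * unit_state N 1 0 0) $$ (i, j) = (\<Sum>k<N. if k = 0 then (if i = e x then 1 else 0) else 0)"
      unfolding index_mult_sum[OF UC unit_state_carrier ij(1,3)] using ij
      by (intro sum.cong) (auto simp: unit_state_def U_def)
    then show "(U x * unit_state N 1 0 0) $$ (i, j) = unit_state (2 * 2 ^ m) 1 (e x) 0 $$ (i, j)"
      using ij by (simp add: unit_state_def N_def)
  qed (use UC in \<open>auto simp: unit_state_def N_def\<close>)
  ultimately have st: "quantum_states (Suc 0) (2 ^ m) 2 (\<lambda>x (y :: 'y). unit_state (2 ^ m) 2 (e x div 2) (e x mod 2))"
    using eN qubit_to_bob_unit_state[of _ "2 ^ m" 0 1] by (simp add: N_def)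
  have "e x div 2 < 2 ^ m" for x using eN[of x] by (auto simp: N_def)
  then obtain J where J: "quantum_states (Suc 0 + m) 1 (2 ^ m * 2) (\<lambda>x (y :: 'y). unit_state 1 (2 ^ m * 2) 0 (J x))"
    "\<And>x. J x < 2 ^ m * 2" "\<And>x x'. J x = J x' \<Longrightarrow> e x div 2 = e x' div 2 \<and> e x mod 2 = e x' mod 2"
    using quantum_states_send_all[OF st] mod_less_divisor[OF pos2] by blast
  have inj: "x = x'" if "J x = J x'" "x \<in> X" "x' \<in> X" for x x'
  proof -
    have "e x = e x'" using J(3)[OF that(1)] by (metis div_mult_mod_eq)
    then show ?thesis using that e0(1) by (auto simp: e_def inj_on_def)
  qed
  define S where "S y = J ` {x \<in> X. F (x, y) = Some True}" for y
  define acc where "acc x y = state_norm2 (unit_state 1 (2 ^ m * 2) 0 (J x) *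
      transpose_mat (mat (2 ^ m * 2) (2 ^ m * 2) (\<lambda>(i, j). if i = j \<and> i \<in> S y then 1 else 0)))" for x y
  have qa: "quantum_acceptance (Suc 0 + m) acc"
    unfolding acc_def by (intro quantum_acceptance.bob_measures[OF J(1)] projector_on_diag)
  have acc: "acc x y = (if J x \<in> S y then 1 else 0)" for x y
    unfolding acc_def by (rule state_norm2_unit_state_diag[OF J(2)])
  have "acc x y = of_bool b" if "F (x, y) = Some b" for x y b
  proof -
    have "(x, y) \<in> dom F" using that by auto
    then have x: "x \<in> X" unfolding X_def by (metis fst_conv image_eqI)
    then have "J x \<in> S y \<longleftrightarrow> F (x, y) = Some True"
      using inj[of x] unfolding S_def by blast
    then show ?thesis using acc that by simp
  qed
  from this[where b = True] this[where b = False]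
  have "F (x, y) = Some True \<Longrightarrow> acc x y = 1" "F (x, y) = Some False \<Longrightarrow> acc x y = 0" for x y
    by simp_all
  with qa show ?thesis
    unfolding quantum_computes_def by (intro exI[of _ "Suc 0 + m"] exI[of _ acc] conjI allI impI) simp_all
qed

section \<open>Approximation by low-degree polynomials\<close>

lemma operator_norm_properties:
  assumes "finite I" "finite J"
  shows operator_norm_nonneg: "0 \<le> operator_norm I J M"
    and opbound_operator_norm: "opbound I J M (operator_norm I J M)"
proof -
  define N where "N v = L2_set (\<lambda>i. \<Sum>j\<in>J. M i j * v j) I" for v
  \<comment> \<open>A real \<open>SUP\<close> dominates its elements only if they are bounded above;
    the sum of all absolute entries is a sufficient crude bound.\<close>
  have bdd: "bdd_above (N ` {v. L2_set v J \<le> 1})"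
  proof (rule bdd_aboveI2)
    fix v assume "v \<in> {v. L2_set v J \<le> 1}"
    then have v: "\<bar>v j\<bar> \<le> 1" if "j \<in> J" for j
    proof -
      have "\<bar>v j\<bar> \<le> L2_set (\<lambda>j. \<bar>v j\<bar>) J" using assms(2) that by (rule member_le_L2_set)
      also have "\<dots> = L2_set v J" by (simp add: L2_set_def)
      finally show ?thesis using \<open>v \<in> _\<close> by simp
    qed
    have "N v \<le> (\<Sum>i\<in>I. \<bar>\<Sum>j\<in>J. M i j * v j\<bar>)"
      unfolding N_def by (rule L2_set_le_sum_abs)
    also have "\<dots> \<le> (\<Sum>i\<in>I. \<Sum>j\<in>J. \<bar>M i j\<bar>)"
      using v by (intro sum_mono order_trans[OF sum_abs]) (auto simp: abs_mult mult_left_le)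
    finally show "N v \<le> (\<Sum>i\<in>I. \<Sum>j\<in>J. \<bar>M i j\<bar>)" .
  qed
  have le: "N v \<le> operator_norm I J M" if "L2_set v J \<le> 1" for v
    unfolding operator_norm_def N_def[symmetric] using bdd that by (intro cSUP_upper) auto
  have "N (\<lambda>_. 0) = 0" by (simp add: N_def L2_set_def)
  then show "0 \<le> operator_norm I J M" using le[of "\<lambda>_. 0"] by (simp add: L2_set_def)
  show "opbound I J M (operator_norm I J M)"
    unfolding opbound_def N_def[symmetric]
  proof
    fix v
    show "N v \<le> operator_norm I J M * L2_set v J"
    proof (cases "L2_set v J = 0")
      case True
      then have "v j = 0" if "j \<in> J" for j
        using that assms by (simp add: L2_set_def sum_nonneg_eq_0_iff)
      then have "N v = 0" by (simp add: N_def L2_set_def)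
      then show ?thesis using True by simp
    next
      case False
      define s where "s = L2_set v J"
      have s: "s > 0" using False by (simp add: s_def order_less_le L2_set_nonneg)
      have "L2_set (\<lambda>j. inverse s * v j) J = 1"
        using s L2_set_right_distrib[of "inverse s" v J] by (simp add: s_def)
      then have "N (\<lambda>j. inverse s * v j) \<le> operator_norm I J M" by (intro le) simp
      also have "N (\<lambda>j. inverse s * v j) = inverse s * N v"
        using s L2_set_right_distrib[of "inverse s" "\<lambda>i. \<Sum>j\<in>J. M i j * v j" I]
        by (simp add: N_def sum_distrib_left mult_ac)
      finally show ?thesis using s by (simp add: field_simps flip: s_def)
    qed
  qed
qed

text \<open>Without the square roots, both sides are sums that can be split and swapped coordinate
  by coordinate.\<close>

lemma opbound_iff_squares:
  assumes "0 \<le> B"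
  shows "opbound I J W B \<longleftrightarrow> (\<forall>v. (\<Sum>i\<in>I. (\<Sum>j\<in>J. W i j * v j)\<^sup>2) \<le> B\<^sup>2 * (\<Sum>j\<in>J. (v j)\<^sup>2))"
proof -
  have "L2_set u I \<le> B * L2_set v J \<longleftrightarrow> (\<Sum>i\<in>I. (u i)\<^sup>2) \<le> B\<^sup>2 * (\<Sum>j\<in>J. (v j)\<^sup>2)" for u v
  proof -
    have "B * L2_set v J = sqrt (B\<^sup>2 * (\<Sum>j\<in>J. (v j)\<^sup>2))"
      using assms by (simp add: L2_set_def real_sqrt_mult)
    then show ?thesis by (simp add: L2_set_def)
  qed
  then show ?thesis by (simp add: opbound_def)
qed

definition nlists :: "'a set \<Rightarrow> nat \<Rightarrow> 'a list set" where
  "nlists A n = {xs. set xs \<subseteq> A \<and> length xs = n}"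

lemma nlists_0 [simp]: "nlists A 0 = {[]}"
  by (auto simp: nlists_def)

lemma finite_nlists: "finite A \<Longrightarrow> finite (nlists A n)"
  by (simp add: nlists_def finite_lists_length_eq)

lemma card_nlists: "finite A \<Longrightarrow> card (nlists A n) = card A ^ n"
  by (simp add: nlists_def card_lists_length_eq)

lemma sum_nlists_Suc: "(\<Sum>xs\<in>nlists A (Suc n). f xs) = (\<Sum>a\<in>A. \<Sum>xs\<in>nlists A n. f (a # xs))"
proof -
  have "(\<Sum>xs\<in>nlists A (Suc n). f xs) = (\<Sum>(xs, a)\<in>nlists A n \<times> A. f (a # xs))"
    unfolding nlists_def lists_length_Suc_eq by (subst sum.reindex) (auto simp: inj_on_def split_def)
  also have "\<dots> = (\<Sum>xs\<in>nlists A n. \<Sum>a\<in>A. f (a # xs))"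
    by (simp add: sum.cartesian_product')
  finally show ?thesis by (simp add: sum.swap[of _ A])
qed

text \<open>Peel off the first tensor factor: apply \<open>M 0\<close> to the first coordinate with
  the tail fixed, then the remaining factors to the tail with the first coordinate fixed. The bounds
  multiply.\<close>

lemma opbound_nlists:
  assumes "\<And>i. 0 \<le> B i" "\<And>i. opbound A C (M i) (B i)"
  shows "opbound (nlists A n) (nlists C n) (\<lambda>xs ys. \<Prod>i<n. M i (xs ! i) (ys ! i)) (\<Prod>i<n. B i)"
  using assms
proof (induction n arbitrary: M B)
  case 0
  show ?case by (simp add: opbound_def)
next
  case (Suc n)
  define B' where "B' = (\<Prod>i<n. B (Suc i))"
  define W where "W xs ys = (\<Prod>i<n. M (Suc i) (xs ! i) (ys ! i))" for xs ys
  have B': "0 \<le> B'" using Suc.prems by (simp add: B'_def prod_nonneg)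
  have IH: "(\<Sum>xs\<in>nlists A n. (\<Sum>ys\<in>nlists C n. W xs ys * v ys)\<^sup>2) \<le> B'\<^sup>2 * (\<Sum>ys\<in>nlists C n. (v ys)\<^sup>2)" for v
    using Suc.IH[of "\<lambda>i. B (Suc i)" "\<lambda>i. M (Suc i)"] Suc.prems B'
    by (simp add: opbound_iff_squares flip: B'_def W_def)
  have M0: "(\<Sum>a\<in>A. (\<Sum>c\<in>C. M 0 a c * v c)\<^sup>2) \<le> (B 0)\<^sup>2 * (\<Sum>c\<in>C. (v c)\<^sup>2)" for v
    using Suc.prems[of 0] by (simp add: opbound_iff_squares)
  have "(\<Sum>xs\<in>nlists A (Suc n). (\<Sum>ys\<in>nlists C (Suc n). (\<Prod>i<Suc n. M i (xs ! i) (ys ! i)) * v ys)\<^sup>2)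
      \<le> (\<Prod>i<Suc n. B i)\<^sup>2 * (\<Sum>ys\<in>nlists C (Suc n). (v ys)\<^sup>2)" for v
  proof -
    \<comment> \<open>\<open>v\<close> after all factors except the first have acted on it.\<close>
    define w where "w c xs = (\<Sum>ys\<in>nlists C n. W xs ys * v (c # ys))" for c xs
    have "(\<Sum>xs\<in>nlists A (Suc n). (\<Sum>ys\<in>nlists C (Suc n). (\<Prod>i<Suc n. M i (xs ! i) (ys ! i)) * v ys)\<^sup>2)
       = (\<Sum>a\<in>A. \<Sum>xs\<in>nlists A n. (\<Sum>c\<in>C. M 0 a c * w c xs)\<^sup>2)"
      by (simp add: sum_nlists_Suc prod.lessThan_Suc_shift w_def W_def sum_distrib_left mult.assoc
          del: prod.lessThan_Suc)
    also have "\<dots> = (\<Sum>xs\<in>nlists A n. \<Sum>a\<in>A. (\<Sum>c\<in>C. M 0 a c * w c xs)\<^sup>2)" by (rule sum.swap)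
    also have "\<dots> \<le> (\<Sum>xs\<in>nlists A n. (B 0)\<^sup>2 * (\<Sum>c\<in>C. (w c xs)\<^sup>2))" by (intro sum_mono M0)
    also have "\<dots> = (B 0)\<^sup>2 * (\<Sum>c\<in>C. \<Sum>xs\<in>nlists A n. (w c xs)\<^sup>2)"
      by (subst sum.swap) (simp add: sum_distrib_left)
    also have "\<dots> \<le> (B 0)\<^sup>2 * (\<Sum>c\<in>C. B'\<^sup>2 * (\<Sum>ys\<in>nlists C n. (v (c # ys))\<^sup>2))"
      unfolding w_def by (intro mult_left_mono sum_mono IH) simp
    also have "\<dots> = (\<Prod>i<Suc n. B i)\<^sup>2 * (\<Sum>ys\<in>nlists C (Suc n). (v ys)\<^sup>2)"
      by (simp add: sum_nlists_Suc prod.lessThan_Suc_shift B'_def power_mult_distrib sum_distrib_left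
          mult.assoc del: prod.lessThan_Suc)
    finally show ?thesis .
  qed
  then show ?case using Suc.prems by (simp add: opbound_iff_squares prod_nonneg del: prod.lessThan_Suc)
qed

text \<open>Distributivity. Applied to the witness distributions it shows that their product has
  total mass 1.\<close>

lemma sum_nlists_prod:
  "(\<Sum>xs\<in>nlists A n. \<Sum>ys\<in>nlists C n. \<Prod>i<n. w i (xs ! i) (ys ! i)) =
    (\<Prod>i<n. \<Sum>a\<in>A. \<Sum>c\<in>C. w i a c :: real)"
proof (induction n arbitrary: w)
  case 0
  show ?case by simp
next
  case (Suc n)
  have "(\<Sum>xs\<in>nlists A (Suc n). \<Sum>ys\<in>nlists C (Suc n). \<Prod>i<Suc n. w i (xs ! i) (ys ! i))
      = (\<Sum>a\<in>A. \<Sum>xs\<in>nlists A n. \<Sum>c\<in>C. w 0 a c * (\<Sum>ys\<in>nlists C n. \<Prod>i<n. w (Suc i) (xs ! i) (ys ! i)))"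
    by (simp add: sum_nlists_Suc prod.lessThan_Suc_shift sum_distrib_left del: prod.lessThan_Suc)
  also have "\<dots> = (\<Sum>a\<in>A. \<Sum>c\<in>C. w 0 a c * (\<Sum>xs\<in>nlists A n. \<Sum>ys\<in>nlists C n. \<Prod>i<n. w (Suc i) (xs ! i) (ys ! i)))"
    by (simp add: sum_distrib_left sum.swap[of _ "nlists A n" C])
  also have "\<dots> = (\<Prod>i<Suc n. \<Sum>a\<in>A. \<Sum>c\<in>C. w i a c)"
    unfolding Suc.IH[of "\<lambda>i. w (Suc i)"] by (simp add: prod.lessThan_Suc_shift sum_distrib_right del: prod.lessThan_Suc)
  finally show ?case .
qed

section \<open>Fourier expansion of the averaged acceptance probability\<close>

text \<open>The Fourier-Walsh character of \<open>S\<close>, with \<open>True\<close> read as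
  -1.\<close>

definition parity_char :: "nat set \<Rightarrow> (nat \<Rightarrow> bool) \<Rightarrow> real" where
  "parity_char S z = (\<Prod>i\<in>S. if z i then - 1 else 1)"

lemma abs_parity_char [simp]: "\<bar>parity_char S z\<bar> = 1"
  unfolding parity_char_def abs_prod by (rule prod.neutral) simp

lemma sum_prod_subsets:
  assumes "finite A"
  shows "(\<Sum>S\<in>Pow A. a ^ card S * b ^ (card A - card S)) = (a + b :: real) ^ card A"
proof -
  have "(a + b) ^ card A = (\<Prod>i\<in>A. a + b)" by simp
  also have "\<dots> = (\<Sum>S\<in>Pow A. (\<Prod>i\<in>S. a) * (\<Prod>i\<in>A - S. b))" by (rule prod_add[OF assms])
  also have "\<dots> = (\<Sum>S\<in>Pow A. a ^ card S * b ^ (card A - card S))"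
    using assms by (intro sum.cong) (auto simp: card_Diff_subset finite_subset)
  finally show ?thesis by simp
qed

lemma block_Suc: "block k (Suc i) x = block k i (drop k x)"
  by (simp add: block_def add.commute)

lemma block_concat:
  assumes "\<forall>x \<in> set xs. length x = k" "i < length xs"
  shows "block k i (concat xs) = xs ! i"
  using assms
proof (induction xs arbitrary: i)
  case (Cons a xs)
  show ?case
  proof (cases i)
    case 0
    then show ?thesis using Cons.prems by (simp add: block_def)
  next
    case (Suc j)
    then show ?thesis using Cons by (simp add: block_Suc)
  qed
qed simp

lemma length_concat_uniform:
  "\<forall>x \<in> set xs. length x = k \<Longrightarrow> length (concat xs) = length xs * k"
  by (induction xs) auto

lemma block_composition_concat:
  assumes "xs \<in> nlists (bitstrings k) n" "ys \<in> nlists (bitstrings k) n"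
    and "\<And>i. i < n \<Longrightarrow> g (xs ! i, ys ! i) = Some (z i)"
  shows "block_composition n k f g (concat xs, concat ys) = Some (f (map z [0..<n]))"
proof -
  have len: "\<forall>x \<in> set xs. length x = k" "\<forall>x \<in> set ys. length x = k" "length xs = n" "length ys = n"
    using assms(1,2) by (auto simp: bitstrings_def nlists_def)
  have g: "g (block k i (concat xs), block k i (concat ys)) = Some (z i)" if "i < n" for i
    using that len assms(3) by (simp add: block_concat)
  then have m: "map (\<lambda>i. the (g (block k i (concat xs), block k i (concat ys)))) [0..<n] = map z [0..<n]"
    by (intro map_cong) simp_all
  have "concat xs \<in> bitstrings (n * k)" "concat ys \<in> bitstrings (n * k)"
    using len by (simp_all add: bitstrings_def length_concat_uniform[OF len(1)] length_concat_uniform[OF len(2)] del: length_concat)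
  then show ?thesis using g unfolding block_composition_def by (auto simp: m)
qed

text \<open>The values \<open>h t\<close> are constrained only where the weight is non-zero, because
  a protocol is controlled only on inputs that satisfy the promise.\<close>

lemma weighted_sum_bounds:
  fixes w :: "'a \<Rightarrow> real"
  assumes "\<And>t. t \<in> T \<Longrightarrow> 0 \<le> w t" "sum w T = 1"
    and "\<And>t. t \<in> T \<Longrightarrow> w t \<noteq> 0 \<Longrightarrow> lo \<le> h t \<and> h t \<le> hi"
  shows "lo \<le> (\<Sum>t\<in>T. w t * h t)" "(\<Sum>t\<in>T. w t * h t) \<le> hi"
proof -
  have "w t * lo \<le> w t * h t \<and> w t * h t \<le> w t * hi" if "t \<in> T" for t
    using assms(1,3)[OF that] by (cases "w t = 0") (auto intro: mult_left_mono)
  then have "(\<Sum>t\<in>T. w t * lo) \<le> (\<Sum>t\<in>T. w t * h t) \<and> (\<Sum>t\<in>T. w t * h t) \<le> (\<Sum>t\<in>T. w t * hi)"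
    by (auto intro!: sum_mono)
  then show "lo \<le> (\<Sum>t\<in>T. w t * h t)" "(\<Sum>t\<in>T. w t * h t) \<le> hi"
    using assms(2) by (simp_all flip: sum_distrib_right)
qed

lemma finite_bitstrings: "finite (bitstrings k)"
  using finite_lists_length_eq[of "UNIV :: bool set" k] by (simp add: bitstrings_def)

lemma low_degree_approximation:
  fixes h :: "bool list list \<Rightarrow> bool list list \<Rightarrow> real"
  assumes IA: "finite IA" and IB: "finite IB"
    and supp: "set_pmf \<mu>0 \<subseteq> IA \<times> IB" "set_pmf \<mu>1 \<subseteq> IA \<times> IB"
    and m: "sqrt (real (card IA) * real (card IB)) *
        operator_norm IA IB (\<lambda>x y. (pmf \<mu>0 (x, y) + pmf \<mu>1 (x, y)) / 2) \<le> 1 + r"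
    and d: "sqrt (real (card IA) * real (card IB)) *
        operator_norm IA IB (\<lambda>x y. (pmf \<mu>0 (x, y) - pmf \<mu>1 (x, y)) / 2) \<le> r"
    and r: "r * real n \<le> 1 / 4"
    and h: "bounded_against (4 ^ c) h"
  shows "\<exists>coef. \<forall>z. \<bar>(\<Sum>xs\<in>nlists IA n. \<Sum>ys\<in>nlists IB n.
      (\<Prod>i<n. pmf (if z i then \<mu>1 else \<mu>0) (xs ! i, ys ! i)) * h xs ys) -
      (\<Sum>S | S \<subseteq> {..<n} \<and> card S \<le> c + 2. coef S * parity_char S z)\<bar> \<le> 1 / 16"
proof -
  define s where "s = sqrt (real (card IA) * real (card IB))"
  define M where "M x y = (pmf \<mu>0 (x, y) + pmf \<mu>1 (x, y)) / 2" for x y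
  define D where "D x y = (pmf \<mu>0 (x, y) - pmf \<mu>1 (x, y)) / 2" for x y
  define NM where "NM = operator_norm IA IB M"
  define ND where "ND = operator_norm IA IB D"
  define coef where "coef S = (\<Sum>xs\<in>nlists IA n. \<Sum>ys\<in>nlists IB n.
      (\<Prod>i<n. (if i \<in> S then D else M) (xs ! i) (ys ! i)) * h xs ys)" for S
  have s0: "0 \<le> s" by (simp add: s_def)
  have NM: "0 \<le> NM" "opbound IA IB M NM" and ND: "0 \<le> ND" "opbound IA IB D ND"
    using IA IB by (auto simp: NM_def ND_def operator_norm_nonneg opbound_operator_norm)
  have sM: "s * NM \<le> 1 + r" and sD: "s * ND \<le> r"
    using m d by (simp_all add: s_def NM_def ND_def M_def[abs_def] D_def[abs_def])
  have r0: "0 \<le> r" using sD s0 ND(1) by (meson mult_nonneg_nonneg order_trans)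
  have fin: "finite (nlists IA n)" "finite (nlists IB n)"
    using IA IB by (auto simp: finite_nlists)
  have coef_le: "\<bar>coef S\<bar> \<le> 4 ^ c * (r ^ card S * (1 + r) ^ (n - card S))" if S: "S \<subseteq> {..<n}" for S
  proof -
    define B where "B i = (if i \<in> S then ND else NM)" for i
    have B: "0 \<le> B i" for i using NM ND by (simp add: B_def)
    have "opbound (nlists IA n) (nlists IB n)
        (\<lambda>xs ys. \<Prod>i<n. (if i \<in> S then D else M) (xs ! i) (ys ! i)) (\<Prod>i<n. B i)"
      using NM ND by (intro opbound_nlists) (auto simp: B_def)
    then have "\<bar>coef S\<bar> \<le> 4 ^ c * (\<Prod>i<n. B i) * sqrt (real (card (nlists IA n)) * real (card (nlists IB n)))"
      using h fin B unfolding bounded_against_def coef_def by (blast intro: prod_nonneg)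
    also have "sqrt (real (card (nlists IA n)) * real (card (nlists IB n))) = s ^ n"
      using IA IB by (simp add: card_nlists s_def real_sqrt_power flip: power_mult_distrib)
    \<comment> \<open>The normalization is distributed evenly, one \<open>s\<close> per tensor
      factor, so each factor becomes one of the two quantities bounded by the spectral
      witness.\<close>
    also have "4 ^ c * (\<Prod>i<n. B i) * s ^ n = 4 ^ c * (\<Prod>i<n. s * B i)"
      by (simp add: prod.distrib)
    also have "(\<Prod>i<n. s * B i) \<le> (\<Prod>i<n. if i \<in> S then r else 1 + r)"
      using B s0 sM sD by (intro prod_mono) (auto simp: B_def)
    also have "(\<Prod>i<n. if i \<in> S then r else 1 + r) = (\<Prod>i\<in>S. r) * (\<Prod>i\<in>{..<n} - S. 1 + r)"
      using S by (subst prod.subset_diff[of S]) (auto intro!: arg_cong2[where f = "(*)"] prod.cong)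
    also have "\<dots> = r ^ card S * (1 + r) ^ (n - card S)"
      using S by (simp add: card_Diff_subset finite_subset)
    finally show ?thesis by simp
  qed
  define p where "p z = (\<Sum>xs\<in>nlists IA n. \<Sum>ys\<in>nlists IB n.
      (\<Prod>i<n. pmf (if z i then \<mu>1 else \<mu>0) (xs ! i, ys ! i)) * h xs ys)" for z
  have p: "p z = (\<Sum>S\<in>Pow {..<n}. coef S * parity_char S z)" for z
  proof -
    \<comment> \<open>At each position the distribution is \<open>M + D\<close> for the value
      \<open>False\<close> and \<open>M - D\<close> for \<open>True\<close>; multiplying out the
      product selects \<open>D\<close> exactly on \<open>S\<close>.\<close>
    have prod: "(\<Prod>i<n. pmf (if z i then \<mu>1 else \<mu>0) (xs ! i, ys ! i)) =
        (\<Sum>S\<in>Pow {..<n}. parity_char S z * (\<Prod>i<n. (if i \<in> S then D else M) (xs ! i) (ys ! i)))" for xs ys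
    proof -
      have "(\<Prod>i<n. pmf (if z i then \<mu>1 else \<mu>0) (xs ! i, ys ! i)) =
        (\<Prod>i<n. (if z i then - 1 else 1) * D (xs ! i) (ys ! i) + M (xs ! i) (ys ! i))"
        by (intro prod.cong) (auto simp: D_def M_def field_simps)
      also have "\<dots> = (\<Sum>S\<in>Pow {..<n}. (\<Prod>i\<in>S. (if z i then - 1 else 1) * D (xs ! i) (ys ! i)) *
          (\<Prod>i\<in>{..<n} - S. M (xs ! i) (ys ! i)))"
        by (rule prod_add) simp
      also have "\<dots> = (\<Sum>S\<in>Pow {..<n}. parity_char S z *
          ((\<Prod>i\<in>S. D (xs ! i) (ys ! i)) * (\<Prod>i\<in>{..<n} - S. M (xs ! i) (ys ! i))))"
        by (simp only: prod.distrib parity_char_def mult.assoc)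
      also have "\<dots> = (\<Sum>S\<in>Pow {..<n}. parity_char S z * (\<Prod>i<n. (if i \<in> S then D else M) (xs ! i) (ys ! i)))"
      proof (intro sum.cong refl arg_cong2[where f = "(*)"])
        fix S assume "S \<in> Pow {..<n}"
        then show "(\<Prod>i\<in>S. D (xs ! i) (ys ! i)) * (\<Prod>i\<in>{..<n} - S. M (xs ! i) (ys ! i)) =
          (\<Prod>i<n. (if i \<in> S then D else M) (xs ! i) (ys ! i))"
          by (subst (3) prod.subset_diff[of S]) (auto simp: mult.commute intro!: arg_cong2[where f = "(*)"] prod.cong)
      qed
      finally show ?thesis .
    qed
    show ?thesis
      unfolding p_def prod coef_def
      by (simp add: sum_distrib_right sum_distrib_left mult_ac sum.swap[of _ "Pow {..<n}"])
  qed
  define Low where "Low = {S. S \<subseteq> {..<n} \<and> card S \<le> c + 2}"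
  have Low: "Low \<subseteq> Pow {..<n}" by (auto simp: Low_def)
  have "\<bar>p z - (\<Sum>S\<in>Low. coef S * parity_char S z)\<bar> \<le> 1 / 16" for z
  proof -
    have "p z - (\<Sum>S\<in>Low. coef S * parity_char S z) = (\<Sum>S\<in>Pow {..<n} - Low. coef S * parity_char S z)"
      unfolding p using Low by (simp add: sum_diff)
    also have "\<bar>\<dots>\<bar> \<le> (\<Sum>S\<in>Pow {..<n} - Low. \<bar>coef S\<bar>)"
      by (rule order_trans[OF sum_abs]) (simp add: abs_mult)
    also have "\<dots> \<le> (\<Sum>S\<in>Pow {..<n} - Low. (1 / 4) ^ 3 * ((4 * r) ^ card S * (1 + r) ^ (n - card S)))"
    proof (rule sum_mono)
      fix S assume S: "S \<in> Pow {..<n} - Low"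
      \<comment> \<open>The three degrees to spare turn \<open>4 ^ c\<close> into
        \<open>4 ^ card S / 64\<close>. The base 4 is absorbed into the power of
        \<open>r\<close>.\<close>
      then have "c + 3 \<le> card S" by (auto simp: Low_def)
      then have "(4 :: real) ^ (c + 3) \<le> 4 ^ card S" by (intro power_increasing) auto
      then have "4 ^ c * (r ^ card S * (1 + r) ^ (n - card S))
          \<le> ((1 / 4) ^ 3 * 4 ^ card S) * (r ^ card S * (1 + r) ^ (n - card S))"
        using r0 by (intro mult_right_mono) (auto simp: power_add field_simps)
      then show "\<bar>coef S\<bar> \<le> (1 / 4) ^ 3 * ((4 * r) ^ card S * (1 + r) ^ (n - card S))"
        using coef_le[of S] S by (auto simp: power_mult_distrib mult_ac)
    qed
    also have "\<dots> \<le> (\<Sum>S\<in>Pow {..<n}. (1 / 4) ^ 3 * ((4 * r) ^ card S * (1 + r) ^ (n - card S)))"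
      using r0 by (intro sum_mono2) auto
    also have "\<dots> = (1 / 4) ^ 3 * (4 * r + (1 + r)) ^ n"
      using sum_prod_subsets[of "{..<n}" "4 * r" "1 + r"] by (simp flip: sum_distrib_left)
    also have "\<dots> \<le> (1 / 4) ^ 3 * 4"
    proof (intro mult_left_mono)
      \<comment> \<open>The sum is at most exp(5/4), and 3 * (4/3) bounds this by 4; hence the final
        error 4/64.\<close>
      have "(4 * r + (1 + r)) ^ n \<le> exp (5 * r) ^ n"
        using r0 exp_ge_add_one_self[of "5 * r"] by (intro power_mono) (simp_all add: algebra_simps)
      also have "\<dots> = exp (5 * (r * real n))" by (simp flip: exp_of_nat_mult add: mult_ac)
      also have "\<dots> \<le> exp (1 + 1 / 4)" using r by simp
      also have "\<dots> = exp 1 * exp (1 / 4)" by (rule exp_add)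
      also have "\<dots> \<le> 3 * (4 / 3)"
      proof (intro mult_mono exp_le)
        have "1 - 1 / 4 \<le> exp (- (1 / 4) :: real)" using exp_ge_add_one_self[of "- (1 / 4)"] by simp
        then show "exp (1 / 4) \<le> (4 / 3 :: real)" by (simp add: exp_minus field_simps)
      qed auto
      finally show "(4 * r + (1 + r)) ^ n \<le> 4" by simp
    qed simp
    finally show ?thesis by (simp add: power3_eq_cube)
  qed
  then show ?thesis unfolding p_def Low_def by blast
qed

text \<open>The product distribution gives weight only to inputs whose \<open>i\<close>-th block
  pair has value \<open>z i\<close>, so on its whole support the composition equals \<open>f\<close>
  at \<open>z\<close> and the average inherits the guarantee of the protocol. Truncation adds 1/16,
  leaving a gap of 5/24 between the two values of \<open>f\<close>.\<close>

theorem quantum_approximate_degree: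
  assumes Q: "quantum_computes c (block_composition n k f g)"
    and W: "spectral_witness k g r" and r: "r * real n \<le> 1 / 4"
  shows "\<exists>coef. \<forall>z.
    (let q = (\<Sum>S | S \<subseteq> {..<n} \<and> card S \<le> c + 2. coef S * parity_char S z) in
      - (1 / 16) \<le> q \<and> q \<le> 17 / 16 \<and>
      (if f (map z [0..<n]) then 2 / 3 - 1 / 16 \<le> q else q \<le> 1 / 3 + 1 / 16))"
proof -
  obtain acc where acc: "quantum_acceptance c acc"
    and T: "\<And>x y. block_composition n k f g (x, y) = Some True \<Longrightarrow> 1 - acc x y \<le> 1 / 3"
    and F: "\<And>x y. block_composition n k f g (x, y) = Some False \<Longrightarrow> acc x y \<le> 1 / 3"
    using Q unfolding quantum_computes_def by blast
  obtain IA IB \<mu>0 \<mu>1 where I: "IA \<subseteq> bitstrings k" "IB \<subseteq> bitstrings k"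
    and \<mu>0: "set_pmf \<mu>0 \<subseteq> {z \<in> IA \<times> IB. g z = Some False}"
    and \<mu>1: "set_pmf \<mu>1 \<subseteq> {z \<in> IA \<times> IB. g z = Some True}"
    and m: "sqrt (real (card IA) * real (card IB)) *
        operator_norm IA IB (\<lambda>x y. (pmf \<mu>0 (x, y) + pmf \<mu>1 (x, y)) / 2) \<le> 1 + r"
    and d: "sqrt (real (card IA) * real (card IB)) *
        operator_norm IA IB (\<lambda>x y. (pmf \<mu>0 (x, y) - pmf \<mu>1 (x, y)) / 2) \<le> r"
    using W unfolding spectral_witness_def b_distribution_def by blast
  have fin: "finite IA" "finite IB" using I by (auto intro: finite_subset[OF _ finite_bitstrings])
  define h where "h xs ys = acc (concat xs) (concat ys)" for xs ys
  have "bounded_against (4 ^ c) h"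
    unfolding h_def by (rule quantum_acceptance_bounded[OF quantum_acceptance_reindex[OF acc]])
  moreover define w where "w z xs ys = (\<Prod>i<n. pmf (if z i then \<mu>1 else \<mu>0) (xs ! i, ys ! i))"
    for z :: "nat \<Rightarrow> bool" and xs ys
  ultimately have "\<exists>coef. \<forall>z. \<bar>(\<Sum>xs\<in>nlists IA n. \<Sum>ys\<in>nlists IB n. w z xs ys * h xs ys) -
      (\<Sum>S | S \<subseteq> {..<n} \<and> card S \<le> c + 2. coef S * parity_char S z)\<bar> \<le> 1 / 16"
    using \<mu>0 \<mu>1 unfolding w_def by (intro low_degree_approximation[OF fin _ _ m d r]) auto
  then obtain coef where coef: "\<And>z. \<bar>(\<Sum>xs\<in>nlists IA n. \<Sum>ys\<in>nlists IB n. w z xs ys * h xs ys) -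
      (\<Sum>S | S \<subseteq> {..<n} \<and> card S \<le> c + 2. coef S * parity_char S z)\<bar> \<le> 1 / 16"
    by (elim exE) blast
  have p: "lo \<le> (\<Sum>xs\<in>nlists IA n. \<Sum>ys\<in>nlists IB n. w z xs ys * h xs ys) \<and>
      (\<Sum>xs\<in>nlists IA n. \<Sum>ys\<in>nlists IB n. w z xs ys * h xs ys) \<le> hi"
    if lohi: "\<And>x y. block_composition n k f g (x, y) = Some (f (map z [0..<n])) \<Longrightarrow> lo \<le> acc x y \<and> acc x y \<le> hi"
    for z lo hi
  proof -
    define T where "T = nlists IA n \<times> nlists IB n"
    have eq: "(\<Sum>xs\<in>nlists IA n. \<Sum>ys\<in>nlists IB n. w z xs ys * h xs ys)
        = (\<Sum>t\<in>T. w z (fst t) (snd t) * h (fst t) (snd t))"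
      by (simp add: T_def sum.cartesian_product')
    have "(\<Sum>a\<in>IA. \<Sum>b\<in>IB. pmf (if z i then \<mu>1 else \<mu>0) (a, b)) = 1" for i
    proof -
      have "(\<Sum>a\<in>IA. \<Sum>b\<in>IB. pmf (if z i then \<mu>1 else \<mu>0) (a, b))
          = (\<Sum>p\<in>IA \<times> IB. pmf (if z i then \<mu>1 else \<mu>0) p)"
        by (simp add: sum.cartesian_product')
      also have "\<dots> = 1" using fin \<mu>0 \<mu>1 by (intro sum_pmf_eq_1) auto
      finally show ?thesis .
    qed
    then have sum1: "(\<Sum>t\<in>T. w z (fst t) (snd t)) = 1"
      by (simp add: T_def sum.cartesian_product' w_def
          sum_nlists_prod[where w = "\<lambda>i a b. pmf (if z i then \<mu>1 else \<mu>0) (a, b)"])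
    have "lo \<le> h xs ys \<and> h xs ys \<le> hi" if "w z xs ys \<noteq> 0" "xs \<in> nlists IA n" "ys \<in> nlists IB n" for xs ys
    proof -
      have "pmf (if z i then \<mu>1 else \<mu>0) (xs ! i, ys ! i) \<noteq> 0" if "i < n" for i
        using \<open>w z xs ys \<noteq> 0\<close> that by (auto simp: w_def)
      then have "g (xs ! i, ys ! i) = Some (z i)" if "i < n" for i
        using that \<mu>0 \<mu>1 by (cases "z i") (fastforce simp: set_pmf_iff)+
      then have "block_composition n k f g (concat xs, concat ys) = Some (f (map z [0..<n]))"
        using that I by (intro block_composition_concat) (auto simp: nlists_def)
      then show ?thesis unfolding h_def by (rule lohi)
    qed
    then have "\<And>t. t \<in> T \<Longrightarrow> w z (fst t) (snd t) \<noteq> 0 \<Longrightarrow>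
        lo \<le> h (fst t) (snd t) \<and> h (fst t) (snd t) \<le> hi"
      by (auto simp: T_def)
    moreover have "0 \<le> w z xs ys" for xs ys by (simp add: w_def prod_nonneg)
    ultimately show ?thesis
      unfolding eq using sum1 by (intro conjI weighted_sum_bounds[of T _ lo _ hi]) auto
  qed
  show ?thesis
  proof (intro exI[of _ coef] allI)
    fix z
    define P where "P = (\<Sum>xs\<in>nlists IA n. \<Sum>ys\<in>nlists IB n. w z xs ys * h xs ys)"
    define q where "q = (\<Sum>S | S \<subseteq> {..<n} \<and> card S \<le> c + 2. coef S * parity_char S z)"
    have q: "\<bar>P - q\<bar> \<le> 1 / 16" using coef[of z] by (simp add: P_def q_def)
    have "if f (map z [0..<n]) then 2 / 3 \<le> P \<and> P \<le> 1 else 0 \<le> P \<and> P \<le> 1 / 3"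
    proof (cases "f (map z [0..<n])")
      case True
      then show ?thesis
        using p[of z "2 / 3" 1] T quantum_acceptance_le_1[OF acc] unfolding P_def by force
    next
      case False
      then show ?thesis
        using p[of z 0 "1 / 3"] F quantum_acceptance_nonneg[OF acc] unfolding P_def by force
    qed
    with q show "let q = (\<Sum>S | S \<subseteq> {..<n} \<and> card S \<le> c + 2. coef S * parity_char S z) in
      - (1 / 16) \<le> q \<and> q \<le> 17 / 16 \<and>
      (if f (map z [0..<n]) then 2 / 3 - 1 / 16 \<le> q else q \<le> 1 / 3 + 1 / 16)"
      unfolding Let_def q_def[symmetric] abs_le_iff by (simp split: if_splits)
  qed
qed

section \<open>Block sensitivity\<close>

lemma lagrange_interpolation_at_0:
  fixes h :: "real poly" and x :: "'i \<Rightarrow> real"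
  assumes fin: "finite I" and inj: "inj_on x I" and deg: "degree h < card I"
  shows "poly h 0 = (\<Sum>i\<in>I. poly h (x i) * (\<Prod>j\<in>I - {i}. x j / (x j - x i)))"
proof -
  define l where "l i = (\<Prod>j\<in>I - {i}. Polynomial.smult (inverse (x j - x i)) [:x j, - 1:])" for i
  define L where "L = (\<Sum>i\<in>I. Polynomial.smult (poly h (x i)) (l i))"
  have l: "poly (l i) t = (\<Prod>j\<in>I - {i}. (x j - t) / (x j - x i))" for i t
    unfolding l_def poly_prod by (intro prod.cong refl) (simp add: divide_inverse algebra_simps)
  have l_x: "poly (l i) (x k) = (if k = i then 1 else 0)" if "i \<in> I" "k \<in> I" for i k
  proof (cases "k = i")
    case True
    have "poly (l i) (x i) = (\<Prod>j\<in>I - {i}. 1)"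
      unfolding l using inj that by (intro prod.cong) (auto simp: inj_on_def)
    then show ?thesis using True by simp
  next
    case False
    then show ?thesis unfolding l using that fin by (auto intro!: prod_zero)
  qed
  have "degree (l i) < card I" if "i \<in> I" for i
  proof -
    have "degree (l i) \<le> (\<Sum>j\<in>I - {i}. 1)"
      unfolding l_def using fin
      by (intro order_trans[OF degree_prod_sum_le] sum_mono order_trans[OF degree_smult_le]) auto
    then show ?thesis using fin that by (simp add: card_gt_0_iff) (metis Suc_pred card_gt_0_iff emptyE less_Suc_eq_le)
  qed
  then have degL: "degree L < card I"
    unfolding L_def using deg
    by (intro degree_sum_less) (auto intro: le_less_trans[OF degree_smult_le])
  have "poly L (x k) = poly h (x k)" if "k \<in> I" for k
  proof -
    have "poly L (x k) = (\<Sum>i\<in>I. if i = k then poly h (x k) else 0)"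
      unfolding L_def poly_sum using that by (intro sum.cong) (auto simp: l_x)
    then show ?thesis using fin that by simp
  qed
  then have "L = h"
    using degL deg inj by (intro poly_eqI_degree[of "x ` I"]) (auto simp: card_image)
  then have "poly h 0 = poly L 0" by simp
  then show ?thesis by (simp add: L_def poly_sum l)
qed

text \<open>The nodes below \<open>i\<close>. With \<open>k = i - 1\<close> this starts the
  induction of \<open>square_node_weight\<close>, which adds the nodes above
  \<open>i\<close>.\<close>

lemma square_node_weight_below:
  assumes "k < i"
  shows "(\<Prod>j = 1..k. \<bar>(real j)\<^sup>2 / ((real j)\<^sup>2 - (real i)\<^sup>2)\<bar>)
    = (fact k)\<^sup>2 * fact (i - 1 - k) * fact i / (fact (i - 1) * fact (i + k))"
  using assms
proof (induction k)
  case (Suc k)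
  then have "i - 1 - k = Suc (i - 1 - Suc k)" by simp
  then have f: "fact (i - 1 - k) = (real i - 1 - real k) * (fact (i - 1 - Suc k) :: real)"
    using Suc.prems by (simp add: of_nat_diff)
  have pos: "real i - 1 - real k > 0" using Suc.prems by linarith
  have "\<bar>(real (Suc k))\<^sup>2 / ((real (Suc k))\<^sup>2 - (real i)\<^sup>2)\<bar>
      = (real (Suc k))\<^sup>2 / ((real i - 1 - real k) * (real i + real (Suc k)))"
  proof -
    have "(real (Suc k))\<^sup>2 - (real i)\<^sup>2 = - ((real i - 1 - real k) * (real i + real (Suc k)))"
      by (simp add: power2_eq_square algebra_simps)
    moreover have "0 \<le> (real i - 1 - real k) * (real i + real (Suc k))" using pos by simp
    ultimately show ?thesis using pos by (simp add: abs_mult)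
  qed
  moreover have "fact (i + Suc k) = (real i + real (Suc k)) * (fact (i + k) :: real)" by (simp add: algebra_simps)
  moreover have "fact (Suc k) = real (Suc k) * (fact k :: real)" by simp
  ultimately show ?case using Suc pos f by (simp add: power_mult_distrib mult_ac del: fact_Suc of_nat_Suc)
qed simp

text \<open>The denominators split as \<open>(j - i) * (j + i)\<close> and collapse to factorials.
  The 2 comes from omitting \<open>j = i\<close>: this removes \<open>2 * i\<close> from the product
  of the sums \<open>j + i\<close>.\<close>

lemma square_node_weight:
  assumes "1 \<le> i" "i \<le> m"
  shows "(\<Prod>j\<in>{1..m} - {i}. \<bar>(real j)\<^sup>2 / ((real j)\<^sup>2 - (real i)\<^sup>2)\<bar>)
    = 2 * (fact m)\<^sup>2 / (fact (m - i) * fact (m + i))"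
  using assms(2)
proof (induction m rule: dec_induct)
  case base
  obtain k where i: "i = Suc k" using assms(1) by (cases i) auto
  have "{1..i} - {i} = {1..k}" by (auto simp: i)
  then have "(\<Prod>j\<in>{1..i} - {i}. \<bar>(real j)\<^sup>2 / ((real j)\<^sup>2 - (real i)\<^sup>2)\<bar>)
      = (fact k)\<^sup>2 * fact i / (fact k * fact (i + k))"
    using square_node_weight_below[of k i] by (simp add: i del: of_nat_Suc fact_Suc)
  moreover have "fact (i + i) = 2 * real (Suc k) * (fact (i + k) :: real)"
    using fact_Suc[of "i + k", where 'a = real] by (simp add: i algebra_simps del: fact_Suc)
  moreover have "fact i = real (Suc k) * (fact k :: real)" by (simp add: i)
  ultimately show ?case by (simp add: power2_eq_square field_simps del: of_nat_Suc fact_Suc)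
next
  case (step m)
  have "{1..Suc m} - {i} = insert (Suc m) ({1..m} - {i})" using step by auto
  moreover have "\<bar>(real (Suc m))\<^sup>2 / ((real (Suc m))\<^sup>2 - (real i)\<^sup>2)\<bar>
      = (real (Suc m))\<^sup>2 / (real (Suc m - i) * real (Suc m + i))"
  proof -
    have "(real (Suc m))\<^sup>2 - (real i)\<^sup>2 = real (Suc m - i) * real (Suc m + i)"
      using step by (simp add: of_nat_diff power2_eq_square algebra_simps)
    then show ?thesis by simp
  qed
  moreover have "fact (Suc m - i) = real (Suc m - i) * (fact (m - i) :: real)"
    using step by (simp add: Suc_diff_le)
  moreover have "fact (Suc m + i) = real (Suc m + i) * (fact (m + i) :: real)" by simp
  moreover have "fact (Suc m) = real (Suc m) * (fact m :: real)" by simp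
  ultimately show ?case
    using step.IH by (simp add: power_mult_distrib mult_ac del: fact_Suc of_nat_Suc)
qed

text \<open>The central binomial coefficient is the largest, so \<open>(fact m)\<^sup>2\<close> is
  at most \<open>fact (m - i) * fact (m + i)\<close>.\<close>

lemma square_node_weight_le:
  assumes "1 \<le> i" "i \<le> m"
  shows "(\<Prod>j\<in>{1..m} - {i}. \<bar>(real j)\<^sup>2 / ((real j)\<^sup>2 - (real i)\<^sup>2)\<bar>) \<le> 2"
proof -
  have "real (2 * m choose (m + i)) = fact (2 * m) / (fact (m + i) * fact (2 * m - (m + i)))"
    using assms by (intro binomial_fact) auto
  moreover have "2 * m - (m + i) = m - i" by simp
  moreover have "real (2 * m choose m) = fact (2 * m) / (fact m * fact (2 * m - m))"
    by (intro binomial_fact) auto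
  moreover have "real (2 * m choose (m + i)) \<le> real (2 * m choose m)"
    using binomial_maximum'[of m "m + i"] by simp
  ultimately have "fact (2 * m) / (fact (m + i) * fact (m - i)) \<le> (fact (2 * m) / (fact m * fact m) :: real)"
    by simp
  then have "(fact m :: real)\<^sup>2 \<le> fact (m - i) * fact (m + i)"
    by (simp add: field_simps power2_eq_square)
  then show ?thesis unfolding square_node_weight[OF assms] by (simp add: field_simps)
qed

text \<open>The term \<open>- 1 / real m\<close> makes the induction telescope.\<close>

lemma sum_inverse_squares_le:
  "1 \<le> m \<Longrightarrow> (\<Sum>i = 1..m. 1 / (real i)\<^sup>2) \<le> 2 - 1 / real m"
proof (induction m rule: dec_induct)
  case (step m)
  have "1 / (real (Suc m))\<^sup>2 \<le> 1 / (real m * real (Suc m))"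
    using step by (intro divide_left_mono) (auto simp: power2_eq_square)
  also have "\<dots> = 1 / real m - 1 / real (Suc m)" using step by (simp add: field_simps)
  finally show ?case using step by simp
qed simp

text \<open>A Markov-type inequality at the endpoint, from Lagrange interpolation at the nodes
  \<open>(i / m)\<^sup>2\<close>; their quadratic clustering at 0 keeps the interpolation weights bounded.\<close>

lemma linear_coeff_bound:
  fixes p :: "real poly"
  assumes deg: "degree p \<le> m" and m: "1 \<le> m"
    and bd: "\<And>t. 0 \<le> t \<Longrightarrow> t \<le> 1 \<Longrightarrow> \<bar>poly p t - poly p 0\<bar> \<le> D"
  shows "\<bar>coeff p 1\<bar> \<le> 4 * D * (real m)\<^sup>2"
proof -
  \<comment> \<open>Here \<open>h\<close> is the difference quotient of \<open>p\<close> at 0: its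
    value at 0 is the linear coefficient, and its degree is below the number \<open>m\<close> of
    nodes.\<close>
  obtain a h where p: "p = pCons a h" by (rule pCons_cases)
  have D: "0 \<le> D" using bd[of 0] by simp
  define x where "x i = (real i / real m)\<^sup>2" for i
  have x: "0 < x i" "x i \<le> 1" if "i \<in> {1..m}" for i
    using that by (auto simp: x_def power_le_one)
  have "degree h < card {1..m}" using deg m by (auto simp: p split: if_splits)
  moreover have "inj_on x {1..m}"
    using m by (auto simp: inj_on_def x_def power_divide)
  ultimately have "poly h 0 = (\<Sum>i\<in>{1..m}. poly h (x i) * (\<Prod>j\<in>{1..m} - {i}. x j / (x j - x i)))"
    by (intro lagrange_interpolation_at_0) auto
  also have "\<bar>\<dots>\<bar> \<le> (\<Sum>i\<in>{1..m}. \<bar>poly h (x i)\<bar> * (\<Prod>j\<in>{1..m} - {i}. \<bar>x j / (x j - x i)\<bar>))"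
    by (rule order_trans[OF sum_abs]) (simp add: abs_mult abs_prod)
  also have "\<dots> \<le> (\<Sum>i\<in>{1..m}. D * (real m)\<^sup>2 / (real i)\<^sup>2 * 2)"
  proof (intro sum_mono mult_mono)
    fix i assume i: "i \<in> {1..m}"
    have "\<bar>x i * poly h (x i)\<bar> \<le> D" using bd[of "x i"] x[OF i] by (simp add: p)
    then have "\<bar>poly h (x i)\<bar> \<le> D / x i" using x[OF i] by (simp add: abs_mult field_simps)
    then show "\<bar>poly h (x i)\<bar> \<le> D * (real m)\<^sup>2 / (real i)\<^sup>2" using m by (simp add: x_def power_divide)
    have "x j / (x j - x i) = (real j)\<^sup>2 / ((real j)\<^sup>2 - (real i)\<^sup>2)" for j
      using m by (simp add: x_def power_divide divide_simps flip: diff_divide_distrib)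
    then show "(\<Prod>j\<in>{1..m} - {i}. \<bar>x j / (x j - x i)\<bar>) \<le> 2"
      using square_node_weight_le[of i m] i by simp
  qed (use D in \<open>auto intro!: prod_nonneg\<close>)
  \<comment> \<open>At node \<open>i\<close> the quotient is at most \<open>D / x i\<close>, that is
    \<open>D * m\<^sup>2 / i\<^sup>2\<close>, and the weight is at most 2. The inverse squares
    contribute another factor 2, whence the constant 4.\<close>
  also have "\<dots> = 2 * D * (real m)\<^sup>2 * (\<Sum>i = 1..m. 1 / (real i)\<^sup>2)"
    by (simp add: sum_distrib_left mult_ac)
  also have "\<dots> \<le> 2 * D * (real m)\<^sup>2 * 2"
  proof (intro mult_left_mono)
    have "(\<Sum>i = 1..m. 1 / (real i)\<^sup>2) \<le> 2 - 1 / real m" by (rule sum_inverse_squares_le[OF m])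
    also have "\<dots> \<le> 2" by simp
    finally show "(\<Sum>i = 1..m. 1 / (real i)\<^sup>2) \<le> 2" .
  qed (use D in auto)
  finally show ?thesis by (simp add: p poly_0_coeff_0)
qed

section \<open>Random block flips and block sensitivity\<close>

definition flip :: "(nat \<Rightarrow> bool) \<Rightarrow> nat set \<Rightarrow> nat \<Rightarrow> bool" where
  "flip z B = (\<lambda>i. z i \<noteq> (i \<in> B))"

lemma parity_char_flip:
  assumes "finite S"
  shows "parity_char S (flip z B) = parity_char S z * (- 1) ^ card (S \<inter> B)"
proof -
  have "parity_char S (flip z B) = (\<Prod>i\<in>S. (if z i then - 1 else 1) * (if i \<in> B then - 1 else 1))"
    unfolding parity_char_def flip_def by (intro prod.cong) auto
  also have "\<dots> = parity_char S z * (\<Prod>i\<in>S. if i \<in> B then - 1 else 1)"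
    by (simp add: prod.distrib parity_char_def)
  also have "(\<Prod>i\<in>S. if i \<in> B then - 1 else 1 :: real) = (- 1) ^ card (S \<inter> B)"
    using assms by (simp add: prod.If_cases Int_def)
  finally show ?thesis .
qed

lemma card_Int_Union_disjoint:
  assumes "finite S" "finite Y" "disjoint Y"
  shows "card (S \<inter> \<Union>Y) = (\<Sum>B\<in>Y. card (S \<inter> B))"
proof -
  have "S \<inter> \<Union>Y = (\<Union>B\<in>Y. S \<inter> B)" by auto
  also have "card \<dots> = (\<Sum>B\<in>Y. card (S \<inter> B))"
    using assms by (intro card_UN_disjoint) (auto simp: disjoint_def)
  finally show ?thesis .
qed

lemma coeff_1_linear_power: "coeff ([:1, - 2:] ^ k) 1 = (- 2 * real k)"
proof -
  have "coeff ([:1, - 2:] ^ k :: real poly) 1 = poly (pderiv ([:1, - 2:] ^ k)) 0"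
    by (simp add: poly_0_coeff_0 coeff_pderiv)
  also have "\<dots> = - 2 * real k" by (simp add: pderiv_power pderiv_pCons)
  finally show ?thesis .
qed

text \<open>Flip every block independently with probability \<open>t\<close>. The expected value of a low-degree
  multilinear polynomial is a low-degree polynomial in \<open>t\<close>, and its derivative at 0 is the total
  change caused by the single block flips.\<close>

lemma sum_block_flips_le:
  fixes coef :: "nat set \<Rightarrow> real"
  assumes F: "finite F" "\<And>S. S \<in> F \<Longrightarrow> finite S \<and> card S \<le> d" and d: "1 \<le> d"
    and q: "\<And>z. q z = (\<Sum>S\<in>F. coef S * parity_char S z)"
    and bounds: "\<And>z. lo \<le> q z" "\<And>z. q z \<le> hi"
    and Bs: "finite Bs" "disjoint Bs"
  shows "\<bar>\<Sum>B\<in>Bs. q (flip z B) - q z\<bar> \<le> 4 * (hi - lo) * (real d)\<^sup>2"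
proof -
  \<comment> \<open>Flipping a block changes the sign of the character of \<open>S\<close> exactly
    if it meets \<open>S\<close> in an odd number of points. The expected sign is then
    \<open>1 - 2 * t\<close> for such a block and 1 for any other.\<close>
  define od where "od S = card {B \<in> Bs. odd (card (S \<inter> B))}" for S :: "nat set"
  define Q where "Q = (\<Sum>S\<in>F. Polynomial.smult (coef S * parity_char S z) ([:1, - 2:] ^ od S))"
  \<comment> \<open>Each block counted by \<open>od S\<close> contains a point of \<open>S\<close>,
    and disjoint blocks contain different points.\<close>
  have od_le: "od S \<le> d" if "S \<in> F" for S
  proof -
    have "od S = (\<Sum>B\<in>{B \<in> Bs. odd (card (S \<inter> B))}. 1)" by (simp add: od_def)
    also have "\<dots> \<le> (\<Sum>B\<in>{B \<in> Bs. odd (card (S \<inter> B))}. card (S \<inter> B))"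
      by (intro sum_mono) (auto intro: Suc_leI odd_pos)
    also have "\<dots> \<le> (\<Sum>B\<in>Bs. card (S \<inter> B))" using Bs by (intro sum_mono2) auto
    also have "\<dots> = card (S \<inter> \<Union>Bs)" using F(2)[OF that] Bs by (simp add: card_Int_Union_disjoint)
    also have "\<dots> \<le> card S" using F(2)[OF that] by (intro card_mono) auto
    finally show ?thesis using F(2)[OF that] by simp
  qed
  have degQ: "degree Q \<le> d"
    unfolding Q_def
  proof (intro degree_sum_le F(1) order_trans[OF degree_smult_le])
    fix S assume "S \<in> F"
    have "degree ([:1, - 2:] ^ od S :: real poly) \<le> 1 * od S"
      by (intro order_trans[OF degree_power_le]) simp
    then show "degree ([:1, - 2:] ^ od S :: real poly) \<le> d" using od_le[OF \<open>S \<in> F\<close>] by simp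
  qed
  \<comment> \<open>\<open>poly Q t\<close> is the expectation of \<open>q\<close> when every block
    enters the flipped set \<open>Y\<close> independently with probability \<open>t\<close>.\<close>
  have polyQ: "poly Q t = (\<Sum>Y\<in>Pow Bs. t ^ card Y * (1 - t) ^ (card Bs - card Y) * q (flip z (\<Union>Y)))" for t
  proof -
    have pw: "(1 - 2 * t) ^ od S = (\<Sum>Y\<in>Pow Bs. t ^ card Y * (1 - t) ^ (card Bs - card Y) * (- 1) ^ card (S \<inter> \<Union>Y))"
      if "S \<in> F" for S
    proof -
      have "(1 - 2 * t) ^ od S = (\<Prod>B\<in>Bs. t * (- 1) ^ card (S \<inter> B) + (1 - t))"
      proof -
        have "(\<Prod>B\<in>Bs. t * (- 1) ^ card (S \<inter> B) + (1 - t)) = (\<Prod>B\<in>Bs. if odd (card (S \<inter> B)) then 1 - 2 * t else 1)"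
          by (intro prod.cong) auto
        also have "\<dots> = (1 - 2 * t) ^ od S" using Bs(1) by (simp add: prod.If_cases od_def Int_def)
        finally show ?thesis by simp
      qed
      also have "\<dots> = (\<Sum>Y\<in>Pow Bs. (\<Prod>B\<in>Y. t * (- 1) ^ card (S \<inter> B)) * (\<Prod>B\<in>Bs - Y. 1 - t))"
        by (rule prod_add[OF Bs(1)])
      also have "\<dots> = (\<Sum>Y\<in>Pow Bs. t ^ card Y * (1 - t) ^ (card Bs - card Y) * (- 1) ^ card (S \<inter> \<Union>Y))"
      proof (intro sum.cong refl)
        fix Y assume "Y \<in> Pow Bs"
        then have Y: "Y \<subseteq> Bs" "finite Y" "disjoint Y"
          using Bs by (auto intro: finite_subset simp: disjoint_def)
        have "card (S \<inter> \<Union>Y) = (\<Sum>B\<in>Y. card (S \<inter> B))"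
          using F(2)[OF that] Y by (intro card_Int_Union_disjoint) auto
        then show "(\<Prod>B\<in>Y. t * (- 1) ^ card (S \<inter> B)) * (\<Prod>B\<in>Bs - Y. 1 - t) =
            t ^ card Y * (1 - t) ^ (card Bs - card Y) * (- 1) ^ card (S \<inter> \<Union>Y)"
          using Y by (simp add: prod.distrib power_sum card_Diff_subset)
      qed
      finally show ?thesis .
    qed
    have "poly Q t = (\<Sum>S\<in>F. coef S * parity_char S z * (1 - 2 * t) ^ od S)"
      by (simp add: Q_def poly_sum mult.commute)
    also have "\<dots> = (\<Sum>S\<in>F. \<Sum>Y\<in>Pow Bs. t ^ card Y * (1 - t) ^ (card Bs - card Y) *
        (coef S * parity_char S (flip z (\<Union>Y))))"
    proof (intro sum.cong refl)
      fix S assume S: "S \<in> F"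
      then have "finite S" using F(2) by simp
      then show "coef S * parity_char S z * (1 - 2 * t) ^ od S = (\<Sum>Y\<in>Pow Bs.
          t ^ card Y * (1 - t) ^ (card Bs - card Y) * (coef S * parity_char S (flip z (\<Union>Y))))"
        unfolding pw[OF S] by (simp add: parity_char_flip sum_distrib_left mult_ac)
    qed
    also have "\<dots> = (\<Sum>Y\<in>Pow Bs. t ^ card Y * (1 - t) ^ (card Bs - card Y) * q (flip z (\<Union>Y)))"
      by (subst sum.swap) (simp add: q sum_distrib_left)
    finally show ?thesis .
  qed
  have "lo \<le> poly Q t \<and> poly Q t \<le> hi" if t: "0 \<le> t" "t \<le> 1" for t
  proof -
    define w where "w Y = t ^ card Y * (1 - t) ^ (card Bs - card Y)" for Y :: "nat set set"
    have w: "0 \<le> w Y" for Y using t by (simp add: w_def)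
    have one: "(\<Sum>Y\<in>Pow Bs. w Y) = 1"
    proof -
      have "(\<Sum>Y\<in>Pow Bs. w Y) = (\<Sum>Y\<in>Pow Bs. (\<Prod>B\<in>Y. t) * (\<Prod>B\<in>Bs - Y. 1 - t))"
        using Bs by (intro sum.cong) (auto simp: w_def card_Diff_subset finite_subset)
      also have "\<dots> = (\<Prod>B\<in>Bs. t + (1 - t))" by (rule prod_add[OF Bs(1), symmetric])
      finally show ?thesis by simp
    qed
    have "(\<Sum>Y\<in>Pow Bs. w Y * lo) \<le> poly Q t"
      unfolding polyQ w_def[symmetric] by (intro sum_mono mult_left_mono bounds w)
    moreover have "poly Q t \<le> (\<Sum>Y\<in>Pow Bs. w Y * hi)"
      unfolding polyQ w_def[symmetric] by (intro sum_mono mult_left_mono bounds w)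
    ultimately show ?thesis by (simp add: one flip: sum_distrib_right)
  qed
  from this[of 0] this have "\<bar>poly Q t - poly Q 0\<bar> \<le> hi - lo" if "0 \<le> t" "t \<le> 1" for t
    using that by (smt (verit))
  then have "\<bar>coeff Q 1\<bar> \<le> 4 * (hi - lo) * (real d)\<^sup>2" by (intro linear_coeff_bound degQ d)
  also have "coeff Q 1 = (\<Sum>S\<in>F. coef S * parity_char S z * (- 2 * real (od S)))"
    unfolding Q_def coeff_sum coeff_smult coeff_1_linear_power ..
  \<comment> \<open>\<open>- 2 * od S\<close> is the sum over the single blocks of the changes of
    sign, so the linear coefficient is the total effect of single flips on \<open>q\<close>.\<close>
  also have "\<dots> = (\<Sum>S\<in>F. coef S * parity_char S z * (\<Sum>B\<in>Bs. (- 1) ^ card (S \<inter> B) - 1))"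
  proof (intro sum.cong refl arg_cong2[where f = "(*)"])
    fix S
    have "(\<Sum>B\<in>Bs. (- 1) ^ card (S \<inter> B) - 1) = (\<Sum>B\<in>Bs. if odd (card (S \<inter> B)) then - 2 else 0 :: real)"
      by (intro sum.cong) auto
    also have "\<dots> = - 2 * real (od S)" using Bs(1) by (simp add: sum.If_cases od_def Int_def)
    finally show "- 2 * real (od S) = (\<Sum>B\<in>Bs. (- 1) ^ card (S \<inter> B) - 1)" by simp
  qed
  also have "\<dots> = (\<Sum>B\<in>Bs. \<Sum>S\<in>F. coef S * parity_char S z * ((- 1) ^ card (S \<inter> B) - 1))"
    unfolding sum_distrib_left by (rule sum.swap)
  also have "\<dots> = (\<Sum>B\<in>Bs. q (flip z B) - q z)"
    unfolding q using F(2)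
    by (intro sum.cong refl) (simp add: parity_char_flip sum_subtractf algebra_simps cong: sum.cong)
  finally show ?thesis .
qed

text \<open>All sensitive flips start from the same value \<open>G z\<close>, so they move
  \<open>q\<close> in one direction, each by at least 5/24, and nothing cancels. With range 9/8 this
  gives 4 * (9/8) * (24/5) = 21.6 times \<open>d\<^sup>2\<close>.\<close>

lemma block_sensitivity_bound:
  fixes coef :: "nat set \<Rightarrow> real"
  assumes F: "finite F" "\<And>S. S \<in> F \<Longrightarrow> finite S \<and> card S \<le> d" and d: "1 \<le> d"
    and q: "\<And>z. q z = (\<Sum>S\<in>F. coef S * parity_char S z)"
    and bounds: "\<And>z. - (1 / 16) \<le> q z" "\<And>z. q z \<le> 17 / 16"
    and approx: "\<And>z. if G z then 2 / 3 - 1 / 16 \<le> q z else q z \<le> 1 / 3 + 1 / 16"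
    and Bs: "finite Bs" "disjoint Bs" and sens: "\<And>B. B \<in> Bs \<Longrightarrow> G (flip z B) \<noteq> G z"
  shows "card Bs \<le> 22 * d\<^sup>2"
proof -
  have "(5 / 24) * real (card Bs) \<le> \<bar>\<Sum>B\<in>Bs. q (flip z B) - q z\<bar>"
  proof (cases "G z")
    case True
    have "(\<Sum>B\<in>Bs. q (flip z B) - q z) \<le> (\<Sum>B\<in>Bs. - (5 / 24))"
    proof (rule sum_mono)
      fix B assume "B \<in> Bs"
      then show "q (flip z B) - q z \<le> - (5 / 24)"
        using sens[of B] True approx[of z] approx[of "flip z B"] by simp
    qed
    then show ?thesis by simp
  next
    case False
    have "(\<Sum>B\<in>Bs. 5 / 24) \<le> (\<Sum>B\<in>Bs. q (flip z B) - q z)"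
    proof (rule sum_mono)
      fix B assume "B \<in> Bs"
      then show "5 / 24 \<le> q (flip z B) - q z"
        using sens[of B] False approx[of z] approx[of "flip z B"] by simp
    qed
    then show ?thesis by simp
  qed
  also have "\<dots> \<le> 4 * (17 / 16 - - (1 / 16)) * (real d)\<^sup>2"
    by (rule sum_block_flips_le[OF F d q bounds Bs])
  finally have "real (card Bs) \<le> 22 * (real d)\<^sup>2" by simp
  then show ?thesis by (metis of_nat_le_iff of_nat_mult of_nat_numeral of_nat_power)
qed

section \<open>Decision trees\<close>

definition certificate :: "((nat \<Rightarrow> bool) \<Rightarrow> bool) \<Rightarrow> (nat \<Rightarrow> bool) \<Rightarrow> nat set \<Rightarrow> bool" where
  "certificate G z A \<longleftrightarrow> (\<forall>z'. (\<forall>i\<in>A. z' i = z i) \<longrightarrow> G z' = G z)"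

datatype decision_tree = Leaf bool | Query nat decision_tree decision_tree

primrec tree_eval :: "decision_tree \<Rightarrow> (nat \<Rightarrow> bool) \<Rightarrow> bool" where
  "tree_eval (Leaf b) z = b"
| "tree_eval (Query i t0 t1) z = (if z i then tree_eval t1 z else tree_eval t0 z)"

primrec tree_depth :: "decision_tree \<Rightarrow> nat" where
  "tree_depth (Leaf b) = 0"
| "tree_depth (Query i t0 t1) = Suc (max (tree_depth t0) (tree_depth t1))"

primrec tree_vars :: "decision_tree \<Rightarrow> nat set" where
  "tree_vars (Leaf b) = {}"
| "tree_vars (Query i t0 t1) = insert i (tree_vars t0 \<union> tree_vars t1)"

text \<open>Correctness is relative to a set \<open>U\<close>, to be read as the inputs consistent
  with the answers so far; this lets trees be built by induction on the answers.\<close>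

definition tree_computes :: "nat \<Rightarrow> nat \<Rightarrow> (nat \<Rightarrow> bool) set \<Rightarrow> ((nat \<Rightarrow> bool) \<Rightarrow> bool) \<Rightarrow> bool" where
  "tree_computes n d U G \<longleftrightarrow>
     (\<exists>t. tree_depth t \<le> d \<and> tree_vars t \<subseteq> {..<n} \<and> (\<forall>z\<in>U. tree_eval t z = G z))"

lemma tree_computes_constant: "(\<And>z. z \<in> U \<Longrightarrow> G z = b) \<Longrightarrow> tree_computes n d U G"
  unfolding tree_computes_def by (intro exI[of _ "Leaf b"]) simp

lemma tree_computes_mono: "tree_computes n d U G \<Longrightarrow> d \<le> d' \<Longrightarrow> tree_computes n d' U G"
  unfolding tree_computes_def by (meson order_trans)

lemma tree_computes_query:
  assumes "i < n" "\<And>b. tree_computes n d {z \<in> U. z i = b} G"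
  shows "tree_computes n (Suc d) U G"
proof -
  obtain t0 where t0: "tree_depth t0 \<le> d" "tree_vars t0 \<subseteq> {..<n}" "\<forall>z\<in>{z \<in> U. z i = False}. tree_eval t0 z = G z"
    using assms(2)[of False] unfolding tree_computes_def by blast
  obtain t1 where t1: "tree_depth t1 \<le> d" "tree_vars t1 \<subseteq> {..<n}" "\<forall>z\<in>{z \<in> U. z i = True}. tree_eval t1 z = G z"
    using assms(2)[of True] unfolding tree_computes_def by blast
  show ?thesis
    unfolding tree_computes_def using t0 t1 assms(1) by (intro exI[of _ "Query i t0 t1"]) auto
qed

lemma tree_computes_query_set:
  assumes "finite A" "A \<subseteq> {..<n}" "\<And>a. tree_computes n d {z \<in> U. \<forall>i\<in>A. z i = a i} G"
  shows "tree_computes n (card A + d) U G"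
  using assms
proof (induction A arbitrary: U)
  case empty
  then show ?case by simp
next
  case (insert i A)
  have "tree_computes n (card A + d) {z \<in> U. z i = b} G" for b
  proof (rule insert.IH)
    fix a
    have "{z \<in> {z \<in> U. z i = b}. \<forall>j\<in>A. z j = a j} = {z \<in> U. \<forall>j\<in>insert i A. z j = (a(i := b)) j}"
      using insert.hyps by (auto simp: fun_upd_def)
    then show "tree_computes n d {z \<in> {z \<in> U. z i = b}. \<forall>j\<in>A. z j = a j} G"
      using insert.prems(2)[of "a(i := b)"] by simp
  qed (use insert.prems in auto)
  then show ?case using insert.hyps insert.prems by (auto intro!: tree_computes_query)
qed

text \<open>Certificates of inputs with different values conflict in some queried position, so each round
  of querying a 1-certificate shortens all remaining 0-certificates.\<close>

lemma tree_computes_if_certified: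
  assumes "\<And>z. z \<in> U \<Longrightarrow> G z \<Longrightarrow> \<exists>A\<subseteq>{..<n}. card A \<le> k \<and> certificate G z A"
    and "\<And>z. z \<in> U \<Longrightarrow> \<not> G z \<Longrightarrow> \<exists>A\<subseteq>{..<n}. card (A - Q) \<le> l \<and> certificate G z A"
    and "\<And>z z' i. z \<in> U \<Longrightarrow> z' \<in> U \<Longrightarrow> i \<in> Q \<Longrightarrow> z i = z' i"
  shows "tree_computes n (l * k) U G"
  using assms
proof (induction l arbitrary: U Q)
  case 0
  show ?case
  \<comment> \<open>An input with value \<open>False\<close> now has its certificate inside the
    queried set \<open>Q\<close>, on which all of \<open>U\<close> agrees; hence all of
    \<open>U\<close> has value \<open>False\<close>.\<close>
  proof (cases "\<exists>z\<in>U. \<not> G z")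
    case True
    then obtain z where z: "z \<in> U" "\<not> G z" by auto
    then obtain A where A: "A \<subseteq> {..<n}" "card (A - Q) \<le> 0" "certificate G z A"
      using 0(2)[OF z] by blast
    moreover have "finite (A - Q)" using A(1) by (meson finite_Diff finite_lessThan finite_subset)
    ultimately have "A \<subseteq> Q" by simp
    then have "G z' = False" if "z' \<in> U" for z'
    proof -
      have "\<forall>i\<in>A. z' i = z i" using \<open>A \<subseteq> Q\<close> 0(3)[OF that z(1)] by blast
      then show ?thesis using A(3) z(2) unfolding certificate_def by blast
    qed
    then show ?thesis by (rule tree_computes_constant)
  qed (auto intro: tree_computes_constant[of _ _ True])
next
  case (Suc l)
  show ?case
  proof (cases "\<exists>z\<in>U. G z")
    case True
    then obtain y where y: "y \<in> U" "G y" by blast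
    then obtain A where A: "A \<subseteq> {..<n}" "card A \<le> k" "certificate G y A"
      using Suc.prems(1)[OF y] by blast
    have "tree_computes n (l * k) {z \<in> U. \<forall>i\<in>A. z i = a i} G" for a
    proof (rule Suc.IH[of _ "Q \<union> A"])
      fix z assume z: "z \<in> {z \<in> U. \<forall>i\<in>A. z i = a i}" "\<not> G z"
      then have "z \<in> U" by simp
      then obtain B where B: "B \<subseteq> {..<n}" "card (B - Q) \<le> Suc l" "certificate G z B"
        using Suc.prems(2)[OF _ z(2)] by blast
      \<comment> \<open>Otherwise the two certificates merge into one input \<open>w\<close> that
        would have both values.\<close>
      have "\<exists>i\<in>A \<inter> B. y i \<noteq> z i"
      proof (rule ccontr)
        assume "\<not> (\<exists>i\<in>A \<inter> B. y i \<noteq> z i)"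
        moreover define w where "w i = (if i \<in> A then y i else z i)" for i
        ultimately have "\<forall>i\<in>A. w i = y i" "\<forall>i\<in>B. w i = z i" by auto
        then have "G w = G y" "G w = G z" using A(3) B(3) unfolding certificate_def by blast+
        then show False using y z by simp
      qed
      then obtain i where i: "i \<in> A" "i \<in> B" "y i \<noteq> z i" by auto
      \<comment> \<open>All of \<open>U\<close> agrees on \<open>Q\<close>, so the conflict is at a
        new position, and querying \<open>A\<close> shortens the unqueried part of
        \<open>B\<close>.\<close>
      then have "i \<notin> Q" using Suc.prems(3)[OF y(1), of z i] z(1) by blast
      then have "B - (Q \<union> A) \<subset> B - Q" using i by auto
      then have "card (B - (Q \<union> A)) < card (B - Q)"
        using B(1) by (intro psubset_card_mono) (auto intro: finite_subset)
      then show "\<exists>A'\<subseteq>{..<n}. card (A' - (Q \<union> A)) \<le> l \<and> certificate G z A'"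
        using B by (intro exI[of _ B]) auto
    next
      fix z assume "z \<in> {z \<in> U. \<forall>i\<in>A. z i = a i}" "G z"
      then show "\<exists>A\<subseteq>{..<n}. card A \<le> k \<and> certificate G z A" using Suc.prems(1) by blast
    next
      fix z z' i
      assume *: "z \<in> {z \<in> U. \<forall>i\<in>A. z i = a i}" "z' \<in> {z \<in> U. \<forall>i\<in>A. z i = a i}" "i \<in> Q \<union> A"
      show "z i = z' i"
      proof (cases "i \<in> A")
        case False
        then show ?thesis using * by (intro Suc.prems(3)) auto
      qed (use * in simp)
    qed
    then have "tree_computes n (card A + l * k) U G"
      using A(1) by (intro tree_computes_query_set) (auto intro: finite_subset)
    then show ?thesis using A(2) by (auto intro: tree_computes_mono)
  qed (auto intro: tree_computes_constant[of _ _ False])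
qed

text \<open>A minimal sensitive block \<open>B\<close> has at most \<open>K\<close> elements: after
  flipping it, undoing any single element changes the value again. A largest disjoint family of
  minimal blocks has at most \<open>K\<close> members. Its union is a certificate, since an input
  with another value that agrees there would yield one more disjoint minimal block.\<close>

lemma small_certificate:
  assumes dep: "\<And>z z'. (\<And>i. i < n \<Longrightarrow> z i = z' i) \<Longrightarrow> G z = G z'"
    and bs: "\<And>z Bs. finite Bs \<Longrightarrow> disjoint Bs \<Longrightarrow> (\<And>B. B \<in> Bs \<Longrightarrow> G (flip z B) \<noteq> G z) \<Longrightarrow> card Bs \<le> K"
  shows "\<exists>A\<subseteq>{..<n}. card A \<le> K * K \<and> certificate G z A"
proof -
  define M where "M = {B. B \<subseteq> {..<n} \<and> G (flip z B) \<noteq> G z \<and> (\<forall>B'\<subset>B. G (flip z B') = G z)}"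
  have finM: "finite M" by (rule finite_subset[of _ "Pow {..<n}"]) (auto simp: M_def)
  have card_M: "card B \<le> K" if B: "B \<in> M" for B
  proof -
    have "card ((\<lambda>i. {i}) ` B) \<le> K"
    proof (rule bs)
      show "finite ((\<lambda>i. {i}) ` B)" using B by (auto simp: M_def intro: finite_subset)
      show "disjoint ((\<lambda>i. {i}) ` B)" by (auto simp: disjoint_def)
      fix C assume "C \<in> (\<lambda>i. {i}) ` B"
      then obtain i where i: "C = {i}" "i \<in> B" by auto
      then have "flip (flip z B) C = flip z (B - {i})" by (auto simp: flip_def)
      moreover have "B - {i} \<subset> B" using i by auto
      ultimately show "G (flip (flip z B) C) \<noteq> G (flip z B)" using B by (auto simp: M_def)
    qed
    then show ?thesis by (simp add: card_image)
  qed
  define \<F> where "\<F> = {Bs. Bs \<subseteq> M \<and> disjoint Bs}"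
  have "{} \<in> \<F>" by (simp add: \<F>_def disjoint_def)
  moreover have "finite \<F>" using finM by (auto simp: \<F>_def intro: finite_subset[of _ "Pow M"])
  ultimately have "finite (card ` \<F>)" "Max (card ` \<F>) \<in> card ` \<F>"
    by (auto intro!: Max_in)
  then obtain Bs where Bs: "Bs \<in> \<F>" "\<And>Cs. Cs \<in> \<F> \<Longrightarrow> card Cs \<le> card Bs"
    by (metis (no_types, lifting) Max_ge imageE imageI)
  have BsM: "Bs \<subseteq> M" "disjoint Bs" "finite Bs" using Bs(1) finM by (auto simp: \<F>_def intro: finite_subset)
  have sub: "\<Union>Bs \<subseteq> {..<n}" using BsM by (auto simp: M_def)
  have "card Bs \<le> K" using BsM by (intro bs[of _ z]) (auto simp: M_def)
  have "card (\<Union>Bs) \<le> (\<Sum>B\<in>Bs. card B)" by (rule card_Union_le_sum_card)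
  also have "\<dots> \<le> (\<Sum>B\<in>Bs. K)" using BsM card_M by (intro sum_mono) auto
  also have "\<dots> \<le> K * K" using \<open>card Bs \<le> K\<close> by simp
  finally have "card (\<Union>Bs) \<le> K * K" .
  moreover have "certificate G z (\<Union>Bs)"
    unfolding certificate_def
  proof (intro allI impI, rule ccontr)
    fix z' assume z': "\<forall>i\<in>\<Union>Bs. z' i = z i" "G z' \<noteq> G z"
    define B0 where "B0 = {i. i < n \<and> z' i \<noteq> z i}"
    have "G (flip z B0) = G z'" by (intro dep) (auto simp: flip_def B0_def)
    then have B0: "G (flip z B0) \<noteq> G z" using z' by simp
    have "finite B0" by (simp add: B0_def)
    \<comment> \<open>The set of disagreements is sensitive; shrink it to a minimal sensitive
      subset.\<close>
    then obtain B where B: "B \<subseteq> B0" "G (flip z B) \<noteq> G z" "\<And>B'. B' \<subset> B \<Longrightarrow> G (flip z B') = G z"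
      using B0
    proof (induction B0 arbitrary: thesis rule: finite_psubset_induct)
      case (psubset A)
      show ?case
      proof (cases "\<exists>B'\<subset>A. G (flip z B') \<noteq> G z")
        case True
        then obtain B' where B': "B' \<subset> A" "G (flip z B') \<noteq> G z" by auto
        show ?thesis by (rule psubset.IH[OF B'(1) _ B'(2)]) (use psubset.prems(1) B'(1) in blast)
      qed (use psubset.prems in blast)
    qed
    have "B \<in> M" using B by (auto simp: M_def B0_def)
    moreover have "B \<inter> \<Union>Bs = {}" using B(1) z'(1) by (auto simp: B0_def)
    ultimately have "insert B Bs \<in> \<F>" using BsM by (auto simp: \<F>_def disjoint_def)
    moreover have "B \<notin> Bs"
    proof
      assume "B \<in> Bs"
      then have "B = {}" using \<open>B \<inter> \<Union>Bs = {}\<close> by auto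
      then show False using B(2) by (simp add: flip_def)
    qed
    ultimately show False using Bs(2)[of "insert B Bs"] BsM(3) by simp
  qed
  ultimately show ?thesis using sub by blast
qed

text \<open>Both kinds of certificate have size at most \<open>K * K\<close>: there are at most that
  many rounds, each with at most that many queries.\<close>

theorem decision_tree_from_block_sensitivity:
  assumes "\<And>z z'. (\<And>i. i < n \<Longrightarrow> z i = z' i) \<Longrightarrow> G z = G z'"
    and "\<And>z Bs. finite Bs \<Longrightarrow> disjoint Bs \<Longrightarrow> (\<And>B. B \<in> Bs \<Longrightarrow> G (flip z B) \<noteq> G z) \<Longrightarrow> card Bs \<le> K"
  shows "tree_computes n (K ^ 4) UNIV G"
proof -
  have "\<exists>A\<subseteq>{..<n}. card (A - {}) \<le> K * K \<and> certificate G z A" for z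
    unfolding Diff_empty using assms by (rule small_certificate)
  then have "tree_computes n (K * K * (K * K)) UNIV G"
    by (intro tree_computes_if_certified[where Q = "{}"]) (simp_all only: Diff_empty empty_iff)
  then show ?thesis by (simp add: power4_eq_xxxx mult.assoc)
qed

section \<open>Randomized protocols\<close>

text \<open>The output is determined by the transcript, hence known to both parties, so the
  continuation may depend on it at no further cost.\<close>

primrec bind_protocol :: "('x, 'y) protocol \<Rightarrow> (bool \<Rightarrow> ('x, 'y) protocol) \<Rightarrow> ('x, 'y) protocol" where
  "bind_protocol (Output b) k = k b"
| "bind_protocol (Alice_Bit s p0 p1) k = Alice_Bit s (bind_protocol p0 k) (bind_protocol p1 k)"
| "bind_protocol (Bob_Bit s p0 p1) k = Bob_Bit s (bind_protocol p0 k) (bind_protocol p1 k)"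

lemma run_bind_protocol [simp]: "run (bind_protocol p k) x y = run (k (run p x y)) x y"
  by (induction p) auto

lemma cost_bind_protocol: "(\<And>b. cost (k b) \<le> d) \<Longrightarrow> cost (bind_protocol p k) \<le> cost p + d"
  by (induction p) auto

primrec pull_protocol :: "('u \<Rightarrow> 'x) \<Rightarrow> ('v \<Rightarrow> 'y) \<Rightarrow> ('x, 'y) protocol \<Rightarrow> ('u, 'v) protocol" where
  "pull_protocol \<alpha> \<beta> (Output b) = Output b"
| "pull_protocol \<alpha> \<beta> (Alice_Bit s p0 p1) = Alice_Bit (s \<circ> \<alpha>) (pull_protocol \<alpha> \<beta> p0) (pull_protocol \<alpha> \<beta> p1)"
| "pull_protocol \<alpha> \<beta> (Bob_Bit s p0 p1) = Bob_Bit (s \<circ> \<beta>) (pull_protocol \<alpha> \<beta> p0) (pull_protocol \<alpha> \<beta> p1)"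

lemma run_pull_protocol [simp]: "run (pull_protocol \<alpha> \<beta> p) x y = run p (\<alpha> x) (\<beta> y)"
  by (induction p) auto

lemma cost_pull_protocol [simp]: "cost (pull_protocol \<alpha> \<beta> p) = cost p"
  by (induction p) auto

section \<open>Error reduction\<close>

definition randomized_computes_err :: "nat \<Rightarrow> real \<Rightarrow> ('x \<times> 'y \<Rightarrow> bool option) \<Rightarrow> bool" where
  "randomized_computes_err c \<epsilon> F \<longleftrightarrow>
     (\<exists>P :: ('x, 'y) protocol pmf.
        (\<forall>p \<in> set_pmf P. cost p \<le> c) \<and>
        (\<forall>x y b. F (x, y) = Some b \<longrightarrow> measure_pmf.prob P {p. run p x y \<noteq> b} \<le> \<epsilon>))"

lemma randomized_computes_iff_err: "randomized_computes c F \<longleftrightarrow> randomized_computes_err c (1 / 3) F"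
  by (simp add: randomized_computes_def randomized_computes_err_def)

lemma randomized_computes_err_mono:
  "randomized_computes_err c \<epsilon> F \<Longrightarrow> c \<le> c' \<Longrightarrow> \<epsilon> \<le> \<epsilon>' \<Longrightarrow> randomized_computes_err c' \<epsilon>' F"
  unfolding randomized_computes_err_def by (meson order_trans)

definition majority_protocol where
  "majority_protocol t = (case t of (p, q, r) \<Rightarrow>
     bind_protocol p (\<lambda>a. bind_protocol q (\<lambda>b. if a = b then Output a else r)))"

lemma prob_pair_pmf_Times:
  "measure_pmf.prob (pair_pmf M N) (A \<times> B) = measure_pmf.prob M A * measure_pmf.prob N B"
proof -
  have "(A \<times> B) \<inter> set_pmf (pair_pmf M N) = (A \<inter> set_pmf M) \<times> (B \<inter> set_pmf N)" by auto
  then have "measure_pmf.prob (pair_pmf M N) (A \<times> B)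
      = measure_pmf.prob (pair_pmf M N) ((A \<inter> set_pmf M) \<times> (B \<inter> set_pmf N))"
    by (metis measure_Int_set_pmf)
  also have "\<dots> = measure_pmf.prob M (A \<inter> set_pmf M) * measure_pmf.prob N (B \<inter> set_pmf N)"
    by (intro measure_pmf_prob_product) (auto intro: countable_Int2)
  finally show ?thesis by (simp add: measure_Int_set_pmf)
qed

text \<open>The event says that at least two of three independent runs err, with probability
  \<open>s * (3 * s - 2 * s\<^sup>2)\<close>. The bracket is 7/9 at s = 1/3 and smaller below, so
  every majority vote shrinks the error by a constant factor.\<close>

lemma majority_error:
  fixes P :: "'a pmf"
  assumes "measure_pmf.prob P S \<le> \<epsilon>" "\<epsilon> \<le> 1 / 3"
  shows "measure_pmf.prob (pair_pmf P (pair_pmf P P))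
      (S \<times> (S \<times> UNIV) \<union> (S \<times> ((- S) \<times> S) \<union> (- S) \<times> (S \<times> S))) \<le> 7 / 9 * \<epsilon>"
proof -
  define s where "s = measure_pmf.prob P S"
  have s: "0 \<le> s" "s \<le> \<epsilon>" using assms by (auto simp: s_def)
  have c: "measure_pmf.prob P (- S) = 1 - s"
    using measure_pmf.prob_compl[of S P] by (simp add: s_def Compl_eq_Diff_UNIV)
  let ?T = "pair_pmf P (pair_pmf P P)"
  have prod: "measure_pmf.prob ?T (A \<times> (B \<times> C)) = measure_pmf.prob P A * (measure_pmf.prob P B * measure_pmf.prob P C)"
    for A B C by (simp add: prob_pair_pmf_Times)
  have "measure_pmf.prob ?T (S \<times> (S \<times> UNIV) \<union> (S \<times> ((- S) \<times> S) \<union> (- S) \<times> (S \<times> S)))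
     \<le> measure_pmf.prob ?T (S \<times> (S \<times> UNIV)) + (measure_pmf.prob ?T (S \<times> ((- S) \<times> S))
        + measure_pmf.prob ?T ((- S) \<times> (S \<times> S)))"
    by (intro order_trans[OF measure_Un_le] add_mono order_refl measure_Un_le) auto
  also have "\<dots> = s * (3 * s - 2 * s\<^sup>2)"
    by (simp add: prod c flip: s_def) (simp add: algebra_simps power2_eq_square)
  also have "\<dots> \<le> s * (7 / 9)"
  proof (intro mult_left_mono s)
    have "0 \<le> (1 / 3 - s) * (7 / 3 - 2 * s)" using s assms(2) by (intro mult_nonneg_nonneg) auto
    also have "\<dots> = 7 / 9 - (3 * s - 2 * s\<^sup>2)" by (simp add: field_simps power2_eq_square)
    finally show "3 * s - 2 * s\<^sup>2 \<le> 7 / 9" by simp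
  qed
  also have "\<dots> \<le> 7 / 9 * \<epsilon>" using s by simp
  finally show ?thesis .
qed

lemma randomized_computes_err_majority:
  assumes "randomized_computes_err c \<epsilon> F" "\<epsilon> \<le> 1 / 3"
  shows "randomized_computes_err (3 * c) (7 / 9 * \<epsilon>) F"
proof -
  obtain P where P: "\<And>p. p \<in> set_pmf P \<Longrightarrow> cost p \<le> c"
    "\<And>x y b. F (x, y) = Some b \<Longrightarrow> measure_pmf.prob P {p. run p x y \<noteq> b} \<le> \<epsilon>"
    using assms unfolding randomized_computes_err_def by blast
  let ?T = "pair_pmf P (pair_pmf P P)"
  define M where "M = map_pmf majority_protocol ?T"
  have "cost m \<le> 3 * c" if m: "m \<in> set_pmf M" for m
  proof -
    obtain p q r where pqr: "p \<in> set_pmf P" "q \<in> set_pmf P" "r \<in> set_pmf P" "m = majority_protocol (p, q, r)"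
      using m unfolding M_def by auto
    have "cost (if a = b then Output a else r) \<le> c" for a b using P(1) pqr by simp
    then have "cost (bind_protocol q (\<lambda>b. if a = b then Output a else r)) \<le> cost q + c" for a
      by (rule cost_bind_protocol)
    then have "cost m \<le> cost p + (cost q + c)"
      unfolding pqr(4) majority_protocol_def prod.case by (rule cost_bind_protocol)
    then show ?thesis using P(1)[OF pqr(1)] P(1)[OF pqr(2)] by simp
  qed
  moreover have "measure_pmf.prob M {p. run p x y \<noteq> b} \<le> 7 / 9 * \<epsilon>" if F: "F (x, y) = Some b" for x y b
  proof -
    define S where "S = {p. run p x y \<noteq> b}"
    have "majority_protocol -` {p. run p x y \<noteq> b}
        = S \<times> (S \<times> UNIV) \<union> (S \<times> ((- S) \<times> S) \<union> (- S) \<times> (S \<times> S))"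
      by (auto simp: S_def majority_protocol_def split: if_splits)
    then show ?thesis
      using majority_error[of P S \<epsilon>] P(2)[OF F] assms(2) by (simp add: M_def S_def)
  qed
  ultimately show ?thesis unfolding randomized_computes_err_def by blast
qed

lemma randomized_computes_err_power:
  assumes "randomized_computes_err c (1 / 3) F"
  shows "randomized_computes_err (3 ^ j * c) ((7 / 9) ^ j / 3) F"
proof (induction j)
  case (Suc j)
  have "(7 / 9) ^ j / 3 \<le> (1 / 3 :: real)" by (simp add: power_le_one)
  from randomized_computes_err_majority[OF Suc this] show ?case by (simp add: mult_ac)
qed (use assms in simp)

text \<open>Three nested majorities multiply the cost by 27 and the error by 343/729, less than 1/2.
  Iterating this \<open>l\<close> times, with \<open>2 ^ l\<close> between \<open>D\<close> and
  \<open>2 * D\<close>, suffices; rounding 27 up to \<open>2 ^ 5\<close> turns the cost into a fifth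
  power of \<open>D\<close>.\<close>

lemma randomized_computes_err_amplify:
  assumes "randomized_computes_err c (1 / 3) F" "1 \<le> D"
  shows "randomized_computes_err (32 * D ^ 5 * c) (1 / (3 * real D)) F"
proof -
  define l where "l = (LEAST l. D \<le> 2 ^ l)"
  have l: "D \<le> 2 ^ l" unfolding l_def by (rule LeastI[of _ D]) (simp add: less_imp_le)
  have l2: "2 ^ l \<le> 2 * D"
  proof (cases l)
    case 0
    then show ?thesis using assms(2) by simp
  next
    case (Suc m)
    then have "\<not> D \<le> 2 ^ m" using not_less_Least[of m "\<lambda>l. D \<le> 2 ^ l"] by (simp add: l_def)
    then show ?thesis by (simp add: Suc)
  qed
  have "(3 :: nat) ^ (3 * l) = 27 ^ l" by (simp add: power_mult)
  also have "\<dots> \<le> 32 ^ l" by (intro power_mono) auto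
  also have "\<dots> = (2 ^ 5) ^ l" by simp
  also have "\<dots> = (2 ^ l) ^ 5" by (simp only: mult.commute flip: power_mult)
  also have "\<dots> \<le> (2 * D) ^ 5" using l2 by (intro power_mono) auto
  finally have "3 ^ (3 * l) \<le> 32 * D ^ 5" by (simp add: power_mult_distrib)
  moreover have "(7 / 9 :: real) ^ (3 * l) / 3 \<le> 1 / (3 * real D)"
  proof -
    have "(7 / 9 :: real) ^ (3 * l) = (343 / 729) ^ l" by (simp add: power_mult power_divide)
    also have "\<dots> \<le> (1 / 2) ^ l" by (intro power_mono) auto
    also have "\<dots> \<le> 1 / real D"
    proof -
      have "real D \<le> 2 ^ l" using l by (metis of_nat_le_iff of_nat_numeral of_nat_power)
      then show ?thesis using assms(2) by (simp add: power_one_over field_simps)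
    qed
    finally show ?thesis using assms(2) by (simp add: field_simps)
  qed
  ultimately show ?thesis
    using randomized_computes_err_power[OF assms(1), of "3 * l"]
    by (elim randomized_computes_err_mono) auto
qed

lemma randomized_computes_err_output: "0 \<le> \<epsilon> \<Longrightarrow> (\<And>x y b'. F (x, y) = Some b' \<Longrightarrow> b' = b) \<Longrightarrow> randomized_computes_err c \<epsilon> F"
  unfolding randomized_computes_err_def
  by (intro exI[of _ "return_pmf (Output b)"]) (auto simp: measure_return_pmf)

section \<open>Simulation of decision trees\<close>

text \<open>Replace each query by the protocol for \<open>g\<close> on the corresponding block; cost
  and, by the union bound, error add up along a path.\<close>

lemma randomized_computes_err_tree:
  assumes g: "randomized_computes_err c \<epsilon> g" and \<epsilon>: "0 \<le> \<epsilon>" and vars: "tree_vars t \<subseteq> {..<n}"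
  shows "randomized_computes_err (tree_depth t * c) (real (tree_depth t) * \<epsilon>)
    (block_composition n k (\<lambda>bs. tree_eval t (\<lambda>i. bs ! i)) g)"
  using vars
proof (induction t)
  case (Leaf b)
  show ?case by (rule randomized_computes_err_output[of _ _ b]) (auto simp: block_composition_def split: if_splits)
next
  case (Query i t0 t1)
  define d where "d = max (tree_depth t0) (tree_depth t1)"
  define F where "F t = block_composition n k (\<lambda>bs. tree_eval t (\<lambda>i. bs ! i)) g" for t
  have i: "i < n" using Query.prems by auto
  have "randomized_computes_err (d * c) (real d * \<epsilon>) (F t0)" "randomized_computes_err (d * c) (real d * \<epsilon>) (F t1)"
    unfolding F_def using Query \<epsilon> by (auto simp: d_def elim!: randomized_computes_err_mono intro!: mult_right_mono)
  then obtain P0 P1 where P0: "\<And>p. p \<in> set_pmf P0 \<Longrightarrow> cost p \<le> d * c"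
      "\<And>x y b. F t0 (x, y) = Some b \<Longrightarrow> measure_pmf.prob P0 {p. run p x y \<noteq> b} \<le> real d * \<epsilon>"
    and P1: "\<And>p. p \<in> set_pmf P1 \<Longrightarrow> cost p \<le> d * c"
      "\<And>x y b. F t1 (x, y) = Some b \<Longrightarrow> measure_pmf.prob P1 {p. run p x y \<noteq> b} \<le> real d * \<epsilon>"
    unfolding randomized_computes_err_def by blast
  obtain P where P: "\<And>p. p \<in> set_pmf P \<Longrightarrow> cost p \<le> c"
    "\<And>x y b. g (x, y) = Some b \<Longrightarrow> measure_pmf.prob P {p. run p x y \<noteq> b} \<le> \<epsilon>"
    using g unfolding randomized_computes_err_def by blast
  define M where "M = map_pmf (\<lambda>(p, q0, q1). bind_protocol (pull_protocol (block k i) (block k i) p)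
      (\<lambda>b. if b then q1 else q0)) (pair_pmf P (pair_pmf P0 P1))"
  have "cost m \<le> Suc d * c" if mM: "m \<in> set_pmf M" for m
  proof -
    obtain p q0 q1 where m: "p \<in> set_pmf P" "q0 \<in> set_pmf P0" "q1 \<in> set_pmf P1"
      "m = bind_protocol (pull_protocol (block k i) (block k i) p) (\<lambda>b. if b then q1 else q0)"
      using mM unfolding M_def by auto
    have "cost m \<le> cost (pull_protocol (block k i) (block k i) p) + d * c"
      unfolding m(4) using P0(1)[OF m(2)] P1(1)[OF m(3)] by (intro cost_bind_protocol) simp
    then show ?thesis using P(1)[OF m(1)] by simp
  qed
  moreover have "measure_pmf.prob M {p. run p x y \<noteq> b} \<le> real (Suc d) * \<epsilon>"
    if "F (Query i t0 t1) (x, y) = Some b" for x y b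
  proof -
    define v where "v j = the (g (block k j x, block k j y))" for j
    have dom: "x \<in> bitstrings (n * k) \<and> y \<in> bitstrings (n * k) \<and> (\<forall>i<n. (block k i x, block k i y) \<in> dom g)"
      using that by (auto simp: F_def block_composition_def split: if_splits)
    have val: "F t (x, y) = Some (tree_eval t ((!) (map v [0..<n])))" for t
      using dom by (simp add: F_def block_composition_def v_def[abs_def])
    have gi: "g (block k i x, block k i y) = Some (v i)" using dom i by (force simp: v_def)
    define t' where "t' = (if v i then t1 else t0)"
    define P' where "P' = (if v i then P1 else P0)"
    have b: "F t' (x, y) = Some b" using that i unfolding val t'_def by (auto split: if_splits)
    define E1 where "E1 = {p. run p (block k i x) (block k i y) \<noteq> v i}"
    define E2 where "E2 = {p. run p x y \<noteq> b}"
    let ?T = "pair_pmf P (pair_pmf P0 P1)"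
    have "measure_pmf.prob M {p. run p x y \<noteq> b} = measure_pmf.prob ?T
       ((\<lambda>(p, q0, q1). bind_protocol (pull_protocol (block k i) (block k i) p) (\<lambda>b. if b then q1 else q0)) -` {p. run p x y \<noteq> b})"
      by (simp add: M_def)
    \<comment> \<open>A wrong output needs a wrong answer to the query or an error in the subtree
      selected by the correct answer \<open>v i\<close>.\<close>
    also have "\<dots> \<le> measure_pmf.prob ?T (fst -` E1 \<union> (if v i then snd \<circ> snd else fst \<circ> snd) -` E2)"
      by (intro measure_pmf.finite_measure_mono) (auto simp: E1_def E2_def split: if_splits)
    also have "\<dots> \<le> measure_pmf.prob ?T (fst -` E1) + measure_pmf.prob ?T ((if v i then snd \<circ> snd else fst \<circ> snd) -` E2)"
      by (rule measure_Un_le) auto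
    also have "measure_pmf.prob ?T (fst -` E1) = measure_pmf.prob (map_pmf fst ?T) E1" by simp
    also have "map_pmf fst ?T = P" by (rule map_fst_pair_pmf)
    also have "measure_pmf.prob ?T ((if v i then snd \<circ> snd else fst \<circ> snd) -` E2)
        = measure_pmf.prob (map_pmf (if v i then snd \<circ> snd else fst \<circ> snd) ?T) E2" by simp
    also have "map_pmf (if v i then snd \<circ> snd else fst \<circ> snd) ?T = P'"
      by (simp add: P'_def map_pmf_compose map_fst_pair_pmf map_snd_pair_pmf)
    also have "measure_pmf.prob P E1 + measure_pmf.prob P' E2 \<le> \<epsilon> + real d * \<epsilon>"
      using P(2)[OF gi] P0(2)[of x y b] P1(2)[of x y b] b
      by (intro add_mono) (auto simp: E1_def E2_def P'_def t'_def split: if_splits)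
    finally show ?thesis by (simp add: algebra_simps)
  qed
  ultimately show ?case
    unfolding randomized_computes_err_def F_def tree_depth.simps d_def[symmetric] by blast
qed

text \<open>Makes the \<open>LEAST\<close> in \<open>R_cc\<close> meaningful: Alice tests her input
  against the finitely many candidates, and at the match Bob announces the value.\<close>

lemma randomized_computes_err_exists:
  fixes F :: "'x \<times> 'y \<Rightarrow> bool option"
  assumes "finite (fst ` dom F)"
  shows "\<exists>c. randomized_computes_err c 0 F"
proof -
  have "\<exists>p. \<forall>x\<in>X. \<forall>y. run p x y = (F (x, y) = Some True)" if "finite X" for X
    using that
  proof induction
    case (insert x0 X)
    then obtain p where p: "\<forall>x\<in>X. \<forall>y. run p x y = (F (x, y) = Some True)" by blast
    then show ?case
      by (intro exI[of _ "Alice_Bit (\<lambda>x. x = x0) p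
          (Bob_Bit (\<lambda>y. F (x0, y) = Some True) (Output False) (Output True))"]) auto
  qed simp
  from this[OF assms] obtain p where p: "\<And>x y. x \<in> fst ` dom F \<Longrightarrow> run p x y = (F (x, y) = Some True)" by blast
  have "run p x y = b" if "F (x, y) = Some b" for x y b
    using p[of x y] that by (force simp: image_iff)
  then show ?thesis
    unfolding randomized_computes_err_def
    by (intro exI[of _ "cost p"] exI[of _ "return_pmf p"]) (auto simp: measure_return_pmf)
qed

section \<open>Comparison of the complexities\<close>

text \<open>Enlarging the bound from \<open>1 / (2 * e * n)\<close> to \<open>1 / (4 * n)\<close>
  makes the inequality strict, so a witness exists without showing that the infimum is
  attained.\<close>

lemma spectral_witness_of_discrepancy:
  assumes "1 \<le> n" and "spectral_discrepancy k g \<le> ereal (1 / (2 * exp 1 * real n))"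
  shows "\<exists>r. spectral_witness k g r \<and> r * real n \<le> 1 / 4"
proof -
  \<comment> \<open>From (1 + 1/2)^2 = 9/4.\<close>
  have "(2 :: real) < exp 1" using exp_ge_one_plus_x_over_n_power_n[of 2 1] by (simp add: power2_eq_square)
  then have "1 / (2 * exp 1 * real n) < 1 / (4 * real n)"
    using assms(1) by (intro divide_strict_left_mono) auto
  then have "spectral_discrepancy k g < ereal (1 / (4 * real n))"
    using assms(2) by (metis ereal_less_eq(3) le_less_trans less_ereal.simps(1))
  then obtain r where "spectral_witness k g r" "r < 1 / (4 * real n)"
    unfolding spectral_discrepancy_def by (auto simp: Inf_less_iff)
  then show ?thesis using assms(1) by (intro exI[of _ r]) (simp add: field_simps)
qed

lemma spectral_witness_values:
  assumes "spectral_witness k g r"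
  shows "\<exists>x\<in>bitstrings k. \<exists>y\<in>bitstrings k. g (x, y) = Some b"
proof -
  obtain IA IB \<mu>0 \<mu>1 where I: "IA \<subseteq> bitstrings k" "IB \<subseteq> bitstrings k"
    and d: "b_distribution g IA IB False \<mu>0" "b_distribution g IA IB True \<mu>1"
    using assms unfolding spectral_witness_def by (elim exE conjE) blast
  define \<mu> where "\<mu> = (if b then \<mu>1 else \<mu>0)"
  have \<mu>: "b_distribution g IA IB b \<mu>" using d by (cases b) (simp_all add: \<mu>_def)
  obtain w where "w \<in> set_pmf \<mu>" using set_pmf_not_empty[of \<mu>] by blast
  then have "w \<in> {z \<in> IA \<times> IB. g z = Some b}" using \<mu> unfolding b_distribution_def by blast
  then show ?thesis using I by (cases w) auto
qed

text \<open>Hybrid argument: pass from \<open>z\<close> to \<open>z'\<close> one coordinate at a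
  time; some step must change the value.\<close>

lemma sensitive_input_exists:
  fixes G :: "(nat \<Rightarrow> bool) \<Rightarrow> bool"
  assumes dep: "\<And>z z'. (\<And>i. i < n \<Longrightarrow> z i = z' i) \<Longrightarrow> G z = G z'" and "G z \<noteq> G z'"
  shows "\<exists>w i. i < n \<and> G (w(i := True)) \<noteq> G (w(i := False))"
proof (rule ccontr)
  assume *: "\<not> (\<exists>w i. i < n \<and> G (w(i := True)) \<noteq> G (w(i := False)))"
  have upd: "G (w(i := b)) = G w" if "i < n" for w i b
  proof -
    have "G (w(i := b)) = G (w(i := w i))" using * that by (cases b; cases "w i") auto
    then show ?thesis by simp
  qed
  define h where "h m i = (if i < m then z' i else z i)" for m i :: nat
  have "m \<le> n \<Longrightarrow> G (h m) = G z" for m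
  proof (induction m)
    case (Suc m)
    have "h (Suc m) = (h m)(m := z' m)" by (simp add: h_def fun_eq_iff less_Suc_eq)
    then have "G (h (Suc m)) = G (h m)" using Suc.prems by (simp only:) (rule upd, simp)
    then show ?case using Suc by simp
  next
    case 0
    have "h 0 = z" by (rule ext) (simp add: h_def)
    then show ?case by simp
  qed
  then have "G (h n) = G z" by simp
  moreover have "G (h n) = G z'" by (rule dep) (simp add: h_def)
  ultimately show False using assms(2) by simp
qed

text \<open>Fill every block except \<open>i\<close> with a fixed input pair of \<open>g\<close> of
  value \<open>w j\<close>. The composition then depends only on the value of \<open>g\<close> on
  block \<open>i\<close>, and by sensitivity it is \<open>g\<close> or its negation; in the second
  case the acceptance is complemented.\<close>

lemma quantum_computes_restrict:
  assumes Q: "quantum_computes c (block_composition n k f g)"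
    and W: "spectral_witness k g r" and dom: "dom g \<subseteq> bitstrings k \<times> bitstrings k"
    and i: "i < n" and sens: "f (map (w(i := True)) [0..<n]) \<noteq> f (map (w(i := False)) [0..<n])"
  shows "quantum_computes c g"
proof -
  obtain acc where acc: "quantum_acceptance c acc"
    and T: "\<And>x y. block_composition n k f g (x, y) = Some True \<Longrightarrow> 1 - acc x y \<le> 1 / 3"
    and F: "\<And>x y. block_composition n k f g (x, y) = Some False \<Longrightarrow> acc x y \<le> 1 / 3"
    using Q unfolding quantum_computes_def by blast
  obtain u v where uv: "\<And>b. u b \<in> bitstrings k" "\<And>b. v b \<in> bitstrings k" "\<And>b. g (u b, v b) = Some b"
    using spectral_witness_values[OF W] by metis
  define \<alpha> where "\<alpha> x = concat (map (\<lambda>j. if j = i then x else u (w j)) [0..<n])" for x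
  define \<beta> where "\<beta> y = concat (map (\<lambda>j. if j = i then y else v (w j)) [0..<n])" for y
  define acc' where "acc' x y = acc (\<alpha> x) (\<beta> y)" for x y
  have acc': "quantum_acceptance c acc'"
    unfolding acc'_def by (rule quantum_acceptance_reindex[OF acc])
  have val: "block_composition n k f g (\<alpha> x, \<beta> y) = Some (f (map (w(i := b)) [0..<n]))"
    if "g (x, y) = Some b" for x y b
  proof -
    have xy: "x \<in> bitstrings k" "y \<in> bitstrings k" using that dom by auto
    show ?thesis
      unfolding \<alpha>_def \<beta>_def
      by (rule block_composition_concat) (use xy uv that in \<open>auto simp: nlists_def\<close>)
  qed
  show ?thesis
  proof (cases "f (map (w(i := True)) [0..<n])")
    case True
    then have "1 - acc' x y \<le> 1 / 3" if "g (x, y) = Some True" for x y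
      unfolding acc'_def using val[OF that] by (intro T) simp
    moreover have "acc' x y \<le> 1 / 3" if "g (x, y) = Some False" for x y
      unfolding acc'_def using val[OF that] True sens by (intro F) simp
    ultimately show ?thesis unfolding quantum_computes_def using acc' by blast
  next
    case False
    then have "acc' x y \<le> 1 / 3" if "g (x, y) = Some True" for x y
      unfolding acc'_def using val[OF that] by (intro F) simp
    moreover have "1 - acc' x y \<le> 1 / 3" if "g (x, y) = Some False" for x y
      unfolding acc'_def using val[OF that] False sens by (intro T) simp
    ultimately show ?thesis
      unfolding quantum_computes_def
      by (intro exI[of _ "\<lambda>x y. 1 - acc' x y"] conjI quantum_acceptance_compl[OF acc']) auto
  qed
qed

text \<open>The tree makes at most \<open>D\<close> queries; with error at most
  \<open>1 / (3 * D)\<close> each, the total stays within 1/3.\<close>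

lemma randomized_computes_block_composition:
  assumes n: "1 \<le> n" and R: "randomized_computes cg g"
    and Q: "quantum_computes c (block_composition n k f g)"
    and W: "spectral_witness k g r" "r * real n \<le> 1 / 4"
  shows "randomized_computes (32 * ((22 * (c + 2)\<^sup>2) ^ 4) ^ 6 * cg) (block_composition n k f g)"
proof -
  define G where "G z = f (map z [0..<n])" for z
  define D where "D = (22 * (c + 2)\<^sup>2) ^ 4"
  have D: "1 \<le> D" by (simp add: D_def)
  define Fs where "Fs = {S. S \<subseteq> {..<n} \<and> card S \<le> c + 2}"
  obtain coef where coef: "\<And>z. let q = (\<Sum>S\<in>Fs. coef S * parity_char S z) in
      - (1 / 16) \<le> q \<and> q \<le> 17 / 16 \<and> (if G z then 2 / 3 - 1 / 16 \<le> q else q \<le> 1 / 3 + 1 / 16)"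
    using quantum_approximate_degree[OF Q W] unfolding G_def Fs_def by blast
  define q where "q z = (\<Sum>S\<in>Fs. coef S * parity_char S z)" for z
  have cf: "- (1 / 16) \<le> q z" "q z \<le> 17 / 16"
      "if G z then 2 / 3 - 1 / 16 \<le> q z else q z \<le> 1 / 3 + 1 / 16" for z
    using coef[of z] unfolding q_def Let_def by blast+
  have "finite Fs" by (rule finite_subset[of _ "Pow {..<n}"]) (auto simp: Fs_def)
  have c2: "1 \<le> c + 2" by simp
  have Fs: "finite S \<and> card S \<le> c + 2" if "S \<in> Fs" for S
    using that by (auto simp: Fs_def intro: finite_subset)
  have "tree_computes n D UNIV G"
    unfolding D_def
  proof (rule decision_tree_from_block_sensitivity)
    show "G z = G z'" if "\<And>i. i < n \<Longrightarrow> z i = z' i" for z z'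
    proof -
      have "map z [0..<n] = map z' [0..<n]" using that by simp
      then show ?thesis unfolding G_def by (rule arg_cong)
    qed
    show "card Bs \<le> 22 * (c + 2)\<^sup>2"
      if "finite Bs" "disjoint Bs" "\<And>B. B \<in> Bs \<Longrightarrow> G (flip z B) \<noteq> G z" for z Bs
      by (rule block_sensitivity_bound[OF \<open>finite Fs\<close> Fs c2 q_def cf that])
  qed
  then obtain t where t: "tree_depth t \<le> D" "tree_vars t \<subseteq> {..<n}" "\<And>z. tree_eval t z = G z"
    unfolding tree_computes_def by blast
  \<comment> \<open>The tree reads functions on all naturals while \<open>f\<close> reads lists; the
    two agree on lists of length \<open>n\<close>, the only ones that the composition
    produces.\<close>
  have eq: "block_composition n k (\<lambda>bs. tree_eval t (\<lambda>i. bs ! i)) g = block_composition n k f g"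
  proof -
    have "f (map ((!) xs) [0..<n]) = f xs" if "length xs = n" for xs
      using map_nth[of xs] that by simp
    then show ?thesis by (simp add: fun_eq_iff block_composition_def t(3) G_def)
  qed
  have "randomized_computes_err (32 * D ^ 5 * cg) (1 / (3 * real D)) g"
    using R D by (intro randomized_computes_err_amplify) (simp_all add: randomized_computes_iff_err)
  from randomized_computes_err_tree[OF this _ t(2), of k]
  have "randomized_computes_err (tree_depth t * (32 * D ^ 5 * cg)) (real (tree_depth t) * (1 / (3 * real D)))
      (block_composition n k f g)"
    by (simp add: eq)
  moreover have "tree_depth t * (32 * D ^ 5 * cg) \<le> 32 * D ^ 6 * cg"
  proof -
    have "tree_depth t * (32 * D ^ 5 * cg) \<le> D * (32 * D ^ 5 * cg)"
      using t(1) by (rule mult_right_mono) simp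
    moreover have "D ^ 6 = D * D ^ 5" by (simp flip: power_Suc)
    ultimately show ?thesis by (simp only: mult_ac)
  qed
  moreover have "real (tree_depth t) * (1 / (3 * real D)) \<le> 1 / 3"
    using t(1) D by (simp add: field_simps)
  ultimately show ?thesis
    unfolding randomized_computes_iff_err D_def[symmetric] by (rule randomized_computes_err_mono)
qed

section \<open>Degenerate cases and attained minima\<close>

text \<open>Without communication a protocol is constant, so it errs on one of the two inputs; the
  two error probabilities sum to at least 1, more than 2/3.\<close>

lemma not_randomized_computes_0:
  assumes "g (x0, y0) = Some False" "g (x1, y1) = Some True"
  shows "\<not> randomized_computes 0 g"
proof
  assume "randomized_computes 0 g"
  then obtain P where P: "\<And>p. p \<in> set_pmf P \<Longrightarrow> cost p = 0"
    "\<And>x y b. g (x, y) = Some b \<Longrightarrow> measure_pmf.prob P {p. run p x y \<noteq> b} \<le> 1 / 3"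
    unfolding randomized_computes_def by auto
  have "run p x0 y0 = run p x1 y1" if "p \<in> set_pmf P" for p
    using P(1)[OF that] by (cases p) auto
  then have sub: "set_pmf P \<subseteq> {p. run p x0 y0 \<noteq> False} \<union> {p. run p x1 y1 \<noteq> True}" by blast
  have "1 = measure_pmf.prob P (set_pmf P)" by (simp add: measure_pmf.prob_eq_1 AE_measure_pmf)
  also have "\<dots> \<le> measure_pmf.prob P ({p. run p x0 y0 \<noteq> False} \<union> {p. run p x1 y1 \<noteq> True})"
    by (rule measure_pmf.finite_measure_mono[OF sub]) simp
  also have "\<dots> \<le> measure_pmf.prob P {p. run p x0 y0 \<noteq> False} + measure_pmf.prob P {p. run p x1 y1 \<noteq> True}"
    by (rule measure_Un_le) auto
  also have "\<dots> \<le> 1 / 3 + 1 / 3" by (intro add_mono P(2) assms)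
  finally show False by simp
qed

lemma randomized_computes_R_cc:
  assumes "finite (fst ` dom F)"
  shows "randomized_computes (R_cc F) F"
proof -
  obtain c where "randomized_computes_err c 0 F" using randomized_computes_err_exists[OF assms] ..
  then have "randomized_computes c F"
    unfolding randomized_computes_iff_err by (rule randomized_computes_err_mono) auto
  then show ?thesis unfolding R_cc_def by (rule LeastI)
qed

lemma quantum_computes_Q_cc:
  assumes "finite (fst ` dom F)"
  shows "quantum_computes (Q_cc F) F"
  using quantum_computes_exists[OF assms] unfolding Q_cc_def by (rule LeastI_ex)

lemma R_cc_le: "randomized_computes c F \<Longrightarrow> R_cc F \<le> c"
  unfolding R_cc_def by (rule Least_le)

lemma Q_cc_le: "quantum_computes c F \<Longrightarrow> Q_cc F \<le> c"
  unfolding Q_cc_def by (rule Least_le)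

lemma finite_fst_dom:
  assumes "dom F \<subseteq> bitstrings k \<times> bitstrings l"
  shows "finite (fst ` dom F)"
  using assms finite_bitstrings by (meson finite_SigmaI finite_imageI finite_subset)

lemma dom_block_composition:
  "dom (block_composition n k f g) \<subseteq> bitstrings (n * k) \<times> bitstrings (n * k)"
  by (auto simp: block_composition_def split: if_splits)

text \<open>Separates off the case in which \<open>g\<close> cannot be recovered from the
  composition and the quantum cost gives no information.\<close>

lemma R_cc_block_composition_constant:
  assumes "\<And>bs bs'. length bs = n \<Longrightarrow> length bs' = n \<Longrightarrow> f bs = f bs'"
  shows "R_cc (block_composition n k f g) = 0"
proof -
  have "randomized_computes_err 0 (1 / 3) (block_composition n k f g)"
  proof (rule randomized_computes_err_output)
    fix x y b assume "block_composition n k f g (x, y) = Some b"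
    then have "b = f (map (\<lambda>i. the (g (block k i x, block k i y))) [0..<n])"
      by (auto simp: block_composition_def split: if_splits)
    then show "b = f (replicate n False)" using assms by simp
  qed simp
  then show ?thesis using R_cc_le unfolding randomized_computes_iff_err by fastforce
qed

theorem theorem4p1:
  fixes C a :: real
  assumes "C \<ge> 1" and "a \<ge> 1"
  shows "\<exists>C' a' :: real. C' \<ge> 1 \<and> a' \<ge> 1 \<and>
    (\<forall>(n :: nat) (k :: nat) (g :: bool list \<times> bool list \<Rightarrow> bool option) (f :: bool list \<Rightarrow> bool).
       n \<ge> 1 \<longrightarrow> k \<ge> 1 \<longrightarrow>
       dom g \<subseteq> bitstrings k \<times> bitstrings k \<longrightarrow>
       spectral_discrepancy k g \<le> ereal (1 / (2 * exp 1 * real n)) \<longrightarrow>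
       real (R_cc g) \<le> C * real (Q_cc g) powr a \<longrightarrow>
       real (R_cc (block_composition n k f g))
         \<le> C' * real (Q_cc (block_composition n k f g)) powr a')"
proof (intro exI conjI allI impI)
  \<comment> \<open>198 is 22 * 9, from bounding \<open>c + 2\<close> by \<open>3 * c\<close>; 24 is
    4 * 6, from the depth \<open>K ^ 4\<close> and the sixth power of \<open>D\<close>; 48 is the
    resulting power of \<open>c\<close>.\<close>
  show "32 * 198 ^ 24 * C \<ge> 1" "48 + a \<ge> 1" using assms by auto
  fix n k :: nat and g :: "bool list \<times> bool list \<Rightarrow> bool option" and f :: "bool list \<Rightarrow> bool"
  assume n: "n \<ge> 1" and dom: "dom g \<subseteq> bitstrings k \<times> bitstrings k"
    and \<rho>: "spectral_discrepancy k g \<le> ereal (1 / (2 * exp 1 * real n))"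
    and RQ: "real (R_cc g) \<le> C * real (Q_cc g) powr a"
  define F where "F = block_composition n k f g"
  define c where "c = Q_cc F"
  have "real (R_cc F) \<le> 32 * 198 ^ 24 * C * real c powr (48 + a)"
  proof (cases "\<forall>bs bs'. length bs = n \<longrightarrow> length bs' = n \<longrightarrow> f bs = f bs'")
    case True
    then have "R_cc F = 0" unfolding F_def by (intro R_cc_block_composition_constant) blast
    then show ?thesis using assms(1) by simp
  next
    case False
    then obtain bs bs' where bs: "length bs = n" "length bs' = n" "f bs \<noteq> f bs'" by blast
    obtain r where r: "spectral_witness k g r" "r * real n \<le> 1 / 4"
      using spectral_witness_of_discrepancy[OF n \<rho>] by blast
    have Qc: "quantum_computes c (block_composition n k f g)"
      unfolding c_def F_def by (rule quantum_computes_Q_cc[OF finite_fst_dom[OF dom_block_composition]])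
    have nth: "map ((!) bs) [0..<n] = bs" "map ((!) bs') [0..<n] = bs'" using map_nth[of bs] map_nth[of bs'] bs(1,2) by simp_all
    have "\<exists>w i. i < n \<and> f (map (w(i := True)) [0..<n]) \<noteq> f (map (w(i := False)) [0..<n])"
    proof (rule sensitive_input_exists[where G = "\<lambda>z. f (map z [0..<n])"])
      show "f (map ((!) bs) [0..<n]) \<noteq> f (map ((!) bs') [0..<n])" using bs nth by simp
      show "f (map z [0..<n]) = f (map z' [0..<n])" if "\<And>i. i < n \<Longrightarrow> z i = z' i" for z z'
      proof -
        have "map z [0..<n] = map z' [0..<n]" using that by simp
        then show ?thesis by (rule arg_cong)
      qed
    qed
    then have "quantum_computes c g" using quantum_computes_restrict[OF Qc r(1) dom] by blast
    then have Qg: "Q_cc g \<le> c" by (rule Q_cc_le)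
    have Rg: "randomized_computes (R_cc g) g" by (rule randomized_computes_R_cc[OF finite_fst_dom[OF dom]])
    have "R_cc g \<noteq> 0"
    proof
      assume "R_cc g = 0"
      moreover obtain x0 y0 x1 y1 where "g (x0, y0) = Some False" "g (x1, y1) = Some True"
        using spectral_witness_values[OF r(1)] by metis
      ultimately show False using Rg not_randomized_computes_0 by metis
    qed
    \<comment> \<open>Zero quantum cost would force \<open>R_cc g = 0\<close>, since
      \<open>0 powr a = 0\<close>. The conclusion gives \<open>c \<ge> 1\<close>, which allows
      \<open>c + 2\<close> to be replaced by a multiple of \<open>c\<close>.\<close>
    then have "Q_cc g \<noteq> 0" using RQ assms(2) by (intro notI) simp
    then have c: "1 \<le> c" using Qg by simp
    define K where "K = 22 * (c + 2)\<^sup>2"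
    have "K \<le> 22 * (3 * c)\<^sup>2" unfolding K_def using c by (intro power_mono mult_left_mono) auto
    also have "\<dots> = 198 * c\<^sup>2" by (simp add: power2_eq_square)
    finally have "K ^ 24 \<le> (198 * c\<^sup>2) ^ 24" by (rule power_mono) simp
    also have "\<dots> = 198 ^ 24 * c ^ 48" unfolding power_mult_distrib power_mult[symmetric] by simp
    finally have K: "K ^ 24 \<le> 198 ^ 24 * c ^ 48" .
    have "R_cc F \<le> 32 * (K ^ 4) ^ 6 * R_cc g"
      unfolding F_def K_def by (rule R_cc_le[OF randomized_computes_block_composition[OF n Rg Qc r]])
    also have "(K ^ 4) ^ 6 = K ^ 24" unfolding power_mult[symmetric] by simp
    also have "32 * K ^ 24 * R_cc g \<le> 32 * (198 ^ 24 * c ^ 48) * R_cc g"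
      by (intro mult_le_mono K order_refl)
    finally have "real (R_cc F) \<le> real (32 * (198 ^ 24 * c ^ 48) * R_cc g)" by (rule of_nat_mono)
    also have "\<dots> = 32 * 198 ^ 24 * real c ^ 48 * real (R_cc g)"
      by (simp only: of_nat_mult of_nat_power of_nat_numeral mult.assoc)
    also have "\<dots> \<le> 32 * 198 ^ 24 * real c ^ 48 * (C * real c powr a)"
    proof (intro mult_left_mono)
      have "real (R_cc g) \<le> C * real (Q_cc g) powr a" by (rule RQ)
      also have "\<dots> \<le> C * real c powr a"
        using Qg assms by (intro mult_left_mono powr_mono2) auto
      finally show "real (R_cc g) \<le> C * real c powr a" .
    qed auto
    also have "\<dots> = 32 * 198 ^ 24 * C * (real c powr 48 * real c powr a)"
      using c powr_realpow[of "real c" 48] by simp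
    also have "real c powr 48 * real c powr a = real c powr (48 + a)" by (simp add: powr_add)
    finally show ?thesis .
  qed
  then show "real (R_cc (block_composition n k f g))
      \<le> 32 * 198 ^ 24 * C * real (Q_cc (block_composition n k f g)) powr (48 + a)"
    by (simp only: c_def F_def)
qed

end
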